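(* Let $A\in\mathbb{R}^{n\times n}$, $B\in\mathbb{R}^{n\times m}$, and consider the system $x(t+1)=Ax(t)+Bu(t)$. Let $T\ge1$, let $T_1,\dots,T_M$ be the experiment horizons, let $k_1,\dots,k_\ell\in\{1,\dots,M\}$ be (possibly repeated) indices such that $\sum_{i=1}^{\ell}T_{k_i}=T$, and let $x_0,x_{\mathrm f}\in\mathbb{R}^n$ be such that $x_{\mathrm f}$ is reachable in $T$ steps from $x_0$. Assume that the dataset, with $N$ experiments for each horizon, is corrupted by noise, i.e. for all $i\in\{1,\dots,M\}$ the available data matrices are $$U_i=\bar U_i+W_{U_i},\qquad X_{0,i}=\bar X_{0,i}+W_{X_{0,i}},\qquad X_i=\bar X_i+W_{X_i},$$ where $\bar U_i,\bar X_{0,i},\bar X_i$ are the true (noiseless) data matrices and the entries of $W_{U_i},W_{X_{0,i}},W_{X_i}$ are mutually independent random variables with zero mean, identically distributed within each of these matrices, with known variances $\sigma_U^2,\sigma_{X_0}^2,\sigma_X^2$, respectively (the same for all $i$). Assume that $\begin{bmatrix}\bar X_{0,k_i}\\ \bar U_{k_i}\end{bmatrix}$ has full row rank for all $i\in\{1,\dots,\ell\}$ (for $N$ large enough). Define, for $i\in\{1,\dots,\ell\}$, $$\Pi_{X_{0,k_i},c}=I-X_{0,k_i}^{\mathsf T}(X_{0,k_i}X_{0,k_i}^{\mathsf T}-N\sigma_{X_0}^2I)^{\dagger}X_{0,k_i},\qquad \Pi_{U_{k_i},c}=I-U_{k_i}^{\mathsf T}(U_{k_i}U_{k_i}^{\mathsf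 T}-N\sigma_U^2I)^{\dagger}U_{k_i},$$ $$Q_{i,c}=X_{k_i}\Pi_{U_{k_i},c}X_{0,k_i}^{\mathsf T}(X_{0,k_i}\Pi_{U_{k_i},c}X_{0,k_i}^{\mathsf T}-N\sigma_{X_0}^2I)^{\dagger},$$ $$L_{i,c}=X_{k_i}\Pi_{X_{0,k_i},c}U_{k_i}^{\mathsf T}(U_{k_i}\Pi_{X_{0,k_i},c}U_{k_i}^{\mathsf T}-N\sigma_U^2I)^{\dagger},$$ $$\hat C_{T,c}=\begin{bmatrix}L_{\ell,c}&Q_{\ell,c}L_{\ell-1,c}&\cdots&Q_{\ell,c}Q_{\ell-1,c}\cdots Q_{2,c}L_{1,c}\end{bmatrix},$$ $$u_{T,c}''=\hat C_{T,c}^{\dagger}\begin{bmatrix}-Q_{\ell,c}Q_{\ell-1,c}\cdots Q_{1,c}&I\end{bmatrix}\begin{bmatrix}x_0\\ x_{\mathrm f}\end{bmatrix}.$$ Then $u_{T,c}''$ converges almost surely, as $N\to\infty$, to the $T$-steps minimum-energy control input $u_T^*$ driving the system from $x_0$ to $x_{\mathrm f}$.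
   Context: System: $x(t+1)=Ax(t)+Bu(t)$, $x(0)=x_0\in\mathbb{R}^n$, with $x(t)\in\mathbb{R}^n$, $u(t)\in\mathbb{R}^m$. The $T$-steps controllability matrix is $C_T=[B\ \ AB\ \cdots\ A^{T-1}B]$. A $T$-steps input sequence is written in reversed time order as $u_T=[u(T-1)^{\mathsf T},\dots,u(0)^{\mathsf T}]^{\mathsf T}\in\mathbb{R}^{mT}$, so that $x(T)=A^Tx(0)+C_Tu_T$. True dataset: there are $M$ distinct horizons $T_1,\dots,T_M\in\mathbb{N}$ (positive integers). For each $i$, $N$ experiments of horizon $T_i$ are performed with arbitrary inputs and initial states. $\bar U_i\in\mathbb{R}^{mT_i\times N}$, $\bar X_{0,i}\in\mathbb{R}^{n\times N}$, $\bar X_i\in\mathbb{R}^{n\times N}$ collect as columns the true input sequences (each stacked in reversed time order, i.e. as $[u(T_i-1)^{\mathsf T},\dots,u(0)^{\mathsf T}]^{\mathsf T}$), the true initial states, and the true states at time $T_i$, respectively; thus $\bar X_i=A^{T_i}\bar X_{0,i}+C_{T_i}\bar U_i$. The limit $N\to\infty$ means that more and more experiments (columns) are added to each data matrix. Reachability: $x_{\mathrm f}$ is reachable in $T$ steps from $x_0$ if $x_{\mathrm f}-A^Tx_0\in\operatorname{Im}(C_T)$. Minimum-energy control: $u_T^*$ is the unique minimizer of $\|u_T\|_2^2$ over $u_T\in\mathbb{R}^{mT}$ subject to $x(t+1)=Ax(t)+Bu(t)$, $x(0)=x_0$, $x(T)=x_{\mathrm f}$; under reachability, $u_T^*=C_T^\dagger(x_{\mathrm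 f}-A^Tx_0)$. Notation: $(\cdot)^\dagger$ is the Moore–Penrose pseudoinverse.
   Formalization: Two hypotheses are added, without which the claim fails: for each used index the smallest eigenvalue of ZZ^T/N, with Z the stacked true initial states and inputs, stays bounded away from 0 as N→∞; and C_T has full rank min(n, mT). *)

theory Defs
  imports "HOL-Probability.Probability" "Jordan_Normal_Form.DL_Rank"
begin

unbundle no vec_syntax

section \<open>Matrices of variable size\<close>

definition append_cols :: "real mat \<Rightarrow> real mat \<Rightarrow> real mat" (infixr \<open>@\<^sub>c\<close> 65) where
  "A @\<^sub>c B = four_block_mat A B (0\<^sub>m 0 (dim_col A)) (0\<^sub>m 0 (dim_col B))"

definition block_row :: "nat \<Rightarrow> real mat list \<Rightarrow> real mat" where
  "block_row n Ms = foldr (@\<^sub>c) Ms (0\<^sub>m n 0)"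

definition prod_mats :: "nat \<Rightarrow> real mat list \<Rightarrow> real mat" where
  "prod_mats n Ms = foldr (*) Ms (1\<^sub>m n)"

definition is_pinv :: "real mat \<Rightarrow> real mat \<Rightarrow> bool" where
  "is_pinv A P \<longleftrightarrow> P \<in> carrier_mat (dim_col A) (dim_row A)
     \<and> A * P * A = A \<and> P * A * P = P
     \<and> (A * P)\<^sup>T = A * P \<and> (P * A)\<^sup>T = P * A"

definition pinv :: "real mat \<Rightarrow> real mat" where
  "pinv A = (THE P. is_pinv A P)"

definition full_row_rank :: "real mat \<Rightarrow> bool" where
  "full_row_rank A \<longleftrightarrow> vec_space.rank (dim_row A) A = dim_row A"

definition vec_tendsto :: "(nat \<Rightarrow> real vec) \<Rightarrow> real vec \<Rightarrow> bool" where
  "vec_tendsto f v \<longleftrightarrow> (\<forall>N. dim_vec (f N) = dim_vec v)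
     \<and> (\<forall>j < dim_vec v. (\<lambda>N. f N $ j) \<longlonglongrightarrow> v $ j)"

section \<open>Linear systems and minimum-energy control\<close>

fun state_at :: "real mat \<Rightarrow> real mat \<Rightarrow> real vec \<Rightarrow> (nat \<Rightarrow> real vec) \<Rightarrow> nat \<Rightarrow> real vec" where
  "state_at A B x0 u 0 = x0"
| "state_at A B x0 u (Suc t) = A *\<^sub>v state_at A B x0 u t + B *\<^sub>v u t"

text \<open>Input sequences are stacked in reversed time order: the block of a stacked vector with
  offset \<open>s * m\<close> is the input at time \<open>T - 1 - s\<close>.\<close>

definition input_at :: "nat \<Rightarrow> nat \<Rightarrow> real vec \<Rightarrow> nat \<Rightarrow> real vec" where
  "input_at m T uT t = vec m (\<lambda>r. uT $ ((T - 1 - t) * m + r))"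

definition final_state :: "real mat \<Rightarrow> real mat \<Rightarrow> nat \<Rightarrow> real vec \<Rightarrow> real vec \<Rightarrow> real vec" where
  "final_state A B T x0 uT = state_at A B x0 (input_at (dim_col B) T uT) T"

definition ctrb :: "real mat \<Rightarrow> real mat \<Rightarrow> nat \<Rightarrow> real mat" where
  "ctrb A B T = block_row (dim_row A) (map (\<lambda>s. A ^\<^sub>m s * B) [0..<T])"

definition reachable :: "real mat \<Rightarrow> real mat \<Rightarrow> nat \<Rightarrow> real vec \<Rightarrow> real vec \<Rightarrow> bool" where
  "reachable A B T x0 xf \<longleftrightarrow>
     (\<exists>w \<in> carrier_vec (dim_col B * T). ctrb A B T *\<^sub>v w = xf - A ^\<^sub>m T *\<^sub>v x0)"

definition steering_inputs ::
  "real mat \<Rightarrow> real mat \<Rightarrow> nat \<Rightarrow> real vec \<Rightarrow> real vec \<Rightarrow> real vec set" where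
  "steering_inputs A B T x0 xf =
     {uT \<in> carrier_vec (dim_col B * T). final_state A B T x0 uT = xf}"

definition is_min_energy_control ::
  "real mat \<Rightarrow> real mat \<Rightarrow> nat \<Rightarrow> real vec \<Rightarrow> real vec \<Rightarrow> real vec \<Rightarrow> bool" where
  "is_min_energy_control A B T x0 xf u \<longleftrightarrow> u \<in> steering_inputs A B T x0 xf
     \<and> (\<forall>w \<in> steering_inputs A B T x0 xf. w \<noteq> u \<longrightarrow> u \<bullet> u < w \<bullet> w)"

section \<open>Data and noise\<close>

definition data_mat :: "nat \<Rightarrow> (nat \<Rightarrow> real vec) \<Rightarrow> nat \<Rightarrow> real mat" where
  "data_mat d f N = mat d N (\<lambda>(r, j). f j $ r)"

definition noise_mat :: "nat \<Rightarrow> (nat \<Rightarrow> nat \<Rightarrow> 'w \<Rightarrow> real) \<Rightarrow> nat \<Rightarrow> 'w \<Rightarrow> real mat" where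
  "noise_mat d W N \<omega> = mat d N (\<lambda>(r, j). W r j \<omega>)"

text \<open>Noise entries are indexed by row and column; adding experiments adds columns, so the
  column index ranges over all natural numbers.\<close>

definition centred_iid_entries ::
  "'w measure \<Rightarrow> nat \<Rightarrow> real \<Rightarrow> (nat \<Rightarrow> nat \<Rightarrow> 'w \<Rightarrow> real) \<Rightarrow> bool" where
  "centred_iid_entries P d \<sigma> W \<longleftrightarrow>
     (\<forall>r < d. \<forall>j. W r j \<in> borel_measurable P
        \<and> integrable P (W r j) \<and> (\<integral>\<omega>. W r j \<omega> \<partial>P) = 0
        \<and> integrable P (\<lambda>\<omega>. (W r j \<omega>)\<^sup>2) \<and> (\<integral>\<omega>. (W r j \<omega>)\<^sup>2 \<partial>P) = \<sigma>\<^sup>2)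
   \<and> (\<forall>r < d. \<forall>r' < d. \<forall>j j'. distr P borel (W r j) = distr P borel (W r' j'))"

datatype block = Input | Initial | Final

definition mutually_indep_entries ::
  "'w measure \<Rightarrow> nat \<Rightarrow> nat \<Rightarrow> (nat \<Rightarrow> nat \<Rightarrow> 'w \<Rightarrow> real) \<Rightarrow> (nat \<Rightarrow> nat \<Rightarrow> 'w \<Rightarrow> real)
     \<Rightarrow> (nat \<Rightarrow> nat \<Rightarrow> 'w \<Rightarrow> real) \<Rightarrow> bool" where
  "mutually_indep_entries P dU n WU WX0 WX \<longleftrightarrow>
     prob_space.indep_vars P (\<lambda>_. borel)
       (\<lambda>(b, r, j). case b of Input \<Rightarrow> WU r j | Initial \<Rightarrow> WX0 r j | Final \<Rightarrow> WX r j)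
       {(b, r, j). r < (case b of Input \<Rightarrow> dU | Initial \<Rightarrow> n | Final \<Rightarrow> n)}"

text \<open>The full-row-rank condition at the scale \<open>1/N\<close> on which the limit is taken: the smallest
  eigenvalue of \<open>Z\<^sub>N * Z\<^sub>N\<^sup>T / N\<close> stays bounded away from zero. Full row rank of every \<open>Z\<^sub>N\<close>
  alone allows the data to be dominated by the noise: if only finitely many columns are non-zero,
  \<open>Z\<^sub>N * Z\<^sub>N\<^sup>T\<close> is bounded, whereas the fluctuation of the noise part of the corrected Gram
  matrix is of order \<open>sqrt N\<close>.\<close>

definition persistent_full_row_rank :: "(nat \<Rightarrow> real mat) \<Rightarrow> nat \<Rightarrow> bool" where
  "persistent_full_row_rank Z p \<longleftrightarrow>
     (\<exists>c > 0. \<forall>\<^sub>F N in sequentially. \<forall>v \<in> carrier_vec p.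
        c * (v \<bullet> v) \<le> (((Z N)\<^sup>T *\<^sub>v v) \<bullet> ((Z N)\<^sup>T *\<^sub>v v)) / real N)"

section \<open>Noise-corrected estimators\<close>

definition corr_gram_pinv :: "real \<Rightarrow> nat \<Rightarrow> real mat \<Rightarrow> real mat" where
  "corr_gram_pinv \<sigma> N G = pinv (G - (real N * \<sigma>\<^sup>2) \<cdot>\<^sub>m 1\<^sub>m (dim_row G))"

definition corr_proj :: "real \<Rightarrow> nat \<Rightarrow> real mat \<Rightarrow> real mat" where
  "corr_proj \<sigma> N Z = 1\<^sub>m N - Z\<^sup>T * corr_gram_pinv \<sigma> N (Z * Z\<^sup>T) * Z"

definition Qc :: "real \<Rightarrow> real \<Rightarrow> nat \<Rightarrow> real mat \<Rightarrow> real mat \<Rightarrow> real mat \<Rightarrow> real mat" where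
  "Qc \<sigma>U \<sigma>X0 N U X0 X =
     X * corr_proj \<sigma>U N U * X0\<^sup>T * corr_gram_pinv \<sigma>X0 N (X0 * corr_proj \<sigma>U N U * X0\<^sup>T)"

definition Lc :: "real \<Rightarrow> real \<Rightarrow> nat \<Rightarrow> real mat \<Rightarrow> real mat \<Rightarrow> real mat \<Rightarrow> real mat" where
  "Lc \<sigma>U \<sigma>X0 N U X0 X =
     X * corr_proj \<sigma>X0 N X0 * U\<^sup>T * corr_gram_pinv \<sigma>U N (U * corr_proj \<sigma>X0 N X0 * U\<^sup>T)"

text \<open>\<open>desc_prod n Q i l\<close> is the product of \<open>Q l, Q (l - 1), \<dots>, Q i\<close> in this order, and the
  identity for \<open>l < i\<close>.\<close>

definition desc_prod :: "nat \<Rightarrow> (nat \<Rightarrow> real mat) \<Rightarrow> nat \<Rightarrow> nat \<Rightarrow> real mat" where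
  "desc_prod n Q i l = prod_mats n (map Q (rev [i..<Suc l]))"

definition ctrb_est :: "nat \<Rightarrow> (nat \<Rightarrow> real mat) \<Rightarrow> (nat \<Rightarrow> real mat) \<Rightarrow> nat \<Rightarrow> real mat" where
  "ctrb_est n Q L l = block_row n (map (\<lambda>i. desc_prod n Q (Suc i) l * L i) (rev [1..<Suc l]))"

definition control_est ::
  "nat \<Rightarrow> (nat \<Rightarrow> real mat) \<Rightarrow> (nat \<Rightarrow> real mat) \<Rightarrow> nat \<Rightarrow> real vec \<Rightarrow> real vec \<Rightarrow> real vec" where
  "control_est n Q L l x0 xf =
     pinv (ctrb_est n Q L l) *\<^sub>v (((- desc_prod n Q 1 l) @\<^sub>c 1\<^sub>m n) *\<^sub>v (x0 @\<^sub>v xf))"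

end

theory Submission
  imports Defs
begin

text \<open>
  For one horizon put \<open>Z = Zb + W\<close>, where \<open>Zb\<close> stacks the true initial states over the true inputs and
  \<open>W\<close> is the noise. By block elimination \<open>Q\<close> and \<open>L\<close> are the two blocks of the solution \<open>H\<close> of
  \<open>H * S = X * Z\<^sup>T\<close>, where \<open>S = Z * Z\<^sup>T - N * \<Sigma>\<close> and \<open>\<Sigma>\<close> is the diagonal matrix of the noise variances, whereas the true
  \<open>F = [A ^ T, C]\<close> satisfies the same equation up to products of noise with noise (\<open>o(N)\<close> by the strong
  law of large numbers) and products \<open>Zb * w\<close> of true data with a noise row.

  The true data may grow arbitrarily fast, so \<open>Zb * w\<close> need not be \<open>o(N)\<close>; it has to be compared with the
  Gram matrix \<open>G = Zb * Zb\<^sup>T\<close>. If \<open>V\<^sub>N\<close> is the squared length of the projection of \<open>w\<close> to the row space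
  of \<open>Zb\<close>, then \<open>(h \<bullet> (Zb * w))\<^sup>2 \<le> (h \<bullet> (G * h)) * V\<^sub>N\<close>. The mean of \<open>V\<^sub>N\<close> is bounded, and
  \<open>V\<^sub>N - V\<^sub>M\<close> is at most the sum of the squares of the noise between \<open>M\<close> and \<open>N\<close>, because the residual sum of squares is
  monotone in \<open>N\<close>. Borel--Cantelli along fourth powers and the strong law then give \<open>V\<^sub>N = o(N)\<close>.
  With \<open>G \<ge> c * N\<close> this makes \<open>S\<close> eventually coercive and \<open>H\<close> converge to \<open>F\<close>. Finally, \<open>pinv\<close> is
  continuous at matrices of full rank.
\<close>

section \<open>The strong law of large numbers\<close>

text \<open>The Gram matrix \<open>G\<close> divided by \<open>N\<close> need neither converge nor
  stay bounded, so there is no limiting system of normal equations that could be inverted. An energy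
  estimate takes its place: the equation for the error \<open>h = H - F\<close> is tested with
  \<open>h\<close> itself. Coercivity of \<open>S\<close> bounds the left side from below by half of
  \<open>q = h \<bullet> (G * h)\<close>, and every term on the right is at most
  \<open>sqrt (q * N)\<close> times a quantity that tends to 0. Dividing by \<open>sqrt q\<close>
  and using \<open>G \<ge> c * N\<close> once more makes \<open>N\<close> cancel. The bounds have to
  hold for all \<open>h\<close> at the same \<open>N\<close>, because \<open>h\<close> depends on
  \<open>N\<close> and on the noise; the projection length \<open>V\<close> serves all
  \<open>h\<close> at once.

  Only second moments of the noise are assumed. Its squares are then merely integrable, which calls
  for a law of large numbers without a variance bound. Products of two different noise rows have
  orthogonal summands. The true data are deterministic, so the mean of \<open>V\<close> is the noise
  variance times the trace of a projection, that is, times the number of regressors.\<close>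

lemma (in prob_space) AE_tendsto_zero_if_summable_expectation:
  fixes f :: "nat \<Rightarrow> 'a \<Rightarrow> real"
  assumes int: "\<And>n. integrable M (f n)" and nonneg: "\<And>n x. 0 \<le> f n x"
    and bound: "\<And>m. (\<Sum>n<m. expectation (f n)) \<le> C"
  shows "AE x in M. (\<lambda>n. f n x) \<longlonglongrightarrow> 0"
proof -
  have C: "(\<Sum>n. ennreal (expectation (f n))) \<le> ennreal C"
    by (rule suminf_le_const) (auto simp: sum_ennreal nonneg bound ennreal_leI)
  have "(\<integral>\<^sup>+x. (\<Sum>n. ennreal (f n x)) \<partial>M) = (\<Sum>n. \<integral>\<^sup>+x. ennreal (f n x) \<partial>M)"
    using int by (intro nn_integral_suminf) auto
  also have "\<dots> = (\<Sum>n. ennreal (expectation (f n)))"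
    using int nonneg by (simp add: nn_integral_eq_integral)
  finally have "(\<integral>\<^sup>+x. (\<Sum>n. ennreal (f n x)) \<partial>M) \<noteq> \<infinity>"
    using C by (metis ennreal_less_top infinity_ennreal_def leD)
  \<comment> \<open>A series of nonnegative terms with finite expectation is finite almost surely;
    this does the work of Markov's inequality and the Borel--Cantelli lemma at once.\<close>
  then have "AE x in M. (\<Sum>n. ennreal (f n x)) \<noteq> \<infinity>"
    using int by (intro nn_integral_noteq_infinite) auto
  then show ?thesis
  proof eventually_elim
    case (elim x)
    then have "summable (\<lambda>n. f n x)"
      using nonneg by (intro summable_suminf_not_top) auto
    then show ?case by (rule summable_LIMSEQ_zero)
  qed
qed

text \<open>Orthogonality leaves only the diagonal of the double sum. Weights 1 give variances of
  partial sums; weights taken from two regressor rows give the covariance of their products with one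
  noise row, a multiple of an entry of the Gram matrix.\<close>

lemma (in prob_space) expectation_orthogonal_sums:
  fixes X :: "nat \<Rightarrow> 'a \<Rightarrow> real"
  assumes "\<And>i j. integrable M (\<lambda>x. X i x * X j x)"
    and "\<And>i j. expectation (\<lambda>x. X i x * X j x) = (if i = j then c else 0)"
  shows "integrable M (\<lambda>x. (\<Sum>i<N. a i * X i x) * (\<Sum>i<N. b i * X i x))" (is ?I)
    and "expectation (\<lambda>x. (\<Sum>i<N. a i * X i x) * (\<Sum>i<N. b i * X i x)) = c * (\<Sum>i<N. a i * b i)" (is ?E)
proof -
  have eq: "(\<Sum>i<N. a i * X i x) * (\<Sum>i<N. b i * X i x)
      = (\<Sum>i<N. \<Sum>j<N. (a i * b j) * (X i x * X j x))" for x
    by (simp add: sum_product mult_ac)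
  show ?I unfolding eq using assms(1) by (intro Bochner_Integration.integrable_sum) auto
  show ?E unfolding eq using assms
    by (simp add: Bochner_Integration.integral_sum Bochner_Integration.integrable_sum
        sum_distrib_left mult_ac if_distrib[of "\<lambda>t. _ * t"] cong: if_cong)
qed

text \<open>Values above the level become 0 rather than the level, and there is no cut from below:
  the function is meant for nonnegative variables.\<close>

definition trunc :: "real \<Rightarrow> real \<Rightarrow> real" where
  "trunc k y = (if y \<le> k then y else 0)"

lemma trunc_measurable [measurable]: "trunc k \<in> borel_measurable borel"
  unfolding trunc_def by measurable

text \<open>Only indices from the first \<open>n0\<close> with \<open>y \<le> k n0\<close> on
  contribute. Since \<open>k n\<close> lies between \<open>\<alpha> ^ n\<close> and
  \<open>2 * \<alpha> ^ n\<close>, their terms are dominated by a geometric series that starts at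
  \<open>2 * y\<close>. The bound is linear in \<open>y\<close>, so after taking expectations a
  finite mean controls the sum of the truncated second moments.\<close>

lemma sum_trunc_square_le:
  fixes \<alpha> y :: real
  assumes \<alpha>: "1 < \<alpha>" and y: "0 \<le> y"
  shows "(\<Sum>n<m. (trunc (nat \<lceil>\<alpha> ^ n\<rceil>) y)\<^sup>2 / nat \<lceil>\<alpha> ^ n\<rceil>) \<le> 2 * (1 / (1 - 1 / \<alpha>)) * y"
proof (cases "y = 0")
  case True then show ?thesis by (simp add: trunc_def)
next
  case False
  with y have y: "0 < y" by simp
  define k where "k n = nat \<lceil>\<alpha> ^ n\<rceil>" for n
  have a1: "1 \<le> \<alpha> ^ n" for n using \<alpha> by simp
  have k1: "\<alpha> ^ n \<le> k n" for n unfolding k_def by linarith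
  have k2: "k n \<le> 2 * \<alpha> ^ n" for n unfolding k_def using a1[of n] by linarith
  have ex: "\<exists>n. y \<le> k n"
    using real_arch_pow[OF \<alpha>, of y] k1 by (meson less_imp_le order_trans)
  define n0 where "n0 = (LEAST n. y \<le> k n)"
  have n0: "y \<le> k n0" unfolding n0_def using ex by (rule LeastI_ex)
  have le: "(trunc (k n) y)\<^sup>2 / k n \<le> (if n0 \<le> n then 2 * y * (1 / \<alpha>) ^ (n - n0) else 0)" for n
  proof (cases "y \<le> k n")
    case True
    then have nn: "n0 \<le> n" unfolding n0_def by (rule Least_le)
    have "y \<le> 2 * \<alpha> ^ n0" using n0 k2[of n0] by linarith
    also have "\<dots> = 2 * \<alpha> ^ n * (1 / \<alpha>) ^ (n - n0)"
      using nn \<alpha> by (simp add: power_one_over power_diff)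
    also have "\<dots> \<le> 2 * k n * (1 / \<alpha>) ^ (n - n0)"
      using k1[of n] \<alpha> by (intro mult_right_mono) auto
    finally have "y * y \<le> y * (2 * k n * (1 / \<alpha>) ^ (n - n0))"
      using y by (intro mult_left_mono) auto
    moreover have "0 < real (k n)" using k1[of n] a1[of n] by linarith
    ultimately show ?thesis using nn True
      by (simp add: trunc_def power2_eq_square divide_le_eq mult_ac)
  next
    case False then show ?thesis using y \<alpha> by (simp add: trunc_def)
  qed
  have "(\<Sum>n<m. (trunc (k n) y)\<^sup>2 / k n) \<le> (\<Sum>n<m. if n0 \<le> n then 2 * y * (1 / \<alpha>) ^ (n - n0) else 0)"
    by (intro sum_mono le)
  also have "\<dots> = (\<Sum>n\<in>{n0..<m}. 2 * y * (1 / \<alpha>) ^ (n - n0))"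
    by (intro sum.mono_neutral_cong_right) auto
  also have "\<dots> = (\<Sum>i<m - n0. 2 * y * (1 / \<alpha>) ^ i)"
    by (rule sum.reindex_bij_witness[of _ "\<lambda>i. i + n0" "\<lambda>n. n - n0"]) auto
  also have "\<dots> = 2 * y * (\<Sum>i<m - n0. (1 / \<alpha>) ^ i)" by (simp add: sum_distrib_left)
  also have "\<dots> \<le> 2 * y * (\<Sum>i. (1 / \<alpha>) ^ i)"
    using y \<alpha> by (intro mult_left_mono sum_le_suminf summable_geometric) auto
  also have "(\<Sum>i. (1 / \<alpha>) ^ i) = 1 / (1 - 1 / \<alpha>)"
    using \<alpha> by (intro suminf_geometric) auto
  finally show ?thesis by (simp add: k_def mult_ac)
qed

text \<open>The geometric subsequences determine the limit because the partial sums are monotone.\<close>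

lemma cesaro_from_geometric_subsequences:
  fixes S :: "nat \<Rightarrow> real"
  assumes mono: "mono S" and nonneg: "\<And>n. 0 \<le> S n"
    and sub: "\<And>i::nat. (\<lambda>n. S (nat \<lceil>(1 + 1 / Suc i) ^ n\<rceil>) / nat \<lceil>(1 + 1 / Suc i) ^ n\<rceil>) \<longlonglongrightarrow> \<mu>"
  shows "(\<lambda>N. S N / N) \<longlonglongrightarrow> \<mu>"
proof (rule LIMSEQ_I)
  fix e :: real assume e: "0 < e"
  \<comment> \<open>The final estimates for \<open>S N / N\<close> will be
    \<open>(\<mu> + d) * (1 + 2 * d)\<close> and \<open>(\<mu> - d) / (1 + d)\<close> with
    \<open>d = 1 / Suc i\<close>: one \<open>d\<close> for the error on the subsequence, one for the
    ratio \<open>\<alpha> = 1 + d\<close>, and a further one, above only, for rounding. The index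
    \<open>i\<close> is chosen to make both fall within \<open>e\<close> of
    \<open>\<mu>\<close>.\<close>
  have lim: "(\<lambda>i. (\<mu> + 1 / Suc i) * (1 + 2 / Suc i)) \<longlonglongrightarrow> (\<mu> + 0) * (1 + 0)"
    by (intro tendsto_intros lim_const_over_n LIMSEQ_Suc[OF lim_const_over_n])
  have lim': "(\<lambda>i. (\<mu> - 1 / Suc i) / (1 + 1 / Suc i)) \<longlonglongrightarrow> (\<mu> - 0) / (1 + 0)"
    by (intro tendsto_intros lim_const_over_n LIMSEQ_Suc[OF lim_const_over_n]) auto
  have "\<forall>\<^sub>F i in sequentially. (\<mu> + 1 / Suc i) * (1 + 2 / Suc i) < \<mu> + e"
    using lim e by (intro order_tendstoD) auto
  moreover have "\<forall>\<^sub>F i in sequentially. \<mu> - e < (\<mu> - 1 / Suc i) / (1 + 1 / Suc i)"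
    using lim' e by (intro order_tendstoD) auto
  ultimately have "\<forall>\<^sub>F i in sequentially. (\<mu> + 1 / Suc i) * (1 + 2 / Suc i) < \<mu> + e \<and>
      \<mu> - e < (\<mu> - 1 / Suc i) / (1 + 1 / Suc i)"
    by eventually_elim simp
  then obtain i :: nat where i: "(\<mu> + 1 / Suc i) * (1 + 2 / Suc i) < \<mu> + e"
      "\<mu> - e < (\<mu> - 1 / Suc i) / (1 + 1 / Suc i)"
    by (auto simp: eventually_sequentially)
  define d where "d = 1 / real (Suc i)"
  define \<alpha> where "\<alpha> = 1 + d"
  have d: "0 < d" by (simp add: d_def)
  have \<alpha>: "1 < \<alpha>" using d by (simp add: \<alpha>_def)
  define k where "k n = nat \<lceil>\<alpha> ^ n\<rceil>" for n
  have a1: "1 \<le> \<alpha> ^ n" for n using \<alpha> by simp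
  have k1: "\<alpha> ^ n \<le> k n" for n unfolding k_def by linarith
  have k2: "k n \<le> \<alpha> ^ n + 1" for n unfolding k_def using a1[of n] by linarith
  have "(\<lambda>n. S (k n) / k n) \<longlonglongrightarrow> \<mu>" using sub[of i] by (simp add: k_def \<alpha>_def d_def)
  from LIMSEQ_D[OF this d] obtain n1 where n1: "\<And>n. n \<ge> n1 \<Longrightarrow> \<bar>S (k n) / k n - \<mu>\<bar> < d" by auto
  have mu0: "0 \<le> \<mu> + d"
  proof -
    have "0 \<le> S (k n1) / k n1" using nonneg by simp
    then show ?thesis using n1[of n1] by linarith
  qed
  \<comment> \<open>\<open>1 / d \<le> N\<close> absorbs the rounding error 1 of the ceiling into
    \<open>d * N\<close>; \<open>\<alpha> ^ n1 \<le> N\<close> ensures that the geometric index just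
    below \<open>N\<close> is at least \<open>n1\<close>.\<close>
  obtain N1 :: nat where N1: "1 / d \<le> N1" "\<alpha> ^ n1 \<le> N1"
    using real_arch_simple[of "max (1/d) (\<alpha> ^ n1)"] by auto
  have "\<bar>S N / N - \<mu>\<bar> < e" if N: "N \<ge> N1" for N
  proof -
    have NR: "1 / d \<le> N" "\<alpha> ^ n1 \<le> N" using N1 N by (auto intro: order_trans)
    have N0: "0 < real N" using NR(2) a1[of n1] by linarith
    have exN: "\<exists>n. real N < \<alpha> ^ n" using real_arch_pow[OF \<alpha>] by blast
    define n' where "n' = (LEAST n. real N < \<alpha> ^ n)"
    have n': "real N < \<alpha> ^ n'" unfolding n'_def using exN by (rule LeastI_ex)
    have "n1 < n'"
    proof (rule ccontr)
      assume "\<not> n1 < n'" then have "\<alpha> ^ n' \<le> \<alpha> ^ n1" using \<alpha> by (intro power_increasing) auto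
      with n' NR show False by linarith
    qed
    then obtain n where n: "n' = Suc n" "n1 \<le> n" by (cases n') auto
    have lo: "\<alpha> ^ n \<le> N"
      using not_less_Least[of n "\<lambda>n. real N < \<alpha> ^ n"] n(1) unfolding n'_def[symmetric] by auto
    have kn: "k n \<le> N" unfolding k_def using lo by (simp add: ceiling_le_iff nat_le_iff)
    have kSn: "N \<le> k (Suc n)" proof -
      have "real N \<le> real (k (Suc n))" using n' k1[of "Suc n"] n(1) by simp
      then show ?thesis by simp
    qed
    have pos: "0 < real (k n)" "0 < real (k (Suc n))" using k1[of n] k1[of "Suc n"] a1[of n] a1[of "Suc n"] by linarith+
    have "S N \<le> S (k (Suc n))" using mono kSn by (simp add: monoD)
    also have "\<dots> \<le> (\<mu> + d) * k (Suc n)"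
      using n1[of "Suc n"] n pos by (simp add: abs_less_iff field_simps)
    also have "\<dots> \<le> (\<mu> + d) * ((1 + 2 * d) * N)"
    proof (rule mult_left_mono[OF _ mu0])
      have "k (Suc n) \<le> \<alpha> * \<alpha> ^ n + 1" using k2[of "Suc n"] by simp
      also have "\<dots> \<le> \<alpha> * N + d * N"
        using lo \<alpha> NR(1) d by (intro add_mono mult_left_mono) (auto simp: field_simps)
      finally show "k (Suc n) \<le> (1 + 2 * d) * N" by (simp add: \<alpha>_def algebra_simps)
    qed
    finally have "S N / N \<le> (\<mu> + d) * (1 + 2 * d)" using N0 by (simp add: field_simps)
    also have "\<dots> < \<mu> + e" using i(1) by (simp add: d_def)
    finally have up: "S N / N < \<mu> + e" .
    have "\<mu> - d < S (k n) / k n" using n1[of n] n by linarith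
    then have "(\<mu> - d) / \<alpha> \<le> S (k n) / k n / \<alpha>" using \<alpha> by (intro divide_right_mono) auto
    also have "\<dots> = S (k n) / (\<alpha> * k n)" by simp
    also have "\<dots> \<le> S N / N"
    proof (rule frac_le)
      show "S (k n) \<le> S N" using mono kn by (simp add: monoD)
      have "N \<le> \<alpha> * \<alpha> ^ n" using n' n(1) by simp
      also have "\<dots> \<le> \<alpha> * k n" using k1[of n] \<alpha> by (intro mult_left_mono) auto
      finally show "real N \<le> \<alpha> * k n" .
    qed (use nonneg N0 in auto)
    finally have "\<mu> - e < S N / N" using i(2) by (simp add: \<alpha>_def d_def)
    with up show ?thesis by (simp add: abs_less_iff)
  qed
  then show "\<exists>no. \<forall>n\<ge>no. norm (S n / real n - \<mu>) < e" by auto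
qed

context prob_space
begin

lemma identical_distribution_integrals:
  fixes Y Y' :: "'a \<Rightarrow> real" and f :: "real \<Rightarrow> real"
  assumes [measurable]: "Y \<in> borel_measurable M" "Y' \<in> borel_measurable M" "f \<in> borel_measurable borel"
    and eq: "distr M borel Y = distr M borel Y'"
  shows "integrable M (\<lambda>x. f (Y x)) \<longleftrightarrow> integrable M (\<lambda>x. f (Y' x))"
    and "expectation (\<lambda>x. f (Y x)) = expectation (\<lambda>x. f (Y' x))"
  using integrable_distr_eq[of Y M borel f] integrable_distr_eq[of Y' M borel f]
    integral_distr[of Y M borel f] integral_distr[of Y' M borel f] eq by simp_all

text \<open>Etemadi's argument, which needs pairwise independence and a finite mean only. Along a
  geometric subsequence all variables of the partial sum are truncated at the common level
  \<open>k n\<close>, the number of summands; Chebyshev's bounds are summable by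
  \<open>sum_trunc_square_le\<close>. Nonnegativity makes the partial sums monotone and thereby
  fills the gaps.\<close>

lemma strong_law_of_large_numbers:
  fixes Y :: "nat \<Rightarrow> 'a \<Rightarrow> real"
  assumes rv [measurable]: "\<And>j. Y j \<in> borel_measurable M"
    and nonneg: "\<And>j x. 0 \<le> Y j x"
    and ident: "\<And>j. distr M borel (Y j) = distr M borel (Y 0)"
    and int: "integrable M (Y 0)"
    and indep: "\<And>i j. i \<noteq> j \<Longrightarrow> indep_var borel (Y i) borel (Y j)"
  shows "AE x in M. (\<lambda>N. (\<Sum>j<N. Y j x) / N) \<longlonglongrightarrow> expectation (Y 0)"
proof -
  define \<mu> where "\<mu> k = expectation (\<lambda>x. trunc k (Y 0 x))" for k
  have tr_le: "\<bar>trunc k (Y j x)\<bar> \<le> \<bar>k\<bar>" for j k x using nonneg[of j x] by (auto simp: trunc_def)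
  have tr_int: "integrable M (\<lambda>x. trunc k (Y j x))" for j k
    using tr_le by (intro integrable_const_bound[where B = "\<bar>k\<bar>"]) auto
  have tr_int2: "integrable M (\<lambda>x. (trunc k (Y j x))\<^sup>2)" for j k
    using tr_le by (intro integrable_const_bound[where B = "\<bar>k\<bar>\<^sup>2"])
      (auto simp: abs_le_square_iff[symmetric])
  have tr_E: "expectation (\<lambda>x. trunc k (Y j x)) = \<mu> k" for j k
    unfolding \<mu>_def by (rule identical_distribution_integrals(2)) (use ident in auto)
  have tr_E2: "expectation (\<lambda>x. (trunc k (Y j x))\<^sup>2) = expectation (\<lambda>x. (trunc k (Y 0 x))\<^sup>2)" for j k
    by (rule identical_distribution_integrals(2)[where f = "\<lambda>y. (trunc k y)\<^sup>2"]) (use ident in auto)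
  have \<mu>_lim: "(\<lambda>n. \<mu> (real (k n))) \<longlonglongrightarrow> expectation (Y 0)" if k: "filterlim k at_top sequentially" for k
    unfolding \<mu>_def
  proof (rule integral_dominated_convergence[where w = "Y 0"])
    show "AE x in M. (\<lambda>n. trunc (real (k n)) (Y 0 x)) \<longlonglongrightarrow> Y 0 x"
    proof (rule AE_I2)
      fix x
      have "\<forall>\<^sub>F n in sequentially. nat \<lceil>Y 0 x\<rceil> \<le> k n" using k unfolding filterlim_at_top by blast
      then have "\<forall>\<^sub>F n in sequentially. trunc (real (k n)) (Y 0 x) = Y 0 x"
        proof eventually_elim
        case (elim n)
        then have "Y 0 x \<le> k n" by linarith
        then show ?case by (simp add: trunc_def)
      qed
      then show "(\<lambda>n. trunc (real (k n)) (Y 0 x)) \<longlonglongrightarrow> Y 0 x" by (rule tendsto_eventually)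
    qed
  qed (use int nonneg in \<open>auto simp: trunc_def\<close>)
  have var: "integrable M (\<lambda>x. ((\<Sum>j<K. trunc k (Y j x)) - K * \<mu> k)\<^sup>2) \<and>
      expectation (\<lambda>x. ((\<Sum>j<K. trunc k (Y j x)) - K * \<mu> k)\<^sup>2)
        \<le> K * expectation (\<lambda>x. (trunc k (Y 0 x))\<^sup>2)" for K :: nat and k
  proof -
    define X where "X j x = trunc k (Y j x) - \<mu> k" for j x
    define v where "v = expectation (\<lambda>x. (trunc k (Y 0 x))\<^sup>2) - (\<mu> k)\<^sup>2"
    have Xsq: "X j x * X j x = (trunc k (Y j x))\<^sup>2 - 2 * \<mu> k * trunc k (Y j x) + (\<mu> k)\<^sup>2" for j x
      by (simp add: X_def power2_eq_square algebra_simps)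
    have Xint: "integrable M (X j)" for j unfolding X_def using tr_int by auto
    have XE: "expectation (X j) = 0" for j
      unfolding X_def using tr_int tr_E by (simp add: prob_space)
    have XX: "integrable M (\<lambda>x. X i x * X j x)" "expectation (\<lambda>x. X i x * X j x) = (if i = j then v else 0)" for i j
    proof -
      have "integrable M (\<lambda>x. X i x * X j x) \<and> expectation (\<lambda>x. X i x * X j x) = (if i = j then v else 0)"
      proof (cases "i = j")
        case True
        show ?thesis unfolding True Xsq v_def using tr_int tr_int2 tr_E tr_E2
          by (auto simp: prob_space power2_eq_square)
      next
        case False
        have "indep_var borel ((\<lambda>y. trunc k y - \<mu> k) \<circ> Y i) borel ((\<lambda>y. trunc k y - \<mu> k) \<circ> Y j)"
          by (rule indep_var_compose[OF indep[OF False]]) auto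
        then have "indep_var borel (X i) borel (X j)" by (simp add: X_def[abs_def] comp_def)
        from indep_var_integrable[OF this Xint Xint] indep_var_lebesgue_integral[OF this Xint Xint]
        show ?thesis using XE False by simp
      qed
      then show "integrable M (\<lambda>x. X i x * X j x)" "expectation (\<lambda>x. X i x * X j x) = (if i = j then v else 0)"
        by auto
    qed
    have S: "(\<Sum>j<K. trunc k (Y j x)) - K * \<mu> k = (\<Sum>j<K. 1 * X j x)" for x
      by (simp add: X_def sum_subtractf)
    have "v * K \<le> K * expectation (\<lambda>x. (trunc k (Y 0 x))\<^sup>2)"
      unfolding v_def by (simp add: algebra_simps)
    then show ?thesis
      unfolding S power2_eq_square
      using expectation_orthogonal_sums[OF XX, of "\<lambda>_. 1" K "\<lambda>_. 1"] by simp
  qed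
  have few: "AE x in M. eventually (\<lambda>j. Y j x \<le> j) sequentially"
  proof -
    define f where "f j x = (indicator {real j<..} (Y j x) :: real)" for j :: nat and x
    have "AE x in M. (\<lambda>j. f j x) \<longlonglongrightarrow> 0"
    proof (rule AE_tendsto_zero_if_summable_expectation)
      show fint: "integrable M (f j)" for j unfolding f_def
        by (intro integrable_const_bound[where B = 1]) (auto simp: indicator_def)
      show "0 \<le> f j x" for j x by (simp add: f_def)
      fix m
      have E: "expectation (f j) = expectation (\<lambda>x. indicator {real j<..} (Y 0 x))" for j
        unfolding f_def
        by (rule identical_distribution_integrals(2)[where f = "indicator {real j<..}"]) (use ident in auto)
      have i0: "integrable M (\<lambda>x. indicator {real j<..} (Y 0 x) :: real)" for j
        by (intro integrable_const_bound[where B = 1]) (auto simp: indicator_def)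
      \<comment> \<open>At most \<open>nat \<lceil>y\<rceil>\<close> indices \<open>j\<close> lie
        below \<open>y\<close>, so the tail probabilities sum to at most the mean plus 1.\<close>
      have pw: "(\<Sum>j<m. indicator {real j<..} y) \<le> y + 1" if y: "0 \<le> y" for y :: real
      proof -
        have "(\<Sum>j<m. indicator {real j<..} y :: real) \<le> (\<Sum>j<nat \<lceil>y\<rceil>. 1)"
          by (rule order_trans[OF _ sum_mono2[of "{..<nat \<lceil>y\<rceil>}" "{..<m} \<inter> {j. real j < y}" "\<lambda>_. 1"]])
            (auto simp: indicator_def sum.If_cases, linarith)
        then show ?thesis using y by simp linarith
      qed
      have "(\<Sum>j<m. expectation (f j)) = expectation (\<lambda>x. \<Sum>j<m. indicator {real j<..} (Y 0 x))"
        unfolding E by (rule Bochner_Integration.integral_sum[symmetric]) (rule i0)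
      also have "\<dots> \<le> expectation (\<lambda>x. Y 0 x + 1)"
        using int i0 pw nonneg
        by (intro integral_mono Bochner_Integration.integrable_sum Bochner_Integration.integrable_add) auto
      finally show "(\<Sum>j<m. expectation (f j)) \<le> expectation (\<lambda>x. Y 0 x + 1)" .
    qed
    then show ?thesis
    proof eventually_elim
      case (elim x)
      then have "\<forall>\<^sub>F j in sequentially. f j x < 1" by (rule order_tendstoD) simp
      then show ?case by eventually_elim (auto simp: f_def indicator_def split: if_splits)
    qed
  qed
  have sub: "AE x in M. (\<lambda>n. (\<Sum>j<nat \<lceil>(1 + 1 / Suc i) ^ n\<rceil>. Y j x) / nat \<lceil>(1 + 1 / Suc i) ^ n\<rceil>)
      \<longlonglongrightarrow> expectation (Y 0)" for i :: nat
  proof -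
    define \<alpha> where "\<alpha> = 1 + 1 / real (Suc i)"
    have \<alpha>: "1 < \<alpha>" by (simp add: \<alpha>_def)
    define k where "k n = nat \<lceil>\<alpha> ^ n\<rceil>" for n
    have k1: "\<alpha> ^ n \<le> k n" for n unfolding k_def by linarith
    have a1: "1 \<le> \<alpha> ^ n" for n using \<alpha> by simp
    have kpos: "0 < k n" for n using k1[of n] a1[of n] by (cases "k n") auto
    have klim: "filterlim k at_top sequentially"
    proof (rule filterlim_at_top_mono)
      show "filterlim (\<lambda>n. nat \<lceil>\<alpha> ^ n\<rceil>) at_top sequentially"
        unfolding filterlim_at_top
      proof
        fix Z :: nat
        obtain n0 where "Z < \<alpha> ^ n0" using real_arch_pow[OF \<alpha>] by blast
        then have "Z \<le> nat \<lceil>\<alpha> ^ n\<rceil>" if "n0 \<le> n" for n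
          using power_increasing[OF that, of \<alpha>] \<alpha> by linarith
        then show "\<forall>\<^sub>F n in sequentially. Z \<le> nat \<lceil>\<alpha> ^ n\<rceil>"
          by (auto simp: eventually_sequentially)
      qed
    qed (simp add: k_def)
    define f where "f n x = ((\<Sum>j<k n. trunc (k n) (Y j x)) - k n * \<mu> (k n))\<^sup>2 / (real (k n))\<^sup>2" for n x
    have "AE x in M. (\<lambda>n. f n x) \<longlonglongrightarrow> 0"
    proof (rule AE_tendsto_zero_if_summable_expectation)
      show "integrable M (f n)" for n unfolding f_def using var by simp
      show "0 \<le> f n x" for n x by (simp add: f_def)
      fix m
      have "expectation (f n) \<le> expectation (\<lambda>x. (trunc (k n) (Y 0 x))\<^sup>2 / k n)" for n
        unfolding f_def using var[of "k n" "k n"] kpos[of n]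
        by (simp add: power2_eq_square field_simps)
      then have "(\<Sum>n<m. expectation (f n)) \<le> (\<Sum>n<m. expectation (\<lambda>x. (trunc (k n) (Y 0 x))\<^sup>2 / k n))"
        by (intro sum_mono)
      also have "\<dots> = expectation (\<lambda>x. \<Sum>n<m. (trunc (k n) (Y 0 x))\<^sup>2 / k n)"
        using tr_int2 by (intro Bochner_Integration.integral_sum[symmetric]) simp
      also have "\<dots> \<le> expectation (\<lambda>x. 2 * (1 / (1 - 1 / \<alpha>)) * Y 0 x)"
        using tr_int2 int sum_trunc_square_le[OF \<alpha> nonneg] unfolding k_def
        by (intro integral_mono Bochner_Integration.integrable_sum) auto
      finally show "(\<Sum>n<m. expectation (f n)) \<le> expectation (\<lambda>x. 2 * (1 / (1 - 1 / \<alpha>)) * Y 0 x)" .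
    qed
    then have "AE x in M. (\<lambda>n. (\<Sum>j<k n. Y j x) / k n) \<longlonglongrightarrow> expectation (Y 0)"
      using few
    proof eventually_elim
      case (elim x)
      have "f n x = ((\<Sum>j<k n. trunc (k n) (Y j x)) / k n - \<mu> (k n))\<^sup>2" for n
        using kpos[of n] by (simp add: f_def power_divide[symmetric] diff_divide_distrib)
      with tendsto_real_sqrt[OF elim(1)]
      have "(\<lambda>n. (\<Sum>j<k n. trunc (k n) (Y j x)) / k n - \<mu> (k n)) \<longlonglongrightarrow> 0"
        by (simp add: tendsto_rabs_zero_iff)
      from tendsto_add[OF this \<mu>_lim[OF klim]]
      have "(\<lambda>n. (\<Sum>j<k n. trunc (k n) (Y j x)) / k n) \<longlonglongrightarrow> expectation (Y 0)" by simp
      moreover obtain J where J: "\<And>j. j \<ge> J \<Longrightarrow> Y j x \<le> j"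
        using elim(2) by (auto simp: eventually_sequentially)
      \<comment> \<open>The bound \<open>Y j x \<le> j\<close> gives \<open>Y j x \<le> k n\<close>
        for all \<open>j\<close> from \<open>J\<close> up to \<open>k n\<close>. The finitely many
        earlier variables lie below their own sum, which \<open>k n\<close> eventually exceeds; then
        truncation changes nothing.\<close>
      have "\<forall>\<^sub>F n in sequentially. nat \<lceil>\<Sum>j<J. Y j x\<rceil> \<le> k n" using klim unfolding filterlim_at_top by blast
      then have "\<forall>\<^sub>F n in sequentially. (\<Sum>j<k n. trunc (k n) (Y j x)) / k n = (\<Sum>j<k n. Y j x) / k n"
      proof eventually_elim
        case (elim n)
        have "Y j x \<le> k n" if "j < k n" for j
        proof (cases "j < J")
          case True
          then have "Y j x \<le> (\<Sum>j<J. Y j x)" using nonneg by (intro member_le_sum) auto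
          then show ?thesis using elim by linarith
        next
          case False
          then show ?thesis using J[of j] that by linarith
        qed
        then show ?case by (simp add: trunc_def)
      qed
      ultimately show ?case by (rule Lim_transform_eventually)
    qed
    then show ?thesis by (simp add: k_def \<alpha>_def)
  qed
  then have "AE x in M. \<forall>i::nat. (\<lambda>n. (\<Sum>j<nat \<lceil>(1 + 1 / Suc i) ^ n\<rceil>. Y j x) / nat \<lceil>(1 + 1 / Suc i) ^ n\<rceil>)
      \<longlonglongrightarrow> expectation (Y 0)"
    by (simp add: AE_all_countable)
  then show ?thesis
  proof eventually_elim
    case (elim x)
    show ?case
    proof (rule cesaro_from_geometric_subsequences)
      show "mono (\<lambda>N. \<Sum>j<N. Y j x)"
        by (intro monoI sum_mono2) (use nonneg in auto)
    qed (use nonneg elim in \<open>auto intro: sum_nonneg\<close>)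
  qed
qed

text \<open>Between consecutive fourth powers the increments are controlled by \<open>r\<close>, and these
  gaps are negligible since \<open>(k + 1) ^ 4 / k ^ 4\<close> tends to \<open>1\<close>.\<close>

lemma sublinear_from_fourth_powers:
  fixes V r :: "nat \<Rightarrow> real"
  assumes nonneg: "\<And>n. 0 \<le> V n"
    and incr: "\<And>m n. start \<le> m \<Longrightarrow> m \<le> n \<Longrightarrow> V n \<le> V m + (\<Sum>j\<in>{m..<n}. r j)"
    and sub: "(\<lambda>k. V (k ^ 4) / k ^ 4) \<longlonglongrightarrow> 0"
    and r: "(\<lambda>N. (\<Sum>j<N. r j) / N) \<longlonglongrightarrow> c"
  shows "(\<lambda>N. V N / N) \<longlonglongrightarrow> 0"
proof -
  define k where "k N = nat \<lfloor>root 4 (real N)\<rfloor>" for N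
  have k0: "real (k N) \<le> root 4 N" "root 4 N < real (k N) + 1" for N
    unfolding k_def by (simp_all add: real_root_ge_zero) linarith?
  have kle: "k N ^ 4 \<le> N" for N
  proof -
    have "real (k N) ^ 4 \<le> root 4 N ^ 4" using k0(1) by (intro power_mono) auto
    then have "real (k N ^ 4) \<le> real N" by simp
    then show ?thesis by (simp only: of_nat_le_iff)
  qed
  have kgt: "real N < (real (k N) + 1) ^ 4" for N
  proof -
    have "root 4 N ^ 4 < (real (k N) + 1) ^ 4" using k0(2) by (intro power_strict_mono) auto
    then show ?thesis by simp
  qed
  have klim: "filterlim k at_top sequentially"
    unfolding filterlim_at_top
  proof
    fix Z :: nat
    have "Z \<le> k N" if "Z ^ 4 \<le> N" for N
    proof (rule ccontr)
      assume "\<not> Z \<le> k N"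
      then have "Suc (k N) ^ 4 \<le> Z ^ 4" by (intro power_mono) auto
      with that have "real (Suc (k N) ^ 4) \<le> real N" by (intro of_nat_mono) linarith
      then show False using kgt[of N] by (simp add: add.commute)
    qed
    then show "\<forall>\<^sub>F N in sequentially. Z \<le> k N" by (auto simp: eventually_sequentially)
  qed
  have k4lim: "filterlim (\<lambda>N. k N ^ 4) at_top sequentially"
  proof (rule filterlim_at_top_mono[OF klim], rule always_eventually, rule allI)
    show "k N \<le> k N ^ 4" for N by (cases "k N = 0") (auto intro: self_le_power)
  qed
  have "(\<lambda>k::nat. (real k / (real k + 1)) ^ 4) \<longlonglongrightarrow> 1 ^ 4"
    by (intro tendsto_power LIMSEQ_n_over_Suc_n[unfolded of_nat_Suc add.commute[of 1]])
  from filterlim_compose[OF this klim]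
  have low: "(\<lambda>N. (real (k N) / (real (k N) + 1)) ^ 4) \<longlonglongrightarrow> 1" by simp
  have ratio: "(\<lambda>N. real (k N ^ 4) / N) \<longlonglongrightarrow> 1"
  proof (rule tendsto_sandwich[OF _ _ low tendsto_const])
    show "\<forall>\<^sub>F N in sequentially. (real (k N) / (real (k N) + 1)) ^ 4 \<le> real (k N ^ 4) / N"
    proof (rule eventually_sequentiallyI[of 1])
      fix N :: nat assume "1 \<le> N"
      then show "(real (k N) / (real (k N) + 1)) ^ 4 \<le> real (k N ^ 4) / N"
        unfolding power_divide of_nat_power using kgt[of N] by (intro divide_left_mono) auto
    qed
    show "\<forall>\<^sub>F N in sequentially. real (k N ^ 4) / N \<le> 1"
    proof (rule eventually_sequentiallyI[of 1])
      fix N :: nat assume "1 \<le> N"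
      moreover have "real (k N ^ 4) \<le> real N" using kle of_nat_le_iff by blast
      ultimately show "real (k N ^ 4) / N \<le> 1" by (simp add: divide_le_eq)
    qed
  qed
  \<comment> \<open>An upper bound for \<open>V N / N\<close>. The increment of the sums of
    \<open>r\<close> from \<open>k N ^ 4\<close> to \<open>N\<close>, divided by \<open>N\<close>,
    tends to \<open>c - c * 1\<close>, because \<open>k N ^ 4 / N\<close> tends to 1.\<close>
  define b where "b N = V (k N ^ 4) / k N ^ 4 + (\<Sum>j<N. r j) / N - (\<Sum>j<k N ^ 4. r j) / (k N ^ 4) * (real (k N ^ 4) / N)" for N
  have "b \<longlonglongrightarrow> 0 + c - c * 1"
    unfolding b_def
    using filterlim_compose[OF sub klim] filterlim_compose[OF r k4lim] r ratio
    by (intro tendsto_intros) auto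
  then have blim: "b \<longlonglongrightarrow> 0" by simp
  show ?thesis
  proof (rule tendsto_sandwich[OF _ _ tendsto_const blim])
    show "\<forall>\<^sub>F N in sequentially. 0 \<le> V N / N" using nonneg by simp
    have "\<forall>\<^sub>F N in sequentially. max 1 start \<le> k N ^ 4" using k4lim unfolding filterlim_at_top by blast
    then show "\<forall>\<^sub>F N in sequentially. V N / N \<le> b N"
    proof eventually_elim
      case (elim N)
      have pos: "0 < real (k N ^ 4)" using elim by (cases "k N = 0") auto
      have le: "real (k N ^ 4) \<le> real N" using kle of_nat_le_iff by blast
      with pos have N: "0 < real N" by linarith
      have "V N \<le> V (k N ^ 4) + (\<Sum>j\<in>{k N ^ 4..<N}. r j)" using elim kle by (intro incr) auto
      also have "(\<Sum>j\<in>{k N ^ 4..<N}. r j) = (\<Sum>j<N. r j) - (\<Sum>j<k N ^ 4. r j)"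
        using sum_diff_nat_ivl[of 0 "k N ^ 4" N r] kle by (simp add: lessThan_atLeast0)
      finally have "V N / N \<le> (V (k N ^ 4) + ((\<Sum>j<N. r j) - (\<Sum>j<k N ^ 4. r j))) / N"
        using N by (intro divide_right_mono) auto
      also have "\<dots> = V (k N ^ 4) / N + (\<Sum>j<N. r j) / N - (\<Sum>j<k N ^ 4. r j) / N"
        by (simp add: add_divide_distrib diff_divide_distrib)
      also have "\<dots> \<le> b N"
        unfolding b_def using pos le nonneg[of "k N ^ 4"] by (simp add: frac_le)
      finally show ?case .
    qed
  qed
qed

text \<open>At \<open>n = k ^ 4\<close> the bound \<open>C * sqrt n / n\<close> becomes
  \<open>C / k ^ 2\<close>, which is summable; this is where the fourth powers come from. The growth
  \<open>sqrt n\<close> is allowed because it is the order of the mean absolute value of a sum of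
  orthogonal terms.\<close>

lemma AE_sublinear:
  fixes V r :: "nat \<Rightarrow> 'a \<Rightarrow> real"
  assumes int: "\<And>n. start \<le> n \<Longrightarrow> integrable M (V n)"
    and nonneg: "\<And>n x. 0 \<le> V n x"
    and E: "\<And>n. start \<le> n \<Longrightarrow> expectation (V n) \<le> C * sqrt n"
    and incr: "\<And>m n x. start \<le> m \<Longrightarrow> m \<le> n \<Longrightarrow> V n x \<le> V m x + (\<Sum>j\<in>{m..<n}. r j x)"
    and r: "AE x in M. (\<lambda>N. (\<Sum>j<N. r j x) / N) \<longlonglongrightarrow> c"
  shows "AE x in M. (\<lambda>N. V N x / N) \<longlonglongrightarrow> 0"
proof -
  \<comment> \<open>The value 0 at small indices keeps integrability and summability intact where
    \<open>V\<close> is not controlled, and changes no limit.\<close>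
  define f where "f k x = (if max 1 start \<le> k ^ 4 then V (k ^ 4) x / k ^ 4 else 0)" for k x
  have sm: "summable (\<lambda>k. C' * inverse (real k ^ 2))" for C'
    by (intro summable_mult inverse_power_summable) simp
  have "AE x in M. (\<lambda>k. f k x) \<longlonglongrightarrow> 0"
  proof (rule AE_tendsto_zero_if_summable_expectation)
    show "integrable M (f k)" for k
      by (cases "max 1 start \<le> k ^ 4") (use int in \<open>auto simp: f_def[abs_def]\<close>)
    show "0 \<le> f k x" for k x unfolding f_def using nonneg by auto
    fix m
    have "expectation (f k) \<le> \<bar>C\<bar> * inverse (real k ^ 2)" for k
    proof (cases "max 1 start \<le> k ^ 4")
      case True
      then have k: "0 < real k" by (cases k) auto
      have sq: "sqrt (real (k ^ 4)) = real k ^ 2"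
        by (rule real_sqrt_unique) (auto simp: power_mult[symmetric])
      have "expectation (f k) = expectation (V (k ^ 4)) / k ^ 4" using True by (simp add: f_def[abs_def])
      also have "\<dots> \<le> \<bar>C\<bar> * real k ^ 2 / k ^ 4"
        using order_trans[OF E[of "k ^ 4"] mult_right_mono[of C "\<bar>C\<bar>" "sqrt (k ^ 4)"]] True sq
        by (intro divide_right_mono) auto
      also have "\<dots> = \<bar>C\<bar> * inverse (real k ^ 2)"
        using k by (simp add: field_simps power2_eq_square power4_eq_xxxx)
      finally show ?thesis .
    next
      case False then show ?thesis by (auto simp: f_def[abs_def])
    qed
    then have "(\<Sum>k<m. expectation (f k)) \<le> (\<Sum>k<m. \<bar>C\<bar> * inverse (real k ^ 2))" by (intro sum_mono)
    also have "\<dots> \<le> (\<Sum>k. \<bar>C\<bar> * inverse (real k ^ 2))"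
      by (intro sum_le_suminf sm) auto
    finally show "(\<Sum>k<m. expectation (f k)) \<le> (\<Sum>k. \<bar>C\<bar> * inverse (real k ^ 2))" .
  qed
  with r show ?thesis
  proof eventually_elim
    case (elim x)
    have "\<forall>\<^sub>F k in sequentially. f k x = V (k ^ 4) x / k ^ 4"
    proof (rule eventually_sequentiallyI[of "max 1 start"])
      fix k assume "max 1 start \<le> k"
      then have "max 1 start \<le> k ^ 4" using self_le_power[of k 4] by linarith
      then show "f k x = V (k ^ 4) x / k ^ 4" by (simp add: f_def)
    qed
    from Lim_transform_eventually[OF elim(2) this]
    have "(\<lambda>k. V (k ^ 4) x / k ^ 4) \<longlonglongrightarrow> 0" .
    from sublinear_from_fourth_powers[OF nonneg incr this elim(1)] show ?case .
  qed
qed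

end

section \<open>The Moore--Penrose pseudoinverse\<close>

text \<open>One Gram--Schmidt step per vector: \<open>c\<close> is the residual of the new vector
  \<open>a k\<close> against the old ones, \<open>r\<close> that of \<open>b\<close>, and
  \<open>r - t * c\<close> is orthogonal to \<open>c\<close> and to all old vectors. No independence
  is assumed; if \<open>c\<close> vanishes, orthogonality to \<open>c\<close> is trivial.\<close>

lemma normal_equations_solvable:
  fixes a :: "nat \<Rightarrow> nat \<Rightarrow> real"
  shows "\<exists>x. \<forall>j<k. (\<Sum>i<d. a j i * (b i - (\<Sum>l<k. x l * a l i))) = 0"
proof (induction k arbitrary: b)
  case 0
  then show ?case by simp
next
  case (Suc k)
  obtain xa where xa: "\<forall>j<k. (\<Sum>i<d. a j i * (a k i - (\<Sum>l<k. xa l * a l i))) = 0"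
    using Suc.IH by blast
  obtain xb where xb: "\<forall>j<k. (\<Sum>i<d. a j i * (b i - (\<Sum>l<k. xb l * a l i))) = 0"
    using Suc.IH by blast
  define c where "c i = a k i - (\<Sum>l<k. xa l * a l i)" for i
  define r where "r i = b i - (\<Sum>l<k. xb l * a l i)" for i
  define t where "t = (\<Sum>i<d. c i * r i) / (\<Sum>i<d. c i * c i)"
  define x where "x l = (if l = k then t else xb l - t * xa l)" for l
  have res: "b i - (\<Sum>l<Suc k. x l * a l i) = r i - t * c i" for i
    by (simp add: x_def r_def c_def sum_subtractf left_diff_distrib right_diff_distrib
        sum_distrib_left mult.assoc)
  have orth: "(\<Sum>i<d. a j i * (r i - t * c i)) = 0" if "j < k" for j
  proof -
    have "(\<Sum>i<d. a j i * (r i - t * c i)) = (\<Sum>i<d. a j i * r i) - t * (\<Sum>i<d. a j i * c i)"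
      by (simp add: sum_subtractf sum_distrib_left algebra_simps)
    then show ?thesis using xa xb that by (simp add: c_def r_def)
  qed
  have cc: "(\<Sum>i<d. c i * (r i - t * c i)) = 0"
  proof (cases "(\<Sum>i<d. c i * c i) = 0")
    case True
    then have "\<forall>i<d. c i = 0" by (subst (asm) sum_nonneg_eq_0_iff) auto
    then show ?thesis by simp
  next
    case False
    have "(\<Sum>i<d. c i * (r i - t * c i)) = (\<Sum>i<d. c i * r i) - t * (\<Sum>i<d. c i * c i)"
      by (simp add: sum_subtractf sum_distrib_left algebra_simps)
    then show ?thesis using False by (simp add: t_def)
  qed
  define w where "w i = r i - t * c i" for i
  \<comment> \<open>\<open>a k\<close> is \<open>c\<close> plus a combination of the old vectors, so
    orthogonality to these passes on to \<open>a k\<close>.\<close>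
  have "a k i * w i = c i * w i + (\<Sum>l<k. xa l * (a l i * w i))" for i
  proof -
    have "a k i = c i + (\<Sum>l<k. xa l * a l i)" by (simp add: c_def)
    then show ?thesis by (simp add: distrib_right sum_distrib_right mult.assoc)
  qed
  then have "(\<Sum>i<d. a k i * (r i - t * c i))
      = (\<Sum>i<d. c i * (r i - t * c i) + (\<Sum>l<k. xa l * (a l i * (r i - t * c i))))"
    by (simp add: w_def)
  also have "\<dots> = (\<Sum>l<k. \<Sum>i<d. xa l * (a l i * (r i - t * c i)))"
    by (simp add: sum.distrib cc) (rule sum.swap)
  also have "\<dots> = 0" using orth by (simp add: sum_distrib_left[symmetric])
  finally have "(\<Sum>i<d. a k i * (r i - t * c i)) = 0" .
  with orth have "\<forall>j<Suc k. (\<Sum>i<d. a j i * (b i - (\<Sum>l<Suc k. x l * a l i))) = 0"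
    unfolding res by (auto simp: less_Suc_eq)
  then show ?case by blast
qed

text \<open>Column \<open>i\<close> of \<open>X\<close> is a least squares solution for the unit
  vector \<open>i\<close>; collecting the normal equations of all columns gives the matrix
  equation.\<close>

lemma gram_equation_solvable:
  fixes A :: "real mat"
  assumes A: "A \<in> carrier_mat nr nc"
  shows "\<exists>X \<in> carrier_mat nc nr. A\<^sup>T * (A * X) = A\<^sup>T"
proof -
  have "\<forall>i. \<exists>x. \<forall>j<nc. (\<Sum>r<nr. A $$ (r, j) * ((if r = i then 1 else 0) - (\<Sum>l<nc. x l * A $$ (r, l)))) = 0"
    using normal_equations_solvable[where k = nc and d = nr and a = "\<lambda>j r. A $$ (r, j)"] by simp
  from choice[OF this] obtain x where x: "\<forall>i. \<forall>j<nc.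
      (\<Sum>r<nr. A $$ (r, j) * ((if r = i then 1 else 0) - (\<Sum>l<nc. x i l * A $$ (r, l)))) = 0"
    by blast
  define X where "X = mat nc nr (\<lambda>(l, i). x i l)"
  have "A\<^sup>T * (A * X) = A\<^sup>T"
  proof (rule eq_matI)
    fix j i assume "j < dim_row A\<^sup>T" "i < dim_col A\<^sup>T"
    then have ji: "j < nc" "i < nr" using A by auto
    have "(\<Sum>r<nr. A $$ (r, j) * (\<Sum>l<nc. x i l * A $$ (r, l))) = (\<Sum>r<nr. A $$ (r, j) * (if r = i then 1 else 0))"
      using x[rule_format, OF ji(1), of i] by (simp add: right_diff_distrib sum_subtractf)
    also have "\<dots> = A $$ (i, j)" using ji by (simp add: if_distrib[of "\<lambda>t. _ * t"] cong: if_cong)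
    finally show "(A\<^sup>T * (A * X)) $$ (j, i) = A\<^sup>T $$ (j, i)"
      using A ji by (simp add: X_def scalar_prod_def lessThan_atLeast0 mult.commute)
  qed (use A in \<open>auto simp: X_def\<close>)
  then show ?thesis by (intro bexI[of _ X]) (auto simp: X_def)
qed

text \<open>The equation \<open>A\<^sup>T * (A * X) = A\<^sup>T\<close> makes
  \<open>(A * X)\<^sup>T\<close> equal to \<open>(A * X)\<^sup>T * (A * X)\<close>, which is
  symmetric; transposing the equation then gives the first Penrose condition. The name refers to the
  numbering of the Penrose conditions.\<close>

lemma one_three_inverse_exists:
  fixes A :: "real mat"
  assumes A: "A \<in> carrier_mat nr nc"
  shows "\<exists>X \<in> carrier_mat nc nr. A * X * A = A \<and> (A * X)\<^sup>T = A * X"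
proof -
  obtain X where X: "X \<in> carrier_mat nc nr" and eq: "A\<^sup>T * (A * X) = A\<^sup>T"
    using gram_equation_solvable[OF A] by blast
  have AX: "A * X \<in> carrier_mat nr nr" using A X by simp
  have "(A * X)\<^sup>T = X\<^sup>T * (A\<^sup>T * (A * X))" using A X eq by (simp add: transpose_mult)
  also have "\<dots> = (A * X)\<^sup>T * (A * X)"
    using A X by (simp add: transpose_mult[OF A X] assoc_mult_mat[of _ nr nc _ nr _ nr])
  finally have sym: "(A * X)\<^sup>T = (A * X)\<^sup>T * (A * X)" .
  then have "((A * X)\<^sup>T)\<^sup>T = ((A * X)\<^sup>T * (A * X))\<^sup>T" by simp
  also have "\<dots> = (A * X)\<^sup>T * (A * X)" using AX by (subst transpose_mult[of _ nr nr _ nr]) auto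
  finally have s: "(A * X)\<^sup>T = A * X" using sym by simp
  have "(A\<^sup>T * (A * X))\<^sup>T = (A * X)\<^sup>T * (A\<^sup>T)\<^sup>T" by (rule transpose_mult[OF _ AX]) (use A in simp)
  then have "A * X * A = A" by (simp only: eq s transpose_transpose)
  with s X show ?thesis by blast
qed

lemma is_pinv_transpose:
  assumes "is_pinv A P" shows "is_pinv A\<^sup>T P\<^sup>T"
proof -
  note a = assms[unfolded is_pinv_def]
  have P: "P \<in> carrier_mat (dim_col A) (dim_row A)" using a by simp
  have A: "A \<in> carrier_mat (dim_row A) (dim_col A)" by simp
  have AP: "A\<^sup>T * P\<^sup>T = P * A" using a transpose_mult[OF P A] by metis
  have PA: "P\<^sup>T * A\<^sup>T = A * P" using a transpose_mult[OF A P] by metis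
  note tA = A[THEN transpose_carrier_mat[THEN iffD2]] and tP = P[THEN transpose_carrier_mat[THEN iffD2]]
  have 1: "A\<^sup>T * P\<^sup>T * A\<^sup>T = A\<^sup>T"
  proof -
    have "A\<^sup>T * P\<^sup>T * A\<^sup>T = A\<^sup>T * (P\<^sup>T * A\<^sup>T)" by (rule assoc_mult_mat[OF tA tP tA])
    also have "\<dots> = A\<^sup>T * (A * P)\<^sup>T" using PA a by simp
    also have "\<dots> = (A * P * A)\<^sup>T" by (rule transpose_mult[OF mult_carrier_mat[OF A P] A, symmetric])
    finally show ?thesis using a by simp
  qed
  have 2: "P\<^sup>T * A\<^sup>T * P\<^sup>T = P\<^sup>T"
  proof -
    have "P\<^sup>T * A\<^sup>T * P\<^sup>T = P\<^sup>T * (A\<^sup>T * P\<^sup>T)" by (rule assoc_mult_mat[OF tP tA tP])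
    also have "\<dots> = P\<^sup>T * (P * A)\<^sup>T" using AP a by simp
    also have "\<dots> = (P * A * P)\<^sup>T" by (rule transpose_mult[OF mult_carrier_mat[OF P A] P, symmetric])
    finally show ?thesis using a by simp
  qed
  show ?thesis unfolding is_pinv_def using a P 1 2 AP PA by simp
qed

text \<open>Both sides are the orthogonal projection to the column space of \<open>A\<close>.
  Transposition gives the other half.\<close>

lemma is_pinv_unique_half:
  assumes "is_pinv A P" "is_pinv A P'" shows "A * P = A * P'"
proof -
  note a = assms[unfolded is_pinv_def]
  have P: "P \<in> carrier_mat (dim_col A) (dim_row A)" "P' \<in> carrier_mat (dim_col A) (dim_row A)" using a by simp_all
  have A: "A \<in> carrier_mat (dim_row A) (dim_col A)" by simp
  note AP = mult_carrier_mat[OF A P(1)] and AP' = mult_carrier_mat[OF A P(2)]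
  have "A * P = (A * P' * A) * P" using a by simp
  also have "\<dots> = (A * P') * (A * P)" by (rule assoc_mult_mat[OF AP' A P(1)])
  also have "\<dots> = (A * P')\<^sup>T * (A * P)\<^sup>T" using a by simp
  also have "\<dots> = ((A * P) * (A * P'))\<^sup>T" by (rule transpose_mult[OF AP AP', symmetric])
  also have "(A * P) * (A * P') = (A * P * A) * P'" by (rule assoc_mult_mat[OF AP A P(2), symmetric])
  finally show ?thesis using a by simp
qed

lemma is_pinv_unique:
  assumes "is_pinv A P" "is_pinv A P'" shows "P = P'"
proof -
  note a = assms[unfolded is_pinv_def]
  have P: "P \<in> carrier_mat (dim_col A) (dim_row A)" "P' \<in> carrier_mat (dim_col A) (dim_row A)" using a by simp_all
  have A: "A \<in> carrier_mat (dim_row A) (dim_col A)" by simp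
  have 1: "A * P = A * P'" by (rule is_pinv_unique_half[OF assms])
  have "A\<^sup>T * P\<^sup>T = A\<^sup>T * P'\<^sup>T" using assms[THEN is_pinv_transpose] by (rule is_pinv_unique_half)
  then have "(P * A)\<^sup>T = (P' * A)\<^sup>T" using transpose_mult[OF P(1) A] transpose_mult[OF P(2) A] by simp
  then have 2: "P * A = P' * A" by (metis transpose_transpose)
  have "P = P * (A * P)" using a assoc_mult_mat[OF P(1) A P(1)] by simp
  also have "\<dots> = P * (A * P')" by (simp add: 1)
  also have "\<dots> = P * A * P'" by (rule assoc_mult_mat[OF P(1) A P(2), symmetric])
  also have "\<dots> = P'" using a 2 by simp
  finally show ?thesis .
qed

text \<open>\<open>X\<close> supplies the symmetric product \<open>A * X\<close>; \<open>Y\<close>,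
  obtained from the transpose of \<open>A\<close>, supplies the symmetric product
  \<open>Y * A\<close>. The combination \<open>Y * A * X\<close> inherits both.\<close>

lemma is_pinv_exists: "\<exists>P. is_pinv A P"
proof -
  define nr nc where "nr = dim_row A" and "nc = dim_col A"
  have A: "A \<in> carrier_mat nr nc" by (simp add: nr_def nc_def)
  obtain X where X: "X \<in> carrier_mat nc nr" "A * X * A = A" "(A * X)\<^sup>T = A * X"
    using one_three_inverse_exists[OF A] by blast
  have "A\<^sup>T \<in> carrier_mat nc nr" using A by simp
  from one_three_inverse_exists[OF this] obtain Z where
    Z: "Z \<in> carrier_mat nr nc" "A\<^sup>T * Z * A\<^sup>T = A\<^sup>T" "(A\<^sup>T * Z)\<^sup>T = A\<^sup>T * Z" by blast
  define Y where "Y = Z\<^sup>T"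
  have Y: "Y \<in> carrier_mat nc nr" using Z by (simp add: Y_def)
  have ZY: "A\<^sup>T * Z = (Y * A)\<^sup>T" using transpose_mult[OF Y A] by (simp add: Y_def)
  have YA: "(Y * A)\<^sup>T = Y * A" using Z(3) unfolding ZY by simp
  have "(A * (Y * A))\<^sup>T = A\<^sup>T" using Z(2) unfolding ZY using Y A by (subst transpose_mult) auto
  then have AYA: "A * (Y * A) = A" by (metis transpose_transpose)
  define P where "P = Y * A * X"
  have P: "P \<in> carrier_mat nc nr" using Y A X by (simp add: P_def)
  have AP: "A * P = A * X"
  proof -
    have "A * P = A * (Y * A) * X" unfolding P_def using Y A X by (intro assoc_mult_mat[symmetric]) auto
    then show ?thesis by (simp add: AYA)
  qed
  have PA: "P * A = Y * A"
  proof -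
    have "P * A = Y * A * (X * A)" unfolding P_def using Y A X by (intro assoc_mult_mat) auto
    also have "\<dots> = Y * (A * (X * A))" using Y A X by (intro assoc_mult_mat) auto
    also have "A * (X * A) = A" using X(2) assoc_mult_mat[OF A X(1) A] by simp
    finally show ?thesis .
  qed
  have "P * A * P = Y * (A * P)" unfolding PA using Y A P by (intro assoc_mult_mat) auto
  also have "\<dots> = Y * (A * X)" by (simp add: AP)
  also have "\<dots> = P" unfolding P_def using Y A X by (intro assoc_mult_mat[symmetric]) auto
  finally have "P * A * P = P" .
  then have "is_pinv A P" unfolding is_pinv_def AP PA using P X YA by (simp add: nr_def nc_def)
  then show ?thesis ..
qed

lemma pinv_is_pinv: "is_pinv A (pinv A)"
  unfolding pinv_def using is_pinv_exists is_pinv_unique by (metis theI)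

lemma pinv_eqI: "is_pinv A P \<Longrightarrow> pinv A = P"
  using is_pinv_unique pinv_is_pinv by blast

lemma pinv_carrier [simp]: "A \<in> carrier_mat nr nc \<Longrightarrow> pinv A \<in> carrier_mat nc nr"
  using pinv_is_pinv[of A] by (auto simp: is_pinv_def)

lemma dim_pinv [simp]: "dim_row (pinv A) = dim_col A" "dim_col (pinv A) = dim_row A"
  using carrier_matD[OF pinv_carrier[OF carrier_matI[OF refl refl]]] by blast+

lemma pinv_transpose: "pinv A\<^sup>T = (pinv A)\<^sup>T"
  by (intro pinv_eqI is_pinv_transpose pinv_is_pinv)

section \<open>Closed formulas for the pseudoinverse at full rank\<close>

lemma symmetric_right_inverse:
  fixes S :: "real mat"
  assumes S: "S \<in> carrier_mat n n" "S\<^sup>T = S" and J: "J \<in> carrier_mat n n" and inv: "S * J = 1\<^sub>m n"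
  shows "J\<^sup>T = J"
proof -
  have tJ: "J\<^sup>T \<in> carrier_mat n n" using J by simp
  have "(S * J)\<^sup>T = J\<^sup>T * S" by (simp only: transpose_mult[OF S(1) J] S(2))
  then have JS: "J\<^sup>T * S = 1\<^sub>m n" by (simp add: inv)
  have "J\<^sup>T * S * J = J\<^sup>T * (S * J)" by (rule assoc_mult_mat[OF tJ S(1) J])
  then show ?thesis unfolding JS inv using J tJ by simp
qed

text \<open>\<open>A * (A\<^sup>T * J)\<close> is the identity, which leaves only the symmetry of
  \<open>A\<^sup>T * J * A\<close>, and that reduces to the symmetry of \<open>J\<close>.\<close>

lemma pinv_full_row_rank:
  assumes A: "A \<in> carrier_mat nr nc" and J: "J \<in> carrier_mat nr nr" and inv: "A * A\<^sup>T * J = 1\<^sub>m nr"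
  shows "pinv A = A\<^sup>T * J"
proof (rule pinv_eqI)
  have tA: "A\<^sup>T \<in> carrier_mat nc nr" using A by simp
  have "(A * A\<^sup>T)\<^sup>T = A * A\<^sup>T" by (simp only: transpose_mult[OF A tA] transpose_transpose)
  from symmetric_right_inverse[OF mult_carrier_mat[OF A tA] this J inv] have JT: "J\<^sup>T = J" .
  have AP: "A * (A\<^sup>T * J) = 1\<^sub>m nr" using assoc_mult_mat[OF A tA J] inv by simp
  have "(A\<^sup>T * J * A)\<^sup>T = A\<^sup>T * (A\<^sup>T * J)\<^sup>T" by (rule transpose_mult[OF mult_carrier_mat[OF tA J] A])
  also have "(A\<^sup>T * J)\<^sup>T = J * A" using transpose_mult[OF tA J] by (simp add: JT)
  also have "A\<^sup>T * (J * A) = A\<^sup>T * J * A" by (rule assoc_mult_mat[OF tA J A, symmetric])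
  finally have PAT: "(A\<^sup>T * J * A)\<^sup>T = A\<^sup>T * J * A" .
  have "A\<^sup>T * J * A * (A\<^sup>T * J) = A\<^sup>T * J * (A * (A\<^sup>T * J))"
    by (rule assoc_mult_mat[OF mult_carrier_mat[OF tA J] A mult_carrier_mat[OF tA J]])
  then have PAP: "A\<^sup>T * J * A * (A\<^sup>T * J) = A\<^sup>T * J"
    unfolding AP using right_mult_one_mat[OF mult_carrier_mat[OF tA J]] by simp
  show "is_pinv A (A\<^sup>T * J)"
    unfolding is_pinv_def AP PAT PAP using A J mult_carrier_mat[OF tA J] by simp
qed

lemma pinv_inverse:
  assumes A: "A \<in> carrier_mat n n" and J: "J \<in> carrier_mat n n" and inv: "A * J = 1\<^sub>m n"
  shows "pinv A = J"
proof (rule pinv_eqI)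
  have "J * A = 1\<^sub>m n" using mat_mult_left_right_inverse[OF A J inv] .
  then show "is_pinv A J" unfolding is_pinv_def inv using A J by simp
qed

text \<open>The adjugate writes the inverse with entries rational in those of \<open>S\<close>, so
  that continuity of inversion follows from continuity of determinants.\<close>

lemma right_inverse_adj_mat:
  fixes S :: "real mat"
  assumes "S \<in> carrier_mat n n" "det S \<noteq> 0"
  shows "S * ((1 / det S) \<cdot>\<^sub>m adj_mat S) = 1\<^sub>m n"
  using adj_mat(1,2)[OF assms(1)] assms
  by (simp add: mult_smult_distrib[of _ n n]) (rule eq_matI, auto)

lemma pinv_full_row_rank_adj:
  assumes A: "A \<in> carrier_mat nr nc" and d: "det (A * A\<^sup>T) \<noteq> 0"
  shows "pinv A = A\<^sup>T * ((1 / det (A * A\<^sup>T)) \<cdot>\<^sub>m adj_mat (A * A\<^sup>T))"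
proof -
  have S: "A * A\<^sup>T \<in> carrier_mat nr nr" using A by simp
  show ?thesis
    by (rule pinv_full_row_rank[OF A _ right_inverse_adj_mat[OF S d]]) (use adj_mat(1)[OF S] in simp)
qed

lemma pinv_nonsingular:
  assumes A: "A \<in> carrier_mat n n" and d: "det A \<noteq> 0"
  shows "A * pinv A = 1\<^sub>m n" "pinv A * A = 1\<^sub>m n"
proof -
  let ?J = "(1 / det A) \<cdot>\<^sub>m adj_mat A"
  have J: "?J \<in> carrier_mat n n" using adj_mat(1)[OF A] by simp
  have p: "pinv A = ?J" by (rule pinv_inverse[OF A J right_inverse_adj_mat[OF assms]])
  show 1: "A * pinv A = 1\<^sub>m n" unfolding p by (rule right_inverse_adj_mat[OF assms])
  show "pinv A * A = 1\<^sub>m n" by (rule mat_mult_left_right_inverse[OF A _ 1]) (use A in simp)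
qed

section \<open>Entrywise convergence of matrices\<close>

text \<open>The dimensions are fixed at every \<open>N\<close>, not just eventually, so that carrier
  facts are available at all indices when sequences are multiplied or joined.\<close>

definition mat_tendsto :: "(nat \<Rightarrow> real mat) \<Rightarrow> real mat \<Rightarrow> bool" where
  "mat_tendsto f F \<longleftrightarrow> (\<forall>N. f N \<in> carrier_mat (dim_row F) (dim_col F))
     \<and> (\<forall>i < dim_row F. \<forall>j < dim_col F. (\<lambda>N. f N $$ (i, j)) \<longlonglongrightarrow> F $$ (i, j))"

lemma mat_tendstoI:
  assumes "F \<in> carrier_mat nr nc" "\<And>N. f N \<in> carrier_mat nr nc"
    and "\<And>i j. i < nr \<Longrightarrow> j < nc \<Longrightarrow> (\<lambda>N. f N $$ (i, j)) \<longlonglongrightarrow> F $$ (i, j)"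
  shows "mat_tendsto f F"
  using assms by (auto simp: mat_tendsto_def)

lemma mat_tendstoD:
  assumes "mat_tendsto f F" "F \<in> carrier_mat nr nc"
  shows "f N \<in> carrier_mat nr nc"
    and "i < nr \<Longrightarrow> j < nc \<Longrightarrow> (\<lambda>N. f N $$ (i, j)) \<longlonglongrightarrow> F $$ (i, j)"
  using assms by (auto simp: mat_tendsto_def)

lemma mat_tendsto_const: "mat_tendsto (\<lambda>_. F) F"
  by (auto simp: mat_tendsto_def)

lemma mat_tendsto_eventually_eq:
  assumes f: "mat_tendsto f F" and g: "\<And>N. g N \<in> carrier_mat (dim_row F) (dim_col F)"
    and ev: "\<forall>\<^sub>F N in sequentially. f N = g N"
  shows "mat_tendsto g F"
proof -
  have "(\<lambda>N. g N $$ (i, j)) \<longlonglongrightarrow> F $$ (i, j)" if "i < dim_row F" "j < dim_col F" for i j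
  proof (rule Lim_transform_eventually)
    show "(\<lambda>N. f N $$ (i, j)) \<longlonglongrightarrow> F $$ (i, j)" using f that by (auto simp: mat_tendsto_def)
    show "\<forall>\<^sub>F N in sequentially. f N $$ (i, j) = g N $$ (i, j)"
      using ev by eventually_elim simp
  qed
  with g show ?thesis by (auto simp: mat_tendsto_def)
qed

lemma mat_tendsto_mult:
  assumes f: "mat_tendsto f F" and g: "mat_tendsto g G"
    and F: "F \<in> carrier_mat nr k" and G: "G \<in> carrier_mat k nc"
  shows "mat_tendsto (\<lambda>N. f N * g N) (F * G)"
proof (rule mat_tendstoI)
  show "F * G \<in> carrier_mat nr nc" using F G by simp
  show "f N * g N \<in> carrier_mat nr nc" for N
    by (rule mult_carrier_mat[OF mat_tendstoD(1)[OF f F] mat_tendstoD(1)[OF g G]])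
  fix i j assume ij: "i < nr" "j < nc"
  have eq: "(S * R) $$ (i, j) = (\<Sum>l<k. S $$ (i, l) * R $$ (l, j))"
    if "S \<in> carrier_mat nr k" "R \<in> carrier_mat k nc" for S R :: "real mat"
    using that ij by (simp add: scalar_prod_def lessThan_atLeast0)
  have "(\<lambda>N. \<Sum>l<k. f N $$ (i, l) * g N $$ (l, j)) \<longlonglongrightarrow> (\<Sum>l<k. F $$ (i, l) * G $$ (l, j))"
    using ij mat_tendstoD(2)[OF f F] mat_tendstoD(2)[OF g G] by (intro tendsto_intros) auto
  then show "(\<lambda>N. (f N * g N) $$ (i, j)) \<longlonglongrightarrow> (F * G) $$ (i, j)"
    using eq[OF F G] eq[OF mat_tendstoD(1)[OF f F] mat_tendstoD(1)[OF g G]] by simp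
qed

lemma mat_tendsto_transpose:
  assumes "mat_tendsto f F" shows "mat_tendsto (\<lambda>N. (f N)\<^sup>T) F\<^sup>T"
proof -
  have "f N \<in> carrier_mat (dim_row F) (dim_col F)" for N using assms by (simp add: mat_tendsto_def)
  then have "dim_row (f N) = dim_row F" "dim_col (f N) = dim_col F" for N by auto
  then show ?thesis using assms by (auto simp: mat_tendsto_def)
qed

lemma mat_tendsto_smult:
  assumes "mat_tendsto f F" "c \<longlonglongrightarrow> d" shows "mat_tendsto (\<lambda>N. c N \<cdot>\<^sub>m f N) (d \<cdot>\<^sub>m F)"
proof -
  have "f N \<in> carrier_mat (dim_row F) (dim_col F)" for N using assms by (simp add: mat_tendsto_def)
  then have "dim_row (f N) = dim_row F" "dim_col (f N) = dim_col F" for N by auto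
  then show ?thesis using assms by (auto simp: mat_tendsto_def intro!: tendsto_mult)
qed

lemma mat_tendsto_uminus:
  assumes "mat_tendsto f F" shows "mat_tendsto (\<lambda>N. - f N) (- F)"
proof -
  have "f N \<in> carrier_mat (dim_row F) (dim_col F)" for N using assms by (simp add: mat_tendsto_def)
  then have "dim_row (f N) = dim_row F" "dim_col (f N) = dim_col F" for N by auto
  then show ?thesis using assms by (auto simp: mat_tendsto_def intro!: tendsto_minus)
qed

lemma append_cols_carrier [simp]:
  "F \<in> carrier_mat n a \<Longrightarrow> G \<in> carrier_mat n b \<Longrightarrow> F @\<^sub>c G \<in> carrier_mat n (a + b)"
  by (auto simp: append_cols_def)

lemma append_cols_index:
  assumes "F \<in> carrier_mat n a" "G \<in> carrier_mat n b" "i < n" "j < a + b"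
  shows "(F @\<^sub>c G) $$ (i, j) = (if j < a then F $$ (i, j) else G $$ (i, j - a))"
  using assms by (auto simp: append_cols_def)

lemma mat_tendsto_append_cols:
  assumes f: "mat_tendsto f F" and g: "mat_tendsto g G"
    and F: "F \<in> carrier_mat n a" and G: "G \<in> carrier_mat n b"
  shows "mat_tendsto (\<lambda>N. f N @\<^sub>c g N) (F @\<^sub>c G)"
proof (rule mat_tendstoI)
  note fc = mat_tendstoD(1)[OF f F] and gc = mat_tendstoD(1)[OF g G]
  show "F @\<^sub>c G \<in> carrier_mat n (a + b)" using F G by simp
  show "f N @\<^sub>c g N \<in> carrier_mat n (a + b)" for N using fc gc by simp
  fix i j assume ij: "i < n" "j < a + b"
  show "(\<lambda>N. (f N @\<^sub>c g N) $$ (i, j)) \<longlonglongrightarrow> (F @\<^sub>c G) $$ (i, j)"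
    using mat_tendstoD(2)[OF f F ij(1)] mat_tendstoD(2)[OF g G ij(1)] ij(2)
    by (cases "j < a") (simp_all add: append_cols_index[OF F G ij] append_cols_index[OF fc gc ij])
qed

lemma mat_tendsto_det:
  assumes f: "mat_tendsto f F" and F: "F \<in> carrier_mat n n"
  shows "(\<lambda>N. det (f N)) \<longlonglongrightarrow> det F"
proof -
  have "(\<lambda>N. \<Sum>p | p permutes {0..<n}. signof p * (\<Prod>i = 0..<n. f N $$ (i, p i)))
      \<longlonglongrightarrow> (\<Sum>p | p permutes {0..<n}. signof p * (\<Prod>i = 0..<n. F $$ (i, p i)))"
    by (intro tendsto_intros mat_tendstoD(2)[OF f F]) (auto dest: permutes_in_image)
  then show ?thesis by (simp add: det_def'[OF F] det_def'[OF mat_tendstoD(1)[OF f F]])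
qed

lemma mat_tendsto_adj_mat:
  assumes f: "mat_tendsto f F" and F: "F \<in> carrier_mat n n"
  shows "mat_tendsto (\<lambda>N. adj_mat (f N)) (adj_mat F)"
proof (rule mat_tendstoI)
  note fc = mat_tendstoD(1)[OF f F]
  show "adj_mat F \<in> carrier_mat n n" by (rule adj_mat(1)[OF F])
  show "adj_mat (f N) \<in> carrier_mat n n" for N by (rule adj_mat(1)[OF fc])
  fix i j assume ij: "i < n" "j < n"
  have "mat_tendsto (\<lambda>N. mat_delete (f N) j i) (mat_delete F j i)"
  proof (rule mat_tendstoI)
    show "mat_delete F j i \<in> carrier_mat (n - 1) (n - 1)"
      "mat_delete (f N) j i \<in> carrier_mat (n - 1) (n - 1)" for N
      using F fc[of N] by (auto simp: mat_delete_def)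
    fix r c assume "r < n - 1" "c < n - 1"
    then show "(\<lambda>N. mat_delete (f N) j i $$ (r, c)) \<longlonglongrightarrow> mat_delete F j i $$ (r, c)"
      using mat_tendstoD(2)[OF f F] F carrier_matD[OF fc] ij by (auto simp: mat_delete_def)
  qed
  then have "(\<lambda>N. cofactor (f N) j i) \<longlonglongrightarrow> cofactor F j i"
    unfolding cofactor_def using F by (intro tendsto_intros mat_tendsto_det) (auto simp: mat_delete_def)
  then show "(\<lambda>N. adj_mat (f N) $$ (i, j)) \<longlonglongrightarrow> adj_mat F $$ (i, j)"
    using F carrier_matD[OF fc] ij by (simp add: adj_mat_def)
qed

text \<open>A nonzero determinant of the limiting Gram matrix stays nonzero nearby, so the closed
  formula eventually holds for \<open>f N\<close> as well and is continuous.\<close>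

lemma mat_tendsto_pinv_full_row_rank:
  assumes f: "mat_tendsto f F" and F: "F \<in> carrier_mat nr nc" and d: "det (F * F\<^sup>T) \<noteq> 0"
  shows "mat_tendsto (\<lambda>N. pinv (f N)) (pinv F)"
proof -
  note fc = mat_tendstoD(1)[OF f F]
  let ?J = "\<lambda>A. (1 / det (A * A\<^sup>T)) \<cdot>\<^sub>m adj_mat (A * A\<^sup>T)"
  have tF: "F\<^sup>T \<in> carrier_mat nc nr" using F by simp
  have S: "F * F\<^sup>T \<in> carrier_mat nr nr" using F by simp
  have limS: "mat_tendsto (\<lambda>N. f N * (f N)\<^sup>T) (F * F\<^sup>T)"
    by (rule mat_tendsto_mult[OF f mat_tendsto_transpose[OF f] F tF])
  have limd: "(\<lambda>N. det (f N * (f N)\<^sup>T)) \<longlonglongrightarrow> det (F * F\<^sup>T)" by (rule mat_tendsto_det[OF limS S])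
  have J: "?J F \<in> carrier_mat nr nr" using adj_mat(1)[OF S] by simp
  have limJ: "mat_tendsto (\<lambda>N. ?J (f N)) (?J F)"
    by (intro mat_tendsto_smult mat_tendsto_adj_mat[OF limS S] tendsto_divide limd tendsto_const d)
  have lim: "mat_tendsto (\<lambda>N. (f N)\<^sup>T * ?J (f N)) (F\<^sup>T * ?J F)"
    by (rule mat_tendsto_mult[OF mat_tendsto_transpose[OF f] limJ tF J])
  have "\<forall>\<^sub>F N in sequentially. det (f N * (f N)\<^sup>T) \<noteq> 0"
    using limd d by (rule tendsto_imp_eventually_ne)
  then have ev: "\<forall>\<^sub>F N in sequentially. (f N)\<^sup>T * ?J (f N) = pinv (f N)"
    by eventually_elim (simp add: pinv_full_row_rank_adj[OF fc])
  have p: "F\<^sup>T * ?J F = pinv F" by (rule pinv_full_row_rank_adj[OF F d, symmetric])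
  show ?thesis
    by (rule mat_tendsto_eventually_eq[OF lim[unfolded p] _ ev])
      (simp only: dim_pinv carrier_matD[OF F] pinv_carrier[OF fc])
qed

lemma mat_tendsto_pinv_full_column_rank:
  assumes f: "mat_tendsto f F" and F: "F \<in> carrier_mat nr nc" and d: "det (F\<^sup>T * F) \<noteq> 0"
  shows "mat_tendsto (\<lambda>N. pinv (f N)) (pinv F)"
proof -
  have "mat_tendsto (\<lambda>N. pinv (f N)\<^sup>T) (pinv F\<^sup>T)"
    by (rule mat_tendsto_pinv_full_row_rank[OF mat_tendsto_transpose[OF f]]) (use F d in auto)
  from mat_tendsto_transpose[OF this] show ?thesis by (simp only: pinv_transpose transpose_transpose)
qed

lemma mat_tendsto_prod_mats:
  assumes "\<And>x. x \<in> set xs \<Longrightarrow> mat_tendsto (\<lambda>N. f N x) (F x)"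
    and "\<And>x. x \<in> set xs \<Longrightarrow> F x \<in> carrier_mat n n"
  shows "mat_tendsto (\<lambda>N. prod_mats n (map (f N) xs)) (prod_mats n (map F xs))
    \<and> prod_mats n (map F xs) \<in> carrier_mat n n"
  using assms
proof (induction xs)
  case Nil
  then show ?case by (simp add: prod_mats_def mat_tendsto_const)
next
  case (Cons x xs)
  then have IH: "mat_tendsto (\<lambda>N. prod_mats n (map (f N) xs)) (prod_mats n (map F xs))"
    "prod_mats n (map F xs) \<in> carrier_mat n n" and x: "mat_tendsto (\<lambda>N. f N x) (F x)" "F x \<in> carrier_mat n n"
    by auto
  show ?case using mat_tendsto_mult[OF x(1) IH(1) x(2) IH(2)] IH(2) x(2) by (simp add: prod_mats_def)
qed

lemma mat_tendsto_block_row: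
  assumes "\<And>x. x \<in> set xs \<Longrightarrow> mat_tendsto (\<lambda>N. f N x) (F x)"
    and "\<And>x. x \<in> set xs \<Longrightarrow> F x \<in> carrier_mat n (c x)"
  shows "mat_tendsto (\<lambda>N. block_row n (map (f N) xs)) (block_row n (map F xs))
    \<and> block_row n (map F xs) \<in> carrier_mat n (\<Sum>x\<leftarrow>xs. c x)"
  using assms
proof (induction xs)
  case Nil
  then show ?case by (simp add: block_row_def mat_tendsto_const)
next
  case (Cons x xs)
  then have IH: "mat_tendsto (\<lambda>N. block_row n (map (f N) xs)) (block_row n (map F xs))"
    "block_row n (map F xs) \<in> carrier_mat n (\<Sum>x\<leftarrow>xs. c x)"
    and x: "mat_tendsto (\<lambda>N. f N x) (F x)" "F x \<in> carrier_mat n (c x)"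
    by auto
  show ?case using mat_tendsto_append_cols[OF x(1) IH(1) x(2) IH(2)] append_cols_carrier[OF x(2) IH(2)]
    by (simp add: block_row_def)
qed

lemma vec_tendsto_mult_mat_vec:
  assumes f: "mat_tendsto f F" and F: "F \<in> carrier_mat nr nc"
    and g: "vec_tendsto g v" and v: "v \<in> carrier_vec nc"
  shows "vec_tendsto (\<lambda>N. f N *\<^sub>v g N) (F *\<^sub>v v)"
proof -
  note fc = mat_tendstoD(1)[OF f F]
  have gc: "dim_vec (g N) = nc" for N using g v by (auto simp: vec_tendsto_def)
  have gl: "(\<lambda>N. g N $ j) \<longlonglongrightarrow> v $ j" if "j < nc" for j using g v that by (auto simp: vec_tendsto_def)
  have "(\<lambda>N. (f N *\<^sub>v g N) $ i) \<longlonglongrightarrow> (F *\<^sub>v v) $ i" if i: "i < nr" for i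
  proof -
    have "(\<lambda>N. \<Sum>l<nc. f N $$ (i, l) * g N $ l) \<longlonglongrightarrow> (\<Sum>l<nc. F $$ (i, l) * v $ l)"
      using i mat_tendstoD(2)[OF f F] gl by (intro tendsto_intros) auto
    then show ?thesis
      using i F v carrier_matD[OF fc] gc by (simp add: scalar_prod_def lessThan_atLeast0)
  qed
  then show ?thesis using F carrier_matD[OF fc] by (auto simp: vec_tendsto_def)
qed

lemma vec_tendsto_const: "vec_tendsto (\<lambda>_. v) v"
  by (simp add: vec_tendsto_def)

section \<open>Controllability and minimum-energy control\<close>

lemma self_scalar_prod_zero:
  fixes w :: "real vec"
  assumes "w \<bullet> w = 0" shows "w = 0\<^sub>v (dim_vec w)"
  using assms by (intro eq_vecI) (auto simp: scalar_prod_def sum_nonneg_eq_0_iff)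

lemma det_gram_nonzero:
  fixes F :: "real mat"
  assumes F: "F \<in> carrier_mat nr nc"
    and ker: "\<And>v. v \<in> carrier_vec nr \<Longrightarrow> F\<^sup>T *\<^sub>v v = 0\<^sub>v nc \<Longrightarrow> v = 0\<^sub>v nr"
  shows "det (F * F\<^sup>T) \<noteq> 0"
proof
  assume "det (F * F\<^sup>T) = 0"
  moreover have tF: "F\<^sup>T \<in> carrier_mat nc nr" using F by simp
  ultimately obtain v where v: "v \<in> carrier_vec nr" "v \<noteq> 0\<^sub>v nr" "F * F\<^sup>T *\<^sub>v v = 0\<^sub>v nr"
    using det_0_iff_vec_prod_zero_field[OF mult_carrier_mat[OF F tF]] by blast
  let ?w = "F\<^sup>T *\<^sub>v v"
  have w: "?w \<in> carrier_vec nc" using tF v(1) by simp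
  have "?w \<bullet> ?w = v \<bullet> (F *\<^sub>v ?w)" by (rule transpose_vec_mult_scalar[OF F w v(1)])
  also have "F *\<^sub>v ?w = 0\<^sub>v nr" using v(3) assoc_mult_mat_vec[OF F tF v(1)] by simp
  finally have "?w \<bullet> ?w = 0" using v(1) by simp
  from self_scalar_prod_zero[OF this] have "?w = 0\<^sub>v nc" using carrier_vecD[OF w] by simp
  with ker v show False by blast
qed

lemma maximal_independent_columns:
  fixes F :: "real mat"
  assumes F: "F \<in> carrier_mat nr nc"
  obtains ss where "set ss \<subseteq> set (cols F)" "distinct ss" "module.lin_indpt class_ring (module_vec TYPE(real) nr) (set ss)"
    "length ss = vec_space.rank nr F"
proof -
  interpret vec_space "TYPE(real)" nr .
  obtain S where S: "maximal S (\<lambda>T. T \<subseteq> set (cols F) \<and> lin_indpt T)"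
    using maximal_exists[of "(\<lambda>T. T \<subseteq> set (cols F) \<and> lin_indpt T)" "card (set (cols F))" "{}"]
    by (meson List.finite_set card_mono empty_iff empty_subsetI finite_lin_indpt2 rev_finite_subset)
  then have S': "S \<subseteq> set (cols F)" "lin_indpt S" by (auto simp: maximal_def)
  then have "finite S" using finite_subset by blast
  then obtain ss where ss: "set ss = S" "distinct ss" using finite_distinct_list by blast
  then have "length ss = rank F" using rank_card_indpt[OF F S] distinct_card by fastforce
  with ss S' that show ?thesis by blast
qed

text \<open>Rank \<open>nr\<close> provides \<open>nr\<close> independent columns, which form an
  invertible square matrix \<open>E\<close>. A vector orthogonal to all columns of \<open>F\<close>
  is annihilated by \<open>E\<^sup>T\<close>.\<close>

lemma full_row_rank_kernel:
  fixes F :: "real mat"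
  assumes F: "F \<in> carrier_mat nr nc" and r: "vec_space.rank nr F = nr"
    and v: "v \<in> carrier_vec nr" and z: "F\<^sup>T *\<^sub>v v = 0\<^sub>v nc"
  shows "v = 0\<^sub>v nr"
proof (rule ccontr)
  assume nz: "v \<noteq> 0\<^sub>v nr"
  interpret vec_space "TYPE(real)" nr .
  obtain ss where ss: "set ss \<subseteq> set (cols F)" "distinct ss" "lin_indpt (set ss)" "length ss = nr"
    using maximal_independent_columns[OF F] unfolding r by blast
  define E where "E = mat_of_cols nr ss"
  have E: "E \<in> carrier_mat nr nr" using mat_of_cols_carrier(1)[of nr ss] by (simp add: E_def ss(4))
  have "set ss \<subseteq> carrier_vec nr" using ss(1) cols_dim[of F] F by auto
  then have cE: "cols E = ss" by (simp add: E_def)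
  have "rank E = nr" by (rule lin_indpt_full_rank[OF E]) (use ss cE in auto)
  then have "det E \<noteq> 0" using det_rank_iff[OF E] by blast
  then have "det E\<^sup>T \<noteq> 0" using det_transpose[OF E] by simp
  moreover have tE: "E\<^sup>T \<in> carrier_mat nr nr" using E by simp
  moreover have "E\<^sup>T *\<^sub>v v = 0\<^sub>v nr"
  proof (rule eq_vecI)
    fix i assume "i < dim_vec (0\<^sub>v nr :: real vec)"
    then have i: "i < nr" by simp
    then have "col E i \<in> set (cols F)" using cE ss(1,4) E by (metis carrier_matD(2) cols_length cols_nth nth_mem subsetD)
    then obtain j where j: "j < nc" "col E i = col F j" using F by (auto simp: cols_def)
    have "(E\<^sup>T *\<^sub>v v) $ i = col F j \<bullet> v" using i E j by simp
    also have "\<dots> = (F\<^sup>T *\<^sub>v v) $ j" using F j by simp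
    finally show "(E\<^sup>T *\<^sub>v v) $ i = 0\<^sub>v nr $ i" using z i j by simp
  qed (use E in simp)
  ultimately show False using det_0_iff_vec_prod_zero_field[OF tE] v nz by blast
qed

text \<open>Linear independence is a property of the set of columns and would overlook a repeated
  column. Counting excludes repetitions: \<open>nc\<close> independent vectors can be found among
  the columns.\<close>

lemma full_column_rank_kernel:
  fixes F :: "real mat"
  assumes F: "F \<in> carrier_mat nr nc" and r: "vec_space.rank nr F = nc"
    and v: "v \<in> carrier_vec nc" and z: "F *\<^sub>v v = 0\<^sub>v nr"
  shows "v = 0\<^sub>v nc"
proof (rule ccontr)
  assume nz: "v \<noteq> 0\<^sub>v nc"
  interpret vec_space "TYPE(real)" nr .
  obtain ss where ss: "set ss \<subseteq> set (cols F)" "distinct ss" "lin_indpt (set ss)" "length ss = nc"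
    using maximal_independent_columns[OF F] unfolding r by blast
  have len: "length (cols F) = nc" using F by simp
  have "nc = card (set ss)" using ss(2,4) distinct_card by fastforce
  also have "\<dots> \<le> card (set (cols F))" using ss(1) by (intro card_mono) auto
  finally have "card (set (cols F)) = length (cols F)" using card_length[of "cols F"] len by linarith
  then have dist: "distinct (cols F)" by (rule card_distinct)
  from full_rank_lin_indpt[OF F r dist] lin_depI[OF F v nz z dist] show False by blast
qed

text \<open>The minimum covers wide and tall matrices; the controllability matrix is tall when the
  stacked input has fewer entries than the state.\<close>

lemma mat_tendsto_pinv:
  assumes f: "mat_tendsto f F" and F: "F \<in> carrier_mat nr nc"
    and r: "vec_space.rank nr F = min nr nc"
  shows "mat_tendsto (\<lambda>N. pinv (f N)) (pinv F)"
proof (cases "nr \<le> nc")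
  case True
  then have "vec_space.rank nr F = nr" using r by simp
  from mat_tendsto_pinv_full_row_rank[OF f F det_gram_nonzero[OF F full_row_rank_kernel[OF F this]]]
  show ?thesis .
next
  case False
  then have r': "vec_space.rank nr F = nc" using r by simp
  have tF: "F\<^sup>T \<in> carrier_mat nc nr" using F by simp
  have "det (F\<^sup>T * (F\<^sup>T)\<^sup>T) \<noteq> 0"
    by (rule det_gram_nonzero[OF tF]) (use full_column_rank_kernel[OF F r'] in simp)
  then show ?thesis using mat_tendsto_pinv_full_column_rank[OF f F] by simp
qed

section \<open>Block rows and matrix powers\<close>

lemma append_cols_mult_vec:
  assumes F: "F \<in> carrier_mat n a" and G: "G \<in> carrier_mat n b"
    and x: "x \<in> carrier_vec a" and y: "y \<in> carrier_vec b"
  shows "(F @\<^sub>c G) *\<^sub>v (x @\<^sub>v y) = F *\<^sub>v x + G *\<^sub>v y"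
proof (rule eq_vecI)
  fix i assume "i < dim_vec (F *\<^sub>v x + G *\<^sub>v y)"
  then have i: "i < n" using G by simp
  have "row (F @\<^sub>c G) i = row F i @\<^sub>v row G i"
    by (rule eq_vecI) (use F G i in \<open>auto simp: append_cols_def\<close>)
  then have "((F @\<^sub>c G) *\<^sub>v (x @\<^sub>v y)) $ i = (row F i @\<^sub>v row G i) \<bullet> (x @\<^sub>v y)"
    using i append_cols_carrier[OF F G] by simp
  also have "\<dots> = row F i \<bullet> x + row G i \<bullet> y"
    by (rule scalar_prod_append) (use F G x y in auto)
  finally show "((F @\<^sub>c G) *\<^sub>v (x @\<^sub>v y)) $ i = (F *\<^sub>v x + G *\<^sub>v y) $ i" using i F G by simp
qed (simp only: dim_mult_mat_vec index_add_vec carrier_matD[OF append_cols_carrier[OF F G]] carrier_matD[OF G])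

lemma mult_append_cols:
  assumes E: "E \<in> carrier_mat k n" and F: "F \<in> carrier_mat n a" and G: "G \<in> carrier_mat n b"
  shows "E * (F @\<^sub>c G) = (E * F) @\<^sub>c (E * G)"
proof (rule eq_matI)
  note FG = append_cols_carrier[OF F G]
    and EFG = append_cols_carrier[OF mult_carrier_mat[OF E F] mult_carrier_mat[OF E G]]
  fix i j assume "i < dim_row (E * F @\<^sub>c E * G)" "j < dim_col (E * F @\<^sub>c E * G)"
  then have ij: "i < k" "j < a + b" using EFG by auto
  have c: "col (F @\<^sub>c G) j = (if j < a then col F j else col G (j - a))"
    using carrier_matD[OF FG] F G ij append_cols_index[OF F G _ ij(2)] by (intro eq_vecI) auto
  show "(E * (F @\<^sub>c G)) $$ (i, j) = (E * F @\<^sub>c E * G) $$ (i, j)"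
    unfolding append_cols_index[OF mult_carrier_mat[OF E F] mult_carrier_mat[OF E G] ij]
    using ij E F G carrier_matD[OF FG] c by auto
qed (use append_cols_carrier[OF F G] append_cols_carrier[OF mult_carrier_mat[OF E F] mult_carrier_mat[OF E G]] E in auto)

lemma append_cols_assoc:
  assumes "E \<in> carrier_mat n a" "F \<in> carrier_mat n b" "G \<in> carrier_mat n c"
  shows "(E @\<^sub>c F) @\<^sub>c G = E @\<^sub>c (F @\<^sub>c G)"
  by (rule eq_matI) (use assms in \<open>auto simp: append_cols_def\<close>)

lemma block_row_carrier:
  assumes "\<And>F. F \<in> set Fs \<Longrightarrow> F \<in> carrier_mat n (dim_col F)"
  shows "block_row n Fs \<in> carrier_mat n (\<Sum>F\<leftarrow>Fs. dim_col F)"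
  using assms
proof (induction Fs)
  case (Cons F Fs)
  then have "F @\<^sub>c block_row n Fs \<in> carrier_mat n (dim_col F + (\<Sum>F\<leftarrow>Fs. dim_col F))"
    by (intro append_cols_carrier) auto
  then show ?case by (simp add: block_row_def)
qed (simp add: block_row_def)

lemma block_row_append:
  assumes "\<And>F. F \<in> set (Fs @ Gs) \<Longrightarrow> F \<in> carrier_mat n (dim_col F)"
  shows "block_row n (Fs @ Gs) = block_row n Fs @\<^sub>c block_row n Gs"
  using assms
proof (induction Fs)
  case Nil
  have "block_row n Gs \<in> carrier_mat n (\<Sum>F\<leftarrow>Gs. dim_col F)"
    by (rule block_row_carrier) (use Nil in auto)
  then show ?case by (intro eq_matI) (auto simp: block_row_def append_cols_def)
next
  case (Cons F Fs)
  have F: "F \<in> carrier_mat n (dim_col F)" using Cons.prems by auto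
  have Fs: "block_row n Fs \<in> carrier_mat n (\<Sum>F\<leftarrow>Fs. dim_col F)"
    by (rule block_row_carrier) (use Cons.prems in auto)
  have Gs: "block_row n Gs \<in> carrier_mat n (\<Sum>F\<leftarrow>Gs. dim_col F)"
    by (rule block_row_carrier) (use Cons.prems in auto)
  have "block_row n ((F # Fs) @ Gs) = F @\<^sub>c (block_row n Fs @\<^sub>c block_row n Gs)"
    using Cons by (simp add: block_row_def)
  also have "\<dots> = (F @\<^sub>c block_row n Fs) @\<^sub>c block_row n Gs"
    by (rule append_cols_assoc[OF F Fs Gs, symmetric])
  finally show ?case by (simp add: block_row_def)
qed

lemma mult_block_row:
  assumes E: "E \<in> carrier_mat k n" and "\<And>F. F \<in> set Fs \<Longrightarrow> F \<in> carrier_mat n (dim_col F)"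
  shows "E * block_row n Fs = block_row k (map ((*) E) Fs)"
  using assms(2)
proof (induction Fs)
  case Nil
  then show ?case using E by (simp add: block_row_def)
next
  case (Cons F Fs)
  have F: "F \<in> carrier_mat n (dim_col F)" using Cons.prems by auto
  have Fs: "block_row n Fs \<in> carrier_mat n (\<Sum>F\<leftarrow>Fs. dim_col F)"
    by (rule block_row_carrier) (use Cons.prems in auto)
  show ?case using mult_append_cols[OF E F Fs] Cons by (simp add: block_row_def)
qed

lemma pow_mat_add:
  assumes A: "(A :: real mat) \<in> carrier_mat n n"
  shows "A ^\<^sub>m (a + b) = A ^\<^sub>m a * A ^\<^sub>m b"
proof (induction b)
  case 0
  then show ?case using A pow_carrier_mat[OF A, of a] by simp
next
  case (Suc b)
  then show ?case using assoc_mult_mat[OF pow_carrier_mat[OF A, of a] pow_carrier_mat[OF A, of b] A] by simp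
qed

section \<open>The exact controllability matrix and minimum-energy control\<close>

context
  fixes A B :: "real mat" and n m :: nat
  assumes A: "A \<in> carrier_mat n n" and B: "B \<in> carrier_mat n m"
begin

lemma ctrb_carrier: "ctrb A B T \<in> carrier_mat n (m * T)"
proof -
  have "block_row n (map (\<lambda>s. A ^\<^sub>m s * B) [0..<T]) \<in> carrier_mat n (\<Sum>s\<leftarrow>[0..<T]. m)"
    using mat_tendsto_block_row[where f = "\<lambda>_. (\<lambda>s. A ^\<^sub>m s * B)", OF mat_tendsto_const
      mult_carrier_mat[OF pow_carrier_mat[OF A] B]] by blast
  then show ?thesis using A by (simp add: ctrb_def sum_list_triv mult.commute)
qed

text \<open>In reversed time order the leading blocks belong to the last \<open>a\<close> inputs;
  the effect of the first \<open>b\<close> inputs is carried through the remaining \<open>a\<close>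
  steps by \<open>A ^\<^sub>m a\<close>. The estimator is assembled by the same rule.\<close>

lemma ctrb_add: "ctrb A B (a + b) = ctrb A B a @\<^sub>c (A ^\<^sub>m a * ctrb A B b)"
proof -
  have c: "A ^\<^sub>m s * B \<in> carrier_mat n (dim_col (A ^\<^sub>m s * B))" for s
    using mult_carrier_mat[OF pow_carrier_mat[OF A, of s] B] B by (simp add: carrier_matD(2)[OF B])
  have e: "A ^\<^sub>m a * (A ^\<^sub>m s * B) = A ^\<^sub>m (s + a) * B" for s
    unfolding add.commute[of s a] pow_mat_add[OF A]
    by (rule assoc_mult_mat[OF pow_carrier_mat[OF A] pow_carrier_mat[OF A] B, symmetric])
  have "[0..<a + b] = [0..<a] @ map (\<lambda>s. s + a) [0..<b]"
    using upt_add_eq_append[of 0 a b] map_add_upt[of a b] by (simp add: add.commute)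
  then have "ctrb A B (a + b) = block_row n (map (\<lambda>s. A ^\<^sub>m s * B) [0..<a] @ map (\<lambda>s. A ^\<^sub>m (s + a) * B) [0..<b])"
    using A by (simp add: ctrb_def comp_def)
  also have "\<dots> = ctrb A B a @\<^sub>c block_row n (map (\<lambda>s. A ^\<^sub>m (s + a) * B) [0..<b])"
    using A c by (subst block_row_append) (auto simp: ctrb_def)
  also have "block_row n (map (\<lambda>s. A ^\<^sub>m (s + a) * B) [0..<b]) = A ^\<^sub>m a * ctrb A B b"
  proof -
    have "F \<in> carrier_mat n (dim_col F)" if "F \<in> set (map (\<lambda>s. A ^\<^sub>m s * B) [0..<b])" for F
      using that c by auto
    from mult_block_row[OF pow_carrier_mat[OF A, of a], of "map (\<lambda>s. A ^\<^sub>m s * B) [0..<b]", OF this]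
    show ?thesis
      using A by (simp add: ctrb_def comp_def e)
  qed
  finally show ?thesis .
qed

lemma ctrb_one: "ctrb A B 1 = B"
  using A B by (intro eq_matI) (auto simp: ctrb_def block_row_def append_cols_def)

lemma state_at_cong:
  assumes "\<And>s. s < t \<Longrightarrow> u s = u' s"
  shows "state_at A B x0 u t = state_at A B x0 u' t"
  using assms by (induction t) auto

text \<open>The induction splits off the leading block \<open>u1\<close>, which by the reversed
  order is the last input. The rest \<open>u2\<close> drives the first \<open>T\<close> steps, its
  offsets being smaller by one block.\<close>

lemma final_state_eq:
  assumes x0: "x0 \<in> carrier_vec n" and "uT \<in> carrier_vec (m * T)"
  shows "final_state A B T x0 uT = A ^\<^sub>m T *\<^sub>v x0 + ctrb A B T *\<^sub>v uT"
  using assms(2)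
proof (induction T arbitrary: uT)
  case 0
  have "ctrb A B 0 *\<^sub>v uT = 0\<^sub>v n"
    using 0 ctrb_carrier[of 0] by (intro eq_vecI) (auto simp: scalar_prod_def)
  then show ?case using A x0 by (simp add: final_state_def)
next
  case (Suc T)
  define u1 where "u1 = vec_first uT m"
  define u2 where "u2 = vec_last uT (m * T)"
  have u: "uT = u1 @\<^sub>v u2" using Suc.prems by (simp add: u1_def u2_def)
  have c: "u1 \<in> carrier_vec m" "u2 \<in> carrier_vec (m * T)" by (simp_all add: u1_def u2_def)
  have "input_at m (Suc T) uT t = input_at m T u2 t" if "t < T" for t
  proof (rule eq_vecI)
    fix r assume "r < dim_vec (input_at m T u2 t)"
    then have r: "r < m" by (simp add: input_at_def)
    have o: "(T - t) * m = m + (T - 1 - t) * m" using that by (cases "T - t") (auto simp: Suc_diff_le)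
    have "(T - 1 - t) * m + r < (T - 1 - t) * m + m" using r by simp
    also have "\<dots> \<le> m * T" using that o by (metis add.commute diff_le_self mult.commute mult_le_mono1)
    finally show "input_at m (Suc T) uT t $ r = input_at m T u2 t $ r"
      using r c by (simp add: input_at_def u o append_vec_def)
  qed (simp add: input_at_def)
  then have "state_at A B x0 (input_at m (Suc T) uT) T = final_state A B T x0 u2"
    using B unfolding final_state_def by (intro state_at_cong) auto
  moreover have "input_at m (Suc T) uT T = u1"
    using c by (intro eq_vecI) (auto simp: input_at_def u append_vec_def)
  ultimately have "final_state A B (Suc T) x0 uT = A *\<^sub>v (A ^\<^sub>m T *\<^sub>v x0 + ctrb A B T *\<^sub>v u2) + B *\<^sub>v u1"
    using B Suc.IH[OF c(2)] by (simp add: final_state_def)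
  also have "A *\<^sub>v (A ^\<^sub>m T *\<^sub>v x0 + ctrb A B T *\<^sub>v u2) = A ^\<^sub>m (1 + T) *\<^sub>v x0 + A *\<^sub>v (ctrb A B T *\<^sub>v u2)"
    unfolding pow_mat_add[OF A]
    using A mult_add_distrib_mat_vec[OF A mult_mat_vec_carrier[OF pow_carrier_mat[OF A] x0] mult_mat_vec_carrier[OF ctrb_carrier c(2)]]
      assoc_mult_mat_vec[OF A pow_carrier_mat[OF A] x0] by simp
  also have "A *\<^sub>v (ctrb A B T *\<^sub>v u2) = (A * ctrb A B T) *\<^sub>v u2"
    by (rule assoc_mult_mat_vec[OF A ctrb_carrier c(2), symmetric])
  also have "A ^\<^sub>m (1 + T) *\<^sub>v x0 + (A * ctrb A B T) *\<^sub>v u2 + B *\<^sub>v u1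
      = A ^\<^sub>m (1 + T) *\<^sub>v x0 + (B *\<^sub>v u1 + (A * ctrb A B T) *\<^sub>v u2)"
    unfolding assoc_add_vec[OF mult_mat_vec_carrier[OF pow_carrier_mat[OF A, of "1 + T"] x0]
        mult_mat_vec_carrier[OF mult_carrier_mat[OF A ctrb_carrier[of T]] c(2)] mult_mat_vec_carrier[OF B c(1)]]
      comm_add_vec[OF mult_mat_vec_carrier[OF mult_carrier_mat[OF A ctrb_carrier[of T]] c(2)]
        mult_mat_vec_carrier[OF B c(1)]] ..
  also have "B *\<^sub>v u1 + (A * ctrb A B T) *\<^sub>v u2 = ctrb A B (1 + T) *\<^sub>v uT"
    using append_cols_mult_vec[OF B mult_carrier_mat[OF A ctrb_carrier[of T]] c] pow_mat_add[OF A, of 1 0] A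
    unfolding u ctrb_add[of 1 T, unfolded ctrb_one] by simp
  finally show ?case by simp
qed

text \<open>\<open>?P * ?C\<close> is symmetric, fixes \<open>u\<close> and annihilates the kernel
  of \<open>?C\<close>; hence \<open>u\<close> is orthogonal to the difference \<open>z\<close> of
  any two steering inputs. Pythagoras gives strict minimality.\<close>

lemma pinv_min_energy:
  assumes x0: "x0 \<in> carrier_vec n" and xf: "xf \<in> carrier_vec n" and reach: "reachable A B T x0 xf"
  shows "is_min_energy_control A B T x0 xf (pinv (ctrb A B T) *\<^sub>v (xf - A ^\<^sub>m T *\<^sub>v x0))"
proof -
  let ?C = "ctrb A B T" and ?P = "pinv (ctrb A B T)"
  define d where "d = xf - A ^\<^sub>m T *\<^sub>v x0"
  define u where "u = ?P *\<^sub>v d"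
  note C = ctrb_carrier[of T] and P = pinv_carrier[OF ctrb_carrier[of T]]
  note Ax = mult_mat_vec_carrier[OF pow_carrier_mat[OF A, of T] x0]
  have d: "d \<in> carrier_vec n" using xf Ax by (simp add: d_def)
  have u: "u \<in> carrier_vec (m * T)" unfolding u_def by (rule mult_mat_vec_carrier[OF P d])
  have pi: "?C * ?P * ?C = ?C" "?P * ?C * ?P = ?P" "(?P * ?C)\<^sup>T = ?P * ?C"
    using pinv_is_pinv[of ?C] by (auto simp: is_pinv_def)
  obtain w where w: "w \<in> carrier_vec (m * T)" "?C *\<^sub>v w = d"
    using reach B by (auto simp: reachable_def d_def)
  have "?C *\<^sub>v u = ?C * ?P * ?C *\<^sub>v w"
    using assoc_mult_mat_vec[OF C P d] assoc_mult_mat_vec[OF mult_carrier_mat[OF C P] C w(1)]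
    by (simp only: u_def w(2))
  then have Cu: "?C *\<^sub>v u = d" by (simp only: pi w(2))
  have fin: "final_state A B T x0 v = xf \<longleftrightarrow> ?C *\<^sub>v v = d" if v: "v \<in> carrier_vec (m * T)" for v
  proof -
    have Cv: "?C *\<^sub>v v \<in> carrier_vec n" by (rule mult_mat_vec_carrier[OF C v])
    have "a + c = y \<longleftrightarrow> c = y - a" if "a \<in> carrier_vec n" "c \<in> carrier_vec n" "y \<in> carrier_vec n"
      for a c y :: "real vec"
      using that by (auto simp: vec_eq_iff)
    from this[OF Ax Cv xf] show ?thesis unfolding final_state_eq[OF x0 v] d_def .
  qed
  have opt: "u \<bullet> u < v \<bullet> v" if v: "v \<in> carrier_vec (m * T)" "?C *\<^sub>v v = d" "v \<noteq> u"
    for v :: "real vec"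
  proof -
    define z where "z = v - u"
    have z: "z \<in> carrier_vec (m * T)" using v u by (simp add: z_def)
    have Cz: "?C *\<^sub>v z = 0\<^sub>v n"
      unfolding z_def mult_minus_distrib_mat_vec[OF C v(1) u] Cu v(2) using d by simp
    have PC: "?P * ?C \<in> carrier_mat (m * T) (m * T)" by (rule mult_carrier_mat[OF P C])
    have "(?P * ?C) *\<^sub>v u = ?P *\<^sub>v (?C *\<^sub>v u)" by (rule assoc_mult_mat_vec[OF P C u])
    then have PCu: "(?P * ?C) *\<^sub>v u = u" unfolding Cu u_def[symmetric] .
    have P0: "?P *\<^sub>v 0\<^sub>v n = 0\<^sub>v (m * T)"
      using carrier_matD[OF P] by (intro eq_vecI) (auto simp: scalar_prod_def)
    have PCz: "(?P * ?C) *\<^sub>v z = 0\<^sub>v (m * T)"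
      using assoc_mult_mat_vec[OF P C z] unfolding Cz P0 .
    have "((?P * ?C)\<^sup>T *\<^sub>v u) \<bullet> z = u \<bullet> ((?P * ?C) *\<^sub>v z)" by (rule transpose_vec_mult_scalar[OF PC z u])
    then have uz: "u \<bullet> z = 0" using u by (simp only: pi(3) PCu PCz) simp
    have vz: "v = u + z" unfolding z_def using u v by (intro eq_vecI) auto
    have "v \<bullet> v = u \<bullet> u + 2 * (u \<bullet> z) + z \<bullet> z"
      unfolding vz add_scalar_prod_distrib[OF u z add_carrier_vec[OF u z]]
        scalar_prod_add_distrib[OF u u z] scalar_prod_add_distrib[OF z u z] comm_scalar_prod[OF z u]
      by simp
    moreover have "z \<bullet> z \<noteq> 0"
    proof
      assume "z \<bullet> z = 0"
      then have "z = 0\<^sub>v (m * T)" using self_scalar_prod_zero[of z] z by simp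
      then show False using vz v(3) u by simp
    qed
    moreover have "0 \<le> z \<bullet> z" by (auto simp: scalar_prod_def intro: sum_nonneg)
    ultimately show ?thesis using uz by simp
  qed
  show ?thesis
    unfolding is_min_energy_control_def steering_inputs_def d_def[symmetric] u_def[symmetric]
    using u fin Cu opt B by auto
qed

lemma prod_mats_carrier:
  assumes "\<And>F. F \<in> set Fs \<Longrightarrow> F \<in> carrier_mat n n" shows "prod_mats n Fs \<in> carrier_mat n n"
  using assms by (induction Fs) (auto simp: prod_mats_def intro: mult_carrier_mat[of _ n n])

lemma desc_prod_Suc:
  assumes "i \<le> Suc l"
  shows "desc_prod n Q i (Suc l) = Q (Suc l) * desc_prod n Q i l"
  using assms by (simp add: desc_prod_def prod_mats_def)

lemma desc_prod_carrier:
  assumes "\<And>i. i \<in> {1..l} \<Longrightarrow> Q i \<in> carrier_mat n n" "1 \<le> i"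
  shows "desc_prod n Q i l \<in> carrier_mat n n"
  unfolding desc_prod_def by (rule prod_mats_carrier) (use assms in auto)

lemma desc_prod_pow:
  assumes "\<And>i. i \<in> {1..l} \<Longrightarrow> Q i = A ^\<^sub>m t i"
  shows "desc_prod n Q 1 l = A ^\<^sub>m (\<Sum>i = 1..l. t i)"
  using assms
proof (induction l)
  case 0
  then show ?case using A by (simp add: desc_prod_def prod_mats_def)
next
  case (Suc l)
  then show ?case by (simp add: desc_prod_Suc pow_mat_add[OF A, symmetric] add.commute)
qed

text \<open>Raising \<open>l\<close> by one multiplies every old block by \<open>Q (Suc l)\<close>
  from the left and puts \<open>L (Suc l)\<close> in front. With exact data this is
  \<open>ctrb_add\<close> for the horizon of the new segment.\<close>

lemma ctrb_est_exact:
  assumes "\<And>i. i \<in> {1..l} \<Longrightarrow> Q i = A ^\<^sub>m t i" "\<And>i. i \<in> {1..l} \<Longrightarrow> L i = ctrb A B (t i)"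
  shows "ctrb_est n Q L l = ctrb A B (\<Sum>i = 1..l. t i)"
  using assms
proof (induction l)
  case 0
  then show ?case using A by (simp add: ctrb_est_def ctrb_def block_row_def)
next
  case (Suc l)
  let ?G = "\<lambda>i. desc_prod n Q (Suc i) l * L i"
  have Qc: "Q i \<in> carrier_mat n n" if "i \<in> {1..Suc l}" for i
    using Suc.prems(1)[OF that] pow_carrier_mat[OF A] by simp
  have Lc: "L i \<in> carrier_mat n (m * t i)" if "i \<in> {1..Suc l}" for i
    using Suc.prems(2)[OF that] ctrb_carrier by simp
  have Dc: "desc_prod n Q (Suc i) l \<in> carrier_mat n n" for i
    by (rule desc_prod_carrier) (use Qc in auto)
  have Gc: "?G i \<in> carrier_mat n (m * t i)" if "i \<in> {1..l}" for i
    using mult_carrier_mat[OF Dc Lc] that by simp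
  have "map (\<lambda>i. desc_prod n Q (Suc i) (Suc l) * L i) (rev [1..<Suc l]) = map ((*) (Q (Suc l))) (map ?G (rev [1..<Suc l]))"
  proof -
    have "desc_prod n Q (Suc i) (Suc l) * L i = Q (Suc l) * ?G i" if "i \<in> {1..l}" for i
      using assoc_mult_mat[OF Qc Dc Lc, of "Suc l" i i] that by (simp add: desc_prod_Suc)
    then show ?thesis unfolding map_map comp_def by (intro map_cong refl) auto
  qed
  \<comment> \<open>The leading block carries the empty product.\<close>
  moreover have "desc_prod n Q (Suc (Suc l)) (Suc l) * L (Suc l) = L (Suc l)"
    using Lc[of "Suc l"] by (simp add: desc_prod_def prod_mats_def)
  ultimately have "ctrb_est n Q L (Suc l) = L (Suc l) @\<^sub>c block_row n (map ((*) (Q (Suc l))) (map ?G (rev [1..<Suc l])))"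
    by (simp add: ctrb_est_def block_row_def del: map_map)
  also have "block_row n (map ((*) (Q (Suc l))) (map ?G (rev [1..<Suc l]))) = Q (Suc l) * ctrb_est n Q L l"
    unfolding ctrb_est_def
  proof (rule mult_block_row[symmetric])
    show "Q (Suc l) \<in> carrier_mat n n" by (rule Qc) simp
    show "F \<in> carrier_mat n (dim_col F)" if "F \<in> set (map ?G (rev [1..<Suc l]))" for F
    proof -
      have "F \<in> ?G ` {1..l}" using that by (auto simp: atLeastLessThanSuc_atLeastAtMost simp del: upt_Suc)
      then obtain i where "F = ?G i" "i \<in> {1..l}" by (rule imageE)
      with Gc[of i] carrier_matD(2)[OF Gc[of i]] show ?thesis by simp
    qed
  qed
  also have "ctrb_est n Q L l = ctrb A B (\<Sum>i = 1..l. t i)" using Suc by simp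
  finally show ?case using Suc.prems ctrb_add by (simp add: add.commute)
qed

end

section \<open>Consistency of noise-corrected regression\<close>

text \<open>A deterministic errors-in-variables regression: \<open>zb\<close> are the true regressors, \<open>w\<close> the
  errors in the regressors and \<open>e\<close> the error in the response. The numbers \<open>V a N\<close> and \<open>Ve N\<close>
  bound the squared length of the projection of an error sequence to the row space of the regressors.\<close>

locale noisy_regression =
  fixes p n0 :: nat and c :: real
    and zb w :: "nat \<Rightarrow> nat \<Rightarrow> real" and e f s :: "nat \<Rightarrow> real"
    and V :: "nat \<Rightarrow> nat \<Rightarrow> real" and Ve :: "nat \<Rightarrow> real"
  assumes c: "0 < c" and n0: "0 < n0"
    and excitation: "\<And>N h. n0 \<le> N \<Longrightarrow> c * N * (\<Sum>a<p. (h a)\<^sup>2) \<le> (\<Sum>j<N. (\<Sum>a<p. h a * zb a j)\<^sup>2)"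
    and ww: "\<And>a b. a < p \<Longrightarrow> b < p \<Longrightarrow>
      (\<lambda>N. (\<Sum>j<N. w a j * w b j) / N) \<longlonglongrightarrow> (if a = b then s a else 0)"
    and ew: "\<And>b. b < p \<Longrightarrow> (\<lambda>N. (\<Sum>j<N. e j * w b j) / N) \<longlonglongrightarrow> 0"
    and V0: "\<And>a N. 0 \<le> V a N" and Ve0: "\<And>N. 0 \<le> Ve N"
    and Vlim: "\<And>a. a < p \<Longrightarrow> (\<lambda>N. V a N / N) \<longlonglongrightarrow> 0"
    and Velim: "(\<lambda>N. Ve N / N) \<longlonglongrightarrow> 0"
    and V: "\<And>a N h. a < p \<Longrightarrow> n0 \<le> N \<Longrightarrow>
      (\<Sum>b<p. h b * (\<Sum>j<N. zb b j * w a j))\<^sup>2 \<le> (\<Sum>j<N. (\<Sum>b<p. h b * zb b j)\<^sup>2) * V a N"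
    and Ve: "\<And>N h. n0 \<le> N \<Longrightarrow>
      (\<Sum>b<p. h b * (\<Sum>j<N. zb b j * e j))\<^sup>2 \<le> (\<Sum>j<N. (\<Sum>b<p. h b * zb b j)\<^sup>2) * Ve N"
begin

definition z :: "nat \<Rightarrow> nat \<Rightarrow> real" where "z a j = zb a j + w a j"

text \<open>The quadratic form of the true Gram matrix. It is the yardstick for all errors, since
  \<open>N\<close> alone may be far smaller than the true data.\<close>

definition q :: "nat \<Rightarrow> (nat \<Rightarrow> real) \<Rightarrow> real" where
  "q N h = (\<Sum>j<N. (\<Sum>a<p. h a * zb a j)\<^sup>2)"

definition S :: "nat \<Rightarrow> nat \<Rightarrow> nat \<Rightarrow> real" where
  "S N a b = (\<Sum>j<N. z a j * z b j) - (if a = b then N * s a else 0)"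

definition D :: "nat \<Rightarrow> nat \<Rightarrow> nat \<Rightarrow> real" where
  "D N a b = (\<Sum>j<N. w a j * w b j) - (if a = b then N * s a else 0)"

definition X :: "nat \<Rightarrow> nat \<Rightarrow> nat \<Rightarrow> real" where
  "X N b a = (\<Sum>j<N. zb b j * w a j)"

lemma q_nonneg: "0 \<le> q N h"
  by (simp add: q_def sum_nonneg)

lemma D_lim: assumes "a < p" "b < p" shows "(\<lambda>N. D N a b / N) \<longlonglongrightarrow> 0"
proof -
  have "(\<lambda>N. (\<Sum>j<N. w a j * w b j) / N - (if a = b then s a else 0)) \<longlonglongrightarrow>
      (if a = b then s a else 0) - (if a = b then s a else 0)"
    by (intro tendsto_intros ww assms)
  then have "(\<lambda>N. (\<Sum>j<N. w a j * w b j) / N - (if a = b then s a else 0)) \<longlonglongrightarrow> 0" by simp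
  moreover have "\<forall>\<^sub>F N in sequentially. (\<Sum>j<N. w a j * w b j) / N - (if a = b then s a else 0) = D N a b / N"
    by (rule eventually_sequentiallyI[of 1]) (simp add: D_def diff_divide_distrib)
  ultimately show ?thesis by (rule Lim_transform_eventually)
qed

lemma coordinate_bound:
  assumes "n0 \<le> N" "a < p" shows "\<bar>h a\<bar> \<le> sqrt (q N h / (c * N))"
proof (rule real_le_rsqrt)
  have N: "0 < c * N" using assms n0 c by simp
  have "(h a)\<^sup>2 \<le> (\<Sum>a<p. (h a)\<^sup>2)" using assms(2) by (intro member_le_sum) auto
  then have "c * N * (h a)\<^sup>2 \<le> q N h"
    using excitation[OF assms(1), of h] N unfolding q_def by (meson less_imp_le mult_left_mono order_trans)
  then show "\<bar>h a\<bar>\<^sup>2 \<le> q N h / (c * N)" using N by (simp add: field_simps)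
qed

lemma cross_bound:
  assumes "n0 \<le> N" "a < p" shows "\<bar>\<Sum>b<p. h b * X N b a\<bar> \<le> sqrt (q N h) * sqrt (V a N)"
  using V[OF assms(2,1), of h] unfolding q_def X_def
  by (simp add: real_sqrt_mult[symmetric] real_le_rsqrt)

lemma S_split: "S N a b = (\<Sum>j<N. zb a j * zb b j) + X N a b + X N b a + D N a b"
  unfolding S_def D_def X_def z_def by (simp add: sum.distrib algebra_simps)

text \<open>The right factor keeps its noise, so that this product cancels against the one on the
  right-hand side of the normal equations.\<close>

lemma S_split_half: "S N a b = (\<Sum>j<N. zb a j * z b j) + X N b a + D N a b"
  unfolding S_def D_def X_def z_def by (simp add: sum.distrib algebra_simps)

lemma quadratic_form_split:
  "(\<Sum>a<p. \<Sum>b<p. h a * S N a b * h b) = q N h + 2 * (\<Sum>b<p. h b * (\<Sum>a<p. h a * X N a b))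
     + (\<Sum>a<p. \<Sum>b<p. h a * h b * D N a b)"
proof -
  have "q N h = (\<Sum>j<N. \<Sum>a<p. \<Sum>b<p. h a * h b * (zb a j * zb b j))"
    unfolding q_def by (simp add: power2_eq_square sum_product mult_ac)
  also have "\<dots> = (\<Sum>a<p. \<Sum>j<N. \<Sum>b<p. h a * h b * (zb a j * zb b j))" by (rule sum.swap)
  also have "\<dots> = (\<Sum>a<p. \<Sum>b<p. \<Sum>j<N. h a * h b * (zb a j * zb b j))"
    by (intro sum.cong refl sum.swap)
  finally have q: "q N h = (\<Sum>a<p. \<Sum>b<p. h a * h b * (\<Sum>j<N. zb a j * zb b j))"
    by (simp add: sum_distrib_left)
  have x1: "(\<Sum>b<p. h b * (\<Sum>a<p. h a * X N a b)) = (\<Sum>a<p. \<Sum>b<p. h a * h b * X N b a)"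
    by (simp add: sum_distrib_left mult_ac)
  have x2: "(\<Sum>a<p. \<Sum>b<p. h a * h b * X N b a) = (\<Sum>a<p. \<Sum>b<p. h a * h b * X N a b)"
    by (subst sum.swap) (simp add: mult_ac)
  have "(\<Sum>a<p. \<Sum>b<p. h a * S N a b * h b) = (\<Sum>a<p. \<Sum>b<p. h a * h b * (\<Sum>j<N. zb a j * zb b j))
      + (\<Sum>a<p. \<Sum>b<p. h a * h b * X N a b) + (\<Sum>a<p. \<Sum>b<p. h a * h b * X N b a)
      + (\<Sum>a<p. \<Sum>b<p. h a * h b * D N a b)"
  proof -
    have "h a * S N a b * h b = h a * h b * (\<Sum>j<N. zb a j * zb b j) + h a * h b * X N a b
        + h a * h b * X N b a + h a * h b * D N a b" for a b
      unfolding S_split by (simp only: distrib_left distrib_right mult_ac)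
    then show ?thesis by (simp only: sum.distrib)
  qed
  then show ?thesis unfolding q x1 using x2 by simp
qed

lemma noise_form_bound:
  assumes N: "n0 \<le> N"
  shows "\<bar>\<Sum>a<p. \<Sum>b<p. h a * h b * D N a b\<bar> \<le> q N h / c * (\<Sum>a<p. \<Sum>b<p. \<bar>D N a b / N\<bar>)"
proof -
  have N0: "0 < real N" using N n0 by simp
  have "\<bar>\<Sum>a<p. \<Sum>b<p. h a * h b * D N a b\<bar> \<le> (\<Sum>a<p. \<Sum>b<p. \<bar>h a * h b * D N a b\<bar>)"
    by (intro order_trans[OF sum_abs] sum_mono sum_abs)
  also have "\<dots> \<le> (\<Sum>a<p. \<Sum>b<p. q N h / (c * N) * \<bar>D N a b\<bar>)"
  proof (intro sum_mono)
    fix a b assume "a \<in> {..<p}" "b \<in> {..<p}"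
    then have "\<bar>h a\<bar> * \<bar>h b\<bar> \<le> sqrt (q N h / (c * N)) * sqrt (q N h / (c * N))"
      by (intro mult_mono coordinate_bound N) (auto simp: q_nonneg c less_imp_le)
    also have "\<dots> = q N h / (c * N)" using c by (simp add: q_nonneg less_imp_le)
    finally have "\<bar>h a\<bar> * \<bar>h b\<bar> \<le> q N h / (c * N)" .
    from mult_right_mono[OF this abs_ge_zero]
    show "\<bar>h a * h b * D N a b\<bar> \<le> q N h / (c * N) * \<bar>D N a b\<bar>" by (simp only: abs_mult)
  qed
  also have "\<dots> = q N h / c * (\<Sum>a<p. \<Sum>b<p. \<bar>D N a b / N\<bar>)"
    using N0 by (simp add: sum_distrib_left field_simps)
  finally show ?thesis .
qed

text \<open>One factor \<open>sqrt (q N h)\<close> comes from the coordinate bound and one from the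
  projection bound. As for the pure noise terms, the result is linear in \<open>q N h\<close> with a
  coefficient that tends to 0 and does not depend on \<open>h\<close>.\<close>

lemma cross_form_bound:
  assumes N: "n0 \<le> N"
  shows "\<bar>\<Sum>b<p. h b * (\<Sum>a<p. h a * X N a b)\<bar> \<le> q N h / sqrt c * (\<Sum>b<p. sqrt (V b N / N))"
proof -
  have N0: "0 < real N" using N n0 by simp
  have "\<bar>\<Sum>b<p. h b * (\<Sum>a<p. h a * X N a b)\<bar> \<le> (\<Sum>b<p. \<bar>h b\<bar> * \<bar>\<Sum>a<p. h a * X N a b\<bar>)"
    by (intro order_trans[OF sum_abs]) (simp add: abs_mult)
  also have "\<dots> \<le> (\<Sum>b<p. sqrt (q N h / (c * N)) * (sqrt (q N h) * sqrt (V b N)))"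
    by (intro sum_mono mult_mono coordinate_bound cross_bound N) (auto simp: q_nonneg c less_imp_le)
  also have "\<dots> = q N h / sqrt c * (\<Sum>b<p. sqrt (V b N / N))"
    unfolding sum_distrib_left
    using N0 c q_nonneg[of N h] by (intro sum.cong refl) (simp add: real_sqrt_divide real_sqrt_mult)
  finally show ?thesis .
qed

lemma V_sqrt_lim: "(\<lambda>N. \<Sum>b<p. sqrt (V b N / N)) \<longlonglongrightarrow> 0"
proof -
  have "(\<lambda>N. \<Sum>b<p. sqrt (V b N / N)) \<longlonglongrightarrow> (\<Sum>b<p. sqrt 0)"
    by (intro tendsto_intros Vlim) auto
  then show ?thesis by simp
qed

lemma D_abs_lim: "(\<lambda>N. \<Sum>a<p. \<Sum>b<p. g a * \<bar>D N a b / N\<bar>) \<longlonglongrightarrow> 0"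
proof -
  have "(\<lambda>N. \<Sum>a<p. \<Sum>b<p. g a * \<bar>D N a b / N\<bar>) \<longlonglongrightarrow> (\<Sum>a<p. \<Sum>b<p. g a * \<bar>0\<bar>)"
    by (intro tendsto_intros D_lim) auto
  then show ?thesis by simp
qed

text \<open>The cross terms and the noise terms together are at most \<open>q N h\<close> times a
  coefficient that is eventually below 1/2. The coefficient is free of \<open>h\<close>, which
  permits the quantifier over \<open>h\<close> inside the eventuality.\<close>

lemma corrected_gram_coercive:
  "\<forall>\<^sub>F N in sequentially. \<forall>h. q N h / 2 \<le> (\<Sum>a<p. \<Sum>b<p. h a * S N a b * h b)"
proof -
  have "(\<lambda>N. 2 / sqrt c * (\<Sum>b<p. sqrt (V b N / N)) + 1 / c * (\<Sum>a<p. \<Sum>b<p. 1 * \<bar>D N a b / N\<bar>))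
      \<longlonglongrightarrow> 2 / sqrt c * 0 + 1 / c * 0"
    by (intro tendsto_intros V_sqrt_lim D_abs_lim)
  then have "\<forall>\<^sub>F N in sequentially.
      2 / sqrt c * (\<Sum>b<p. sqrt (V b N / N)) + 1 / c * (\<Sum>a<p. \<Sum>b<p. \<bar>D N a b / N\<bar>) < 1 / 2"
    by (intro order_tendstoD) auto
  moreover have "\<forall>\<^sub>F N in sequentially. n0 \<le> N" by (rule eventually_ge_at_top)
  ultimately show ?thesis
  proof eventually_elim
    case (elim N)
    show ?case
    proof
      fix h
      have "q N h * (2 / sqrt c * (\<Sum>b<p. sqrt (V b N / N)) + 1 / c * (\<Sum>a<p. \<Sum>b<p. \<bar>D N a b / N\<bar>))
          \<le> q N h * (1 / 2)"
        using elim(1) q_nonneg by (intro mult_left_mono) auto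
      moreover have "q N h * (2 / sqrt c * (\<Sum>b<p. sqrt (V b N / N)) + 1 / c * (\<Sum>a<p. \<Sum>b<p. \<bar>D N a b / N\<bar>))
          = 2 * (q N h / sqrt c * (\<Sum>b<p. sqrt (V b N / N))) + q N h / c * (\<Sum>a<p. \<Sum>b<p. \<bar>D N a b / N\<bar>)"
        by (simp add: distrib_left)
      ultimately show "q N h / 2 \<le> (\<Sum>a<p. \<Sum>b<p. h a * S N a b * h b)"
        using cross_form_bound[OF elim(2), of h] noise_form_bound[OF elim(2), of h]
        unfolding quadratic_form_split by linarith
    qed
  qed
qed

text \<open>The products of the true response \<open>f\<close> with the noisy regressors cancel.
  What remains are true data against noise, to be compared with \<open>q\<close>, and noise against
  noise, to be compared with \<open>N\<close>.\<close>

lemma normal_equation_error: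
  assumes "\<And>b. b < p \<Longrightarrow> (\<Sum>a<p. H a * S N a b) = (\<Sum>j<N. ((\<Sum>a<p. f a * zb a j) + e j) * z b j)"
    and b: "b < p"
  shows "(\<Sum>a<p. (H a - f a) * S N a b)
    = (\<Sum>j<N. zb b j * e j) - (\<Sum>a<p. f a * X N b a) + (\<Sum>j<N. e j * w b j) - (\<Sum>a<p. f a * D N a b)"
proof -
  have "(\<Sum>a<p. f a * S N a b) = (\<Sum>a<p. f a * (\<Sum>j<N. zb a j * z b j)) + (\<Sum>a<p. f a * X N b a) + (\<Sum>a<p. f a * D N a b)"
    unfolding S_split_half by (simp only: distrib_left sum.distrib)
  also have "(\<Sum>a<p. f a * (\<Sum>j<N. zb a j * z b j)) = (\<Sum>j<N. (\<Sum>a<p. f a * zb a j) * z b j)"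
    unfolding sum_distrib_left sum_distrib_right by (subst sum.swap) (simp add: mult.assoc)
  finally have F: "(\<Sum>a<p. f a * S N a b) = (\<Sum>j<N. (\<Sum>a<p. f a * zb a j) * z b j)
      + (\<Sum>a<p. f a * X N b a) + (\<Sum>a<p. f a * D N a b)" .
  have "(\<Sum>a<p. (H a - f a) * S N a b) = (\<Sum>a<p. H a * S N a b) - (\<Sum>a<p. f a * S N a b)"
    by (simp add: left_diff_distrib sum_subtractf)
  also have "(\<Sum>a<p. H a * S N a b) = (\<Sum>j<N. (\<Sum>a<p. f a * zb a j) * z b j) + (\<Sum>j<N. zb b j * e j) + (\<Sum>j<N. e j * w b j)"
  proof -
    have "(g + e j) * z b j = g * z b j + zb b j * e j + e j * w b j" for g j
      by (simp add: z_def algebra_simps)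
    then show ?thesis unfolding assms(1)[OF b] by (simp only: sum.distrib)
  qed
  finally show ?thesis unfolding F by simp
qed

text \<open>Testing the error equation with \<open>h = H N - f\<close> gives
  \<open>q N h / 2 \<le> sqrt (q N h * N) * \<eta> N\<close>, hence
  \<open>sqrt (q N h) \<le> 2 * sqrt N * \<eta> N\<close>. The coordinate bound divides by
  \<open>sqrt (c * N)\<close>, and \<open>N\<close> drops out.\<close>

lemma estimator_consistent:
  assumes H: "\<forall>\<^sub>F N in sequentially. \<forall>b<p.
      (\<Sum>a<p. H N a * S N a b) = (\<Sum>j<N. ((\<Sum>a<p. f a * zb a j) + e j) * z b j)"
    and i: "i < p"
  shows "(\<lambda>N. H N i) \<longlonglongrightarrow> f i"
proof -
  \<comment> \<open>The four error terms of \<open>normal_equation_error\<close> after division by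
    \<open>sqrt (q N h * N)\<close>. The factor \<open>1 / sqrt c\<close> appears where the
    coordinate bound is used instead of a projection bound.\<close>
  define \<eta> where "\<eta> N = sqrt (Ve N / N) + (\<Sum>a<p. \<bar>f a\<bar> * sqrt (V a N / N))
      + 1 / sqrt c * ((\<Sum>b<p. \<bar>(\<Sum>j<N. e j * w b j) / N\<bar>) + (\<Sum>a<p. \<Sum>b<p. \<bar>f a\<bar> * \<bar>D N a b / N\<bar>))" for N
  have "\<eta> \<longlonglongrightarrow> sqrt 0 + (\<Sum>a<p. \<bar>f a\<bar> * sqrt 0) + 1 / sqrt c * ((\<Sum>b<p. \<bar>0\<bar>) + 0)"
    unfolding \<eta>_def by (intro tendsto_intros Velim Vlim ew D_abs_lim) auto
  then have \<eta>: "\<eta> \<longlonglongrightarrow> 0" by simp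
  have "\<forall>\<^sub>F N in sequentially. \<bar>H N i - f i\<bar> \<le> 2 / sqrt c * \<eta> N"
    using H corrected_gram_coercive eventually_ge_at_top[of n0]
  proof eventually_elim
    case (elim N)
    define h where "h a = H N a - f a" for a
    have N0: "0 < real N" using elim(3) n0 by simp
    let ?r = "sqrt (q N h / (c * N))"
    have rN: "?r = sqrt (q N h * N) * (1 / sqrt c) / N"
      using N0 c by (simp add: real_sqrt_divide real_sqrt_mult field_simps)
    have t1: "\<bar>\<Sum>b<p. h b * (\<Sum>j<N. zb b j * e j)\<bar> \<le> sqrt (q N h * N) * sqrt (Ve N / N)"
    proof -
      have "\<bar>\<Sum>b<p. h b * (\<Sum>j<N. zb b j * e j)\<bar> \<le> sqrt (q N h * Ve N)"
        using Ve[OF elim(3), of h] by (intro real_le_rsqrt) (simp add: q_def)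
      also have "q N h * Ve N = (q N h * N) * (Ve N / N)" using N0 by simp
      finally show ?thesis by (simp only: real_sqrt_mult)
    qed
    have t2: "\<bar>\<Sum>b<p. h b * (\<Sum>a<p. f a * X N b a)\<bar> \<le> sqrt (q N h * N) * (\<Sum>a<p. \<bar>f a\<bar> * sqrt (V a N / N))"
    proof -
      have "(\<Sum>b<p. h b * (\<Sum>a<p. f a * X N b a)) = (\<Sum>a<p. f a * (\<Sum>b<p. h b * X N b a))"
        unfolding sum_distrib_left by (subst sum.swap) (simp add: mult_ac)
      also have "\<bar>\<dots>\<bar> \<le> (\<Sum>a<p. \<bar>f a\<bar> * \<bar>\<Sum>b<p. h b * X N b a\<bar>)"
        by (intro order_trans[OF sum_abs]) (simp add: abs_mult)
      also have "\<dots> \<le> (\<Sum>a<p. \<bar>f a\<bar> * (sqrt (q N h) * sqrt (V a N)))"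
        by (intro sum_mono mult_left_mono cross_bound elim(3)) auto
      also have "\<dots> = sqrt (q N h * N) * (\<Sum>a<p. \<bar>f a\<bar> * sqrt (V a N / N))"
        unfolding sum_distrib_left using N0 by (intro sum.cong refl) (simp add: real_sqrt_divide real_sqrt_mult)
      finally show ?thesis .
    qed
    have t3: "\<bar>\<Sum>b<p. h b * (\<Sum>j<N. e j * w b j)\<bar>
        \<le> sqrt (q N h * N) * (1 / sqrt c * (\<Sum>b<p. \<bar>(\<Sum>j<N. e j * w b j) / N\<bar>))"
    proof -
      have "\<bar>\<Sum>b<p. h b * (\<Sum>j<N. e j * w b j)\<bar> \<le> (\<Sum>b<p. \<bar>h b\<bar> * \<bar>\<Sum>j<N. e j * w b j\<bar>)"
        by (intro order_trans[OF sum_abs]) (simp add: abs_mult)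
      also have "\<dots> \<le> (\<Sum>b<p. ?r * \<bar>\<Sum>j<N. e j * w b j\<bar>)"
        by (intro sum_mono mult_right_mono coordinate_bound elim(3)) auto
      also have "\<dots> = sqrt (q N h * N) * (1 / sqrt c * (\<Sum>b<p. \<bar>(\<Sum>j<N. e j * w b j) / N\<bar>))"
        unfolding rN sum_distrib_left using N0 by (intro sum.cong refl) simp
      finally show ?thesis .
    qed
    have t4: "\<bar>\<Sum>b<p. h b * (\<Sum>a<p. f a * D N a b)\<bar>
        \<le> sqrt (q N h * N) * (1 / sqrt c * (\<Sum>a<p. \<Sum>b<p. \<bar>f a\<bar> * \<bar>D N a b / N\<bar>))"
    proof -
      have "(\<Sum>b<p. h b * (\<Sum>a<p. f a * D N a b)) = (\<Sum>a<p. \<Sum>b<p. h b * (f a * D N a b))"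
        unfolding sum_distrib_left by (rule sum.swap)
      also have "\<bar>\<dots>\<bar> \<le> (\<Sum>a<p. \<Sum>b<p. \<bar>h b * (f a * D N a b)\<bar>)"
        by (intro order_trans[OF sum_abs] sum_mono sum_abs)
      also have "\<dots> \<le> (\<Sum>a<p. \<Sum>b<p. ?r * (\<bar>f a\<bar> * \<bar>D N a b\<bar>))"
        unfolding abs_mult by (intro sum_mono mult_right_mono coordinate_bound elim(3)) auto
      also have "\<dots> = sqrt (q N h * N) * (1 / sqrt c * (\<Sum>a<p. \<Sum>b<p. \<bar>f a\<bar> * \<bar>D N a b / N\<bar>))"
        unfolding rN sum_distrib_left using N0 by (intro sum.cong refl) simp
      finally show ?thesis .
    qed
    have "(\<Sum>a<p. \<Sum>b<p. h a * S N a b * h b) = (\<Sum>b<p. h b * (\<Sum>a<p. h a * S N a b))"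
      unfolding sum_distrib_left by (subst sum.swap) (simp add: mult_ac)
    also have "\<dots> = (\<Sum>b<p. h b * ((\<Sum>j<N. zb b j * e j) - (\<Sum>a<p. f a * X N b a) + (\<Sum>j<N. e j * w b j) - (\<Sum>a<p. f a * D N a b)))"
    proof (intro sum.cong refl)
      fix b assume "b \<in> {..<p}"
      then have "b < p" by simp
      from normal_equation_error[OF elim(1)[rule_format] this]
      show "h b * (\<Sum>a<p. h a * S N a b) = h b * ((\<Sum>j<N. zb b j * e j) - (\<Sum>a<p. f a * X N b a)
          + (\<Sum>j<N. e j * w b j) - (\<Sum>a<p. f a * D N a b))"
        unfolding h_def by simp
    qed
    also have "\<dots> = (\<Sum>b<p. h b * (\<Sum>j<N. zb b j * e j)) - (\<Sum>b<p. h b * (\<Sum>a<p. f a * X N b a))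
        + (\<Sum>b<p. h b * (\<Sum>j<N. e j * w b j)) - (\<Sum>b<p. h b * (\<Sum>a<p. f a * D N a b))"
      by (simp only: right_diff_distrib distrib_left sum.distrib sum_subtractf)
    also have "\<dots> \<le> sqrt (q N h * N) * \<eta> N"
      unfolding \<eta>_def distrib_left using t1 t2 t3 t4 unfolding distrib_left by linarith
    finally have le: "q N h / 2 \<le> sqrt (q N h * N) * \<eta> N" using elim(2) by (meson order_trans)
    have sq: "sqrt (q N h) \<le> 2 * sqrt N * \<eta> N"
    proof (cases "q N h = 0")
      case True
      have "0 \<le> \<eta> N" unfolding \<eta>_def using V0 Ve0 c by (intro add_nonneg_nonneg mult_nonneg_nonneg sum_nonneg) auto
      then show ?thesis using True by simp
    next
      case False
      then have "0 < sqrt (q N h)" using q_nonneg[of N h] by simp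
      moreover have "sqrt (q N h) * sqrt (q N h) \<le> sqrt (q N h) * (2 * sqrt N * \<eta> N)"
        using le q_nonneg[of N h] by (simp add: real_sqrt_mult)
      ultimately show ?thesis by (simp only: mult_le_cancel_left_pos)
    qed
    have "\<bar>h i\<bar> \<le> ?r" by (rule coordinate_bound[OF elim(3) i])
    also have "?r = sqrt (q N h) / (sqrt c * sqrt N)" by (simp add: real_sqrt_divide real_sqrt_mult)
    also have "\<dots> \<le> 2 * sqrt N * \<eta> N / (sqrt c * sqrt N)" using sq c by (intro divide_right_mono) auto
    also have "\<dots> = 2 / sqrt c * \<eta> N" using N0 by simp
    finally show ?case by (simp add: h_def)
  qed
  moreover have "(\<lambda>N. 2 / sqrt c * \<eta> N) \<longlonglongrightarrow> 0" by (rule tendsto_mult_right_zero[OF \<eta>])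
  ultimately have "(\<lambda>N. \<bar>H N i - f i\<bar>) \<longlonglongrightarrow> 0"
    by (rule tendsto_sandwich[OF always_eventually[OF allI[OF abs_ge_zero]] _ tendsto_const])
  then show ?thesis by (rule LIM_zero_cancel[OF tendsto_rabs_zero_cancel])
qed

end

section \<open>Almost sure behaviour of the noise\<close>

text \<open>A kernel vector of the Gram matrix makes the sum of squares vanish, so definiteness
  gives invertibility. The inverse is delivered as a function of indices to suit sums of random
  variables.\<close>

lemma gram_inverse:
  fixes z :: "nat \<Rightarrow> nat \<Rightarrow> real"
  assumes pd: "\<And>h. (\<Sum>j<N. (\<Sum>a<p. h a * z a j)\<^sup>2) = 0 \<Longrightarrow> \<forall>a<p. h a = 0"
  obtains K :: "nat \<Rightarrow> nat \<Rightarrow> real" where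
    "\<And>a c. a < p \<Longrightarrow> c < p \<Longrightarrow> (\<Sum>b<p. K a b * (\<Sum>j<N. z b j * z c j)) = (if a = c then 1 else 0)"
    "\<And>a c. a < p \<Longrightarrow> c < p \<Longrightarrow> (\<Sum>b<p. (\<Sum>j<N. z a j * z b j) * K b c) = (if a = c then 1 else 0)"
proof -
  define G where "G = mat p p (\<lambda>(a, b). \<Sum>j<N. z a j * z b j)"
  have G: "G \<in> carrier_mat p p" by (simp add: G_def)
  have "det G \<noteq> 0"
  proof
    assume "det G = 0"
    then obtain v where v: "v \<in> carrier_vec p" "v \<noteq> 0\<^sub>v p" "G *\<^sub>v v = 0\<^sub>v p"
      using det_0_iff_vec_prod_zero_field[OF G] by blast
    have Gv: "(\<Sum>b<p. (\<Sum>j<N. z a j * z b j) * v $ b) = 0" if "a < p" for a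
    proof -
      have "(G *\<^sub>v v) $ a = (\<Sum>b<p. (\<Sum>j<N. z a j * z b j) * v $ b)"
        using that v(1) by (simp add: G_def scalar_prod_def lessThan_atLeast0)
      then show ?thesis using v(3) that by simp
    qed
    have "(\<Sum>j<N. (\<Sum>a<p. v $ a * z a j)\<^sup>2) = (\<Sum>j<N. \<Sum>a<p. \<Sum>b<p. v $ a * (z a j * z b j * v $ b))"
      by (simp add: power2_eq_square sum_product mult_ac)
    also have "\<dots> = (\<Sum>a<p. \<Sum>j<N. \<Sum>b<p. v $ a * (z a j * z b j * v $ b))" by (rule sum.swap)
    also have "\<dots> = (\<Sum>a<p. \<Sum>b<p. \<Sum>j<N. v $ a * (z a j * z b j * v $ b))"
      by (intro sum.cong refl sum.swap)
    also have "\<dots> = (\<Sum>a<p. v $ a * (\<Sum>b<p. (\<Sum>j<N. z a j * z b j) * v $ b))"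
      by (simp add: sum_distrib_left sum_distrib_right)
    also have "\<dots> = 0" using Gv by simp
    finally have "\<forall>a<p. v $ a = 0" by (rule pd)
    then have "v = 0\<^sub>v p" using v(1) by (intro eq_vecI) auto
    with v(2) show False by simp
  qed
  note inv = pinv_nonsingular[OF G this]
  define K where "K a b = pinv G $$ (a, b)" for a b
  have pc: "pinv G \<in> carrier_mat p p" using G by simp
  show thesis
  proof (rule that[of K])
    fix a c assume ac: "a < p" "c < p"
    have "(pinv G * G) $$ (a, c) = (\<Sum>b<p. K a b * (\<Sum>j<N. z b j * z c j))"
      using ac carrier_matD[OF pc] by (simp add: G_def K_def scalar_prod_def lessThan_atLeast0)
    then show "(\<Sum>b<p. K a b * (\<Sum>j<N. z b j * z c j)) = (if a = c then 1 else 0)"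
      unfolding inv(2) using ac by simp
    have "(G * pinv G) $$ (a, c) = (\<Sum>b<p. (\<Sum>j<N. z a j * z b j) * K b c)"
      using ac carrier_matD[OF pc] by (simp add: G_def K_def scalar_prod_def lessThan_atLeast0)
    then show "(\<Sum>b<p. (\<Sum>j<N. z a j * z b j) * K b c) = (if a = c then 1 else 0)"
      unfolding inv(1) using ac by simp
  qed
qed

text \<open>One family for the rows of all noise matrices of an experiment: entries are independent
  throughout, but variance and distribution are shared only within a row.\<close>

locale noise_family = prob_space +
  fixes W :: "'i \<Rightarrow> nat \<Rightarrow> 'a \<Rightarrow> real" and I :: "'i set" and v :: "'i \<Rightarrow> real"
  assumes indep: "indep_vars (\<lambda>_. borel) (\<lambda>(i, j). W i j) (I \<times> UNIV)"
    and int: "\<And>i j. i \<in> I \<Longrightarrow> integrable M (W i j)"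
    and mean: "\<And>i j. i \<in> I \<Longrightarrow> expectation (W i j) = 0"
    and int2: "\<And>i j. i \<in> I \<Longrightarrow> integrable M (\<lambda>x. (W i j x)\<^sup>2)"
    and var: "\<And>i j. i \<in> I \<Longrightarrow> expectation (\<lambda>x. (W i j x)\<^sup>2) = v i"
    and ident: "\<And>i j. i \<in> I \<Longrightarrow> distr M borel (W i j) = distr M borel (W i 0)"
begin

lemma measurable_W: "i \<in> I \<Longrightarrow> W i j \<in> borel_measurable M"
  using int by blast

lemma indep_pair:
  assumes "i \<in> I" "i' \<in> I" "(i, j) \<noteq> (i', j')"
  shows "indep_var borel (W i j) borel (W i' j')"
proof -
  have "indep_vars (\<lambda>_. borel) (\<lambda>(i, j). W i j) (insert (i, j) {(i', j')})"
    by (rule indep_vars_subset[OF indep]) (use assms in auto)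
  from indep_vars_prod[OF _ _ this] show ?thesis using assms(3) by simp
qed

lemma second_moments:
  assumes "i \<in> I"
  shows "integrable M (\<lambda>x. W i j x * W i j' x)"
    and "expectation (\<lambda>x. W i j x * W i j' x) = (if j = j' then v i else 0)"
proof -
  have "integrable M (\<lambda>x. W i j x * W i j' x) \<and> expectation (\<lambda>x. W i j x * W i j' x) = (if j = j' then v i else 0)"
  proof (cases "j = j'")
    case True
    then show ?thesis using int2[OF assms, of j'] var[OF assms, of j'] by (simp add: power2_eq_square)
  next
    case False
    then have ind: "indep_var borel (W i j) borel (W i j')" by (intro indep_pair assms) auto
    show ?thesis
      using indep_var_integrable[OF ind int[OF assms] int[OF assms]]
        indep_var_lebesgue_integral[OF ind int[OF assms] int[OF assms]] False mean[OF assms] by simp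
  qed
  then show "integrable M (\<lambda>x. W i j x * W i j' x)"
    "expectation (\<lambda>x. W i j x * W i j' x) = (if j = j' then v i else 0)" by auto
qed

lemma AE_average_squares:
  assumes i: "i \<in> I"
  shows "AE x in M. (\<lambda>N. (\<Sum>j<N. (W i j x)\<^sup>2) / N) \<longlonglongrightarrow> v i"
proof -
  note [measurable] = measurable_W[OF i]
  have "AE x in M. (\<lambda>N. (\<Sum>j<N. (W i j x)\<^sup>2) / N) \<longlonglongrightarrow> expectation (\<lambda>x. (W i 0 x)\<^sup>2)"
  proof (rule strong_law_of_large_numbers)
    fix j
    have "distr M borel (\<lambda>x. (W i j x)\<^sup>2) = distr (distr M borel (W i j)) borel (\<lambda>y. y\<^sup>2)"
      by (subst distr_distr) (auto simp: comp_def)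
    also have "distr M borel (W i j) = distr M borel (W i 0)" by (rule ident[OF i])
    also have "distr (distr M borel (W i 0)) borel (\<lambda>y. y\<^sup>2) = distr M borel (\<lambda>x. (W i 0 x)\<^sup>2)"
      by (subst distr_distr) (auto simp: comp_def)
    finally show "distr M borel (\<lambda>x. (W i j x)\<^sup>2) = distr M borel (\<lambda>x. (W i 0 x)\<^sup>2)" .
  next
    fix j k :: nat assume "j \<noteq> k"
    then have "indep_var borel (W i j) borel (W i k)" by (intro indep_pair i) auto
    then have "indep_var borel ((\<lambda>y. y\<^sup>2) \<circ> W i j) borel ((\<lambda>y. y\<^sup>2) \<circ> W i k)"
      by (rule indep_var_compose) auto
    then show "indep_var borel (\<lambda>x. (W i j x)\<^sup>2) borel (\<lambda>x. (W i k x)\<^sup>2)" by (simp add: comp_def)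
  qed (use int2[OF i] in auto)
  then show ?thesis by (simp add: var[OF i])
qed

text \<open>For different columns the four entries are distinct, independent and centred; for equal
  columns the product of two independent squares appears. So second moments of the entries suffice
  for second moments of the products.\<close>

lemma product_moments:
  assumes i: "i \<in> I" "i' \<in> I" "i \<noteq> i'"
  shows "integrable M (\<lambda>x. (W i j x * W i' j x) * (W i k x * W i' k x))"
    and "expectation (\<lambda>x. (W i j x * W i' j x) * (W i k x * W i' k x)) = (if j = k then v i * v i' else 0)"
proof -
  have "integrable M (\<lambda>x. (W i j x * W i' j x) * (W i k x * W i' k x)) \<and>
    expectation (\<lambda>x. (W i j x * W i' j x) * (W i k x * W i' k x)) = (if j = k then v i * v i' else 0)"
  proof (cases "j = k")
    case True
    have "indep_var borel (W i k) borel (W i' k)" by (intro indep_pair i) (use i in auto)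
    then have "indep_var borel ((\<lambda>y. y\<^sup>2) \<circ> W i k) borel ((\<lambda>y. y\<^sup>2) \<circ> W i' k)"
      by (rule indep_var_compose) auto
    then have ind: "indep_var borel (\<lambda>x. (W i k x)\<^sup>2) borel (\<lambda>x. (W i' k x)\<^sup>2)" by (simp add: comp_def)
    have eq: "(W i k x * W i' k x) * (W i k x * W i' k x) = (W i k x)\<^sup>2 * (W i' k x)\<^sup>2" for x
      by (simp add: power2_eq_square mult_ac)
    show ?thesis unfolding True eq
      using indep_var_integrable[OF ind int2[OF i(1)] int2[OF i(2)]]
        indep_var_lebesgue_integral[OF ind int2[OF i(1)] int2[OF i(2)]] var[OF i(1)] var[OF i(2)] by simp
  next
    case False
    let ?J = "{(i, j), (i', j), (i, k), (i', k)}"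
    have ind: "indep_vars (\<lambda>_. borel) (\<lambda>(i, j). W i j) ?J"
      by (rule indep_vars_subset[OF indep]) (use i in auto)
    have int': "integrable M ((\<lambda>(i, j). W i j) l)" if "l \<in> ?J" for l using that int i by auto
    have eq: "(\<Prod>l\<in>?J. (\<lambda>(i, j). W i j) l x) = (W i j x * W i' j x) * (W i k x * W i' k x)" for x
      using i(3) False by (simp add: mult_ac)
    have "(\<Prod>l\<in>?J. expectation ((\<lambda>(i, j). W i j) l)) = 0" using mean[OF i(1)] by simp
    then show ?thesis
      using indep_vars_integrable[OF _ ind int'] indep_vars_lebesgue_integral[OF _ ind int'] False
      unfolding eq by simp
  qed
  then show "integrable M (\<lambda>x. (W i j x * W i' j x) * (W i k x * W i' k x))"
    "expectation (\<lambda>x. (W i j x * W i' j x) * (W i k x * W i' k x)) = (if j = k then v i * v i' else 0)"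
    by auto
qed

text \<open>The products have no sign, so the strong law for nonnegative variables does not apply.
  Orthogonality gives partial sums of mean size \<open>sqrt N\<close>, and their increments are
  dominated by squares, whose averages converge.\<close>

lemma AE_average_products:
  assumes i: "i \<in> I" "i' \<in> I" "i \<noteq> i'"
  shows "AE x in M. (\<lambda>N. (\<Sum>j<N. W i j x * W i' j x) / N) \<longlonglongrightarrow> 0"
proof -
  note [measurable] = measurable_W[OF i(1)] measurable_W[OF i(2)]
  define S where "S N x = (\<Sum>j<N. W i j x * W i' j x)" for N x
  have S2: "integrable M (\<lambda>x. (S N x)\<^sup>2)" "expectation (\<lambda>x. (S N x)\<^sup>2) = v i * v i' * N" for N
    using expectation_orthogonal_sums[of "\<lambda>j x. W i j x * W i' j x" "v i * v i'" "\<lambda>_. 1" N "\<lambda>_. 1",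
        OF product_moments[OF i]]
    unfolding S_def power2_eq_square by auto
  have pint: "integrable M (\<lambda>x. W i j x * W i' j x)" for j
    by (rule indep_var_integrable[OF indep_pair int int]) (use i in auto)
  have Sint: "integrable M (S N)" for N unfolding S_def using pint by auto
  have "AE x in M. (\<lambda>N. \<bar>S N x\<bar> / N) \<longlonglongrightarrow> 0"
  proof (rule AE_sublinear[where start = 1 and r = "\<lambda>j x. (W i j x)\<^sup>2 + (W i' j x)\<^sup>2"
        and C = "(v i * v i' + 1) / 2" and c = "v i + v i'"])
    fix N :: nat assume N: "1 \<le> N"
    have "expectation (\<lambda>x. \<bar>S N x\<bar>) \<le> expectation (\<lambda>x. ((S N x)\<^sup>2 / sqrt N + sqrt N) / 2)"
    proof (rule integral_mono)
      fix x
      \<comment> \<open>The weight \<open>sqrt N\<close> balances the two terms: the second moment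
        of \<open>S N\<close> grows like \<open>N\<close>, so both contribute multiples of
        \<open>sqrt N\<close>.\<close>
      have "0 \<le> (\<bar>S N x\<bar> - sqrt N)\<^sup>2" by simp
      then have "2 * \<bar>S N x\<bar> * sqrt N \<le> (S N x)\<^sup>2 + sqrt N * sqrt N"
        by (simp add: power2_diff)
      then show "\<bar>S N x\<bar> \<le> ((S N x)\<^sup>2 / sqrt N + sqrt N) / 2"
        using N by (simp add: field_simps)
    qed (use Sint S2 in auto)
    also have "\<dots> = ((v i * v i' * N) / sqrt N + sqrt N) / 2"
      using S2 by (simp add: prob_space)
    also have "\<dots> = (v i * v i' + 1) / 2 * sqrt N"
      unfolding times_divide_eq_right[symmetric] real_div_sqrt[OF of_nat_0_le_iff]
      by (simp add: distrib_right add_divide_distrib)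
    finally show "expectation (\<lambda>x. \<bar>S N x\<bar>) \<le> (v i * v i' + 1) / 2 * sqrt N" .
  next
    fix m n :: nat and x assume "m \<le> n"
    then have "S n x = S m x + (\<Sum>j\<in>{m..<n}. W i j x * W i' j x)"
      unfolding S_def by (simp add: lessThan_atLeast0 sum.atLeastLessThan_concat)
    then have "\<bar>S n x\<bar> \<le> \<bar>S m x\<bar> + (\<Sum>j\<in>{m..<n}. \<bar>W i j x * W i' j x\<bar>)"
      using sum_abs[of "\<lambda>j. W i j x * W i' j x" "{m..<n}"] by linarith
    also have "(\<Sum>j\<in>{m..<n}. \<bar>W i j x * W i' j x\<bar>) \<le> (\<Sum>j\<in>{m..<n}. (W i j x)\<^sup>2 + (W i' j x)\<^sup>2)"
    proof (rule sum_mono)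
      fix j
      have "0 \<le> (\<bar>W i j x\<bar> - \<bar>W i' j x\<bar>)\<^sup>2" by simp
      then have "2 * (\<bar>W i j x\<bar> * \<bar>W i' j x\<bar>) \<le> (W i j x)\<^sup>2 + (W i' j x)\<^sup>2" by (simp add: power2_diff)
      moreover have "0 \<le> \<bar>W i j x\<bar> * \<bar>W i' j x\<bar>" by simp
      ultimately show "\<bar>W i j x * W i' j x\<bar> \<le> (W i j x)\<^sup>2 + (W i' j x)\<^sup>2" unfolding abs_mult by linarith
    qed
    finally show "\<bar>S n x\<bar> \<le> \<bar>S m x\<bar> + (\<Sum>j\<in>{m..<n}. (W i j x)\<^sup>2 + (W i' j x)\<^sup>2)" by simp
  next
    show "AE x in M. (\<lambda>N. (\<Sum>j<N. (W i j x)\<^sup>2 + (W i' j x)\<^sup>2) / N) \<longlonglongrightarrow> v i + v i'"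
      using AE_average_squares[OF i(1)] AE_average_squares[OF i(2)]
    proof eventually_elim
      case (elim x)
      from tendsto_add[OF this] show ?case by (simp add: sum.distrib add_divide_distrib)
    qed
  qed (use Sint in auto)
  then show ?thesis
  proof eventually_elim
    case (elim x)
    then have "(\<lambda>N. \<bar>S N x / N\<bar>) \<longlonglongrightarrow> 0" by (simp add: abs_divide)
    then show ?case unfolding S_def by (rule tendsto_rabs_zero_cancel)
  qed
qed

text \<open>The witness \<open>V N\<close> is the squared length of the projection of the first \<open>N\<close> errors to the row
  space of the regressors.\<close>

lemma AE_projection_sublinear:
  fixes z :: "nat \<Rightarrow> nat \<Rightarrow> real"
  assumes i: "i \<in> I"
    and pd: "\<And>N h. n0 \<le> N \<Longrightarrow> (\<Sum>j<N. (\<Sum>a<p. h a * z a j)\<^sup>2) = 0 \<Longrightarrow> \<forall>a<p. h a = 0"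
  shows "AE x in M. \<exists>V. (\<forall>N. 0 \<le> V N) \<and> (\<lambda>N. V N / N) \<longlonglongrightarrow> 0 \<and>
    (\<forall>N h. n0 \<le> N \<longrightarrow>
      (\<Sum>b<p. h b * (\<Sum>j<N. z b j * W i j x))\<^sup>2 \<le> (\<Sum>j<N. (\<Sum>b<p. h b * z b j)\<^sup>2) * V N)"
proof -
  define G where "G N a b = (\<Sum>j<N. z a j * z b j)" for N a b
  have "\<forall>N. \<exists>K. n0 \<le> N \<longrightarrow>
     (\<forall>a c. a < p \<longrightarrow> c < p \<longrightarrow> (\<Sum>b<p. K a b * G N b c) = (if a = c then 1 else (0::real))) \<and>
     (\<forall>a c. a < p \<longrightarrow> c < p \<longrightarrow> (\<Sum>b<p. G N a b * K b c) = (if a = c then 1 else (0::real)))"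
  proof
    fix N
    show "\<exists>K. n0 \<le> N \<longrightarrow>
     (\<forall>a c. a < p \<longrightarrow> c < p \<longrightarrow> (\<Sum>b<p. K a b * G N b c) = (if a = c then 1 else (0::real))) \<and>
     (\<forall>a c. a < p \<longrightarrow> c < p \<longrightarrow> (\<Sum>b<p. G N a b * K b c) = (if a = c then 1 else (0::real)))"
    proof (cases "n0 \<le> N")
      case True
      show ?thesis
      proof (rule gram_inverse[where N = N and p = p and z = z])
        show "\<forall>a<p. h a = 0" if "(\<Sum>j<N. (\<Sum>a<p. h a * z a j)\<^sup>2) = 0" for h
          by (rule pd[OF True that])
      next
        fix K :: "nat \<Rightarrow> nat \<Rightarrow> real"
        assume "\<And>a c. a < p \<Longrightarrow> c < p \<Longrightarrow> (\<Sum>b<p. K a b * (\<Sum>j<N. z b j * z c j)) = (if a = c then 1 else 0)"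
          "\<And>a c. a < p \<Longrightarrow> c < p \<Longrightarrow> (\<Sum>b<p. (\<Sum>j<N. z a j * z b j) * K b c) = (if a = c then 1 else 0)"
        then show ?thesis unfolding G_def by (intro exI[of _ K]) simp
      qed
    qed simp
  qed
  from choice[OF this] obtain K where K': "\<forall>N. n0 \<le> N \<longrightarrow>
     (\<forall>a c. a < p \<longrightarrow> c < p \<longrightarrow> (\<Sum>b<p. K N a b * G N b c) = (if a = c then 1 else (0::real))) \<and>
     (\<forall>a c. a < p \<longrightarrow> c < p \<longrightarrow> (\<Sum>b<p. G N a b * K N b c) = (if a = c then 1 else (0::real)))" ..
  have
    K: "\<And>N a c. n0 \<le> N \<Longrightarrow> a < p \<Longrightarrow> c < p \<Longrightarrow> (\<Sum>b<p. K N a b * G N b c) = (if a = c then 1 else (0::real))"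
      "\<And>N a c. n0 \<le> N \<Longrightarrow> a < p \<Longrightarrow> c < p \<Longrightarrow> (\<Sum>b<p. G N a b * K N b c) = (if a = c then 1 else (0::real))"
    using K' by simp_all
  \<comment> \<open>\<open>s\<close> is the true data matrix applied to the noise row,
    \<open>t\<close> holds the least squares coefficients of that row, and \<open>V\<close> is the
    squared length of the fit. Below \<open>n0\<close>, where the Gram matrix may be singular,
    \<open>V\<close> is set to 0.\<close>
  define s where "s N a x = (\<Sum>j<N. z a j * W i j x)" for N a x
  define t where "t N a x = (\<Sum>b<p. K N a b * s N b x)" for N a x
  define V where "V N x = (if n0 \<le> N then (\<Sum>a<p. t N a x * s N a x) else 0)" for N x
  have Gt: "(\<Sum>b<p. G N a b * t N b x) = s N a x" if N: "n0 \<le> N" and a: "a < p" for N a x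
  proof -
    have "(\<Sum>b<p. G N a b * t N b x) = (\<Sum>b<p. \<Sum>c<p. G N a b * K N b c * s N c x)"
      unfolding t_def by (simp add: sum_distrib_left mult.assoc)
    also have "\<dots> = (\<Sum>c<p. (\<Sum>b<p. G N a b * K N b c) * s N c x)"
      by (subst sum.swap) (simp add: sum_distrib_right)
    also have "\<dots> = (\<Sum>c<p. (if a = c then 1 else 0) * s N c x)" using K(2)[OF N a] by simp
    also have "\<dots> = s N a x" using a by (simp add: if_distrib[of "\<lambda>t. t * _"] cong: if_cong)
    finally show ?thesis .
  qed
  have bil: "(\<Sum>j<N. (\<Sum>a<p. g a * z a j) * (\<Sum>b<p. h b * z b j)) = (\<Sum>a<p. g a * (\<Sum>b<p. G N a b * h b))" for N g h
  proof -
    have "(\<Sum>j<N. (\<Sum>a<p. g a * z a j) * (\<Sum>b<p. h b * z b j)) = (\<Sum>j<N. \<Sum>a<p. \<Sum>b<p. g a * (z a j * z b j * h b))"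
      by (simp add: sum_product mult_ac)
    also have "\<dots> = (\<Sum>a<p. \<Sum>j<N. \<Sum>b<p. g a * (z a j * z b j * h b))" by (rule sum.swap)
    also have "\<dots> = (\<Sum>a<p. \<Sum>b<p. \<Sum>j<N. g a * (z a j * z b j * h b))" by (intro sum.cong refl sum.swap)
    finally show ?thesis unfolding G_def by (simp add: sum_distrib_left sum_distrib_right)
  qed
  have bilt: "(\<Sum>j<N. (\<Sum>a<p. g a * z a j) * (\<Sum>b<p. t N b x * z b j)) = (\<Sum>a<p. g a * s N a x)"
    if "n0 \<le> N" for N g x
    unfolding bil using Gt[OF that] by simp
  have Vsq: "V N x = (\<Sum>j<N. (\<Sum>a<p. t N a x * z a j)\<^sup>2)" if "n0 \<le> N" for N x
    unfolding power2_eq_square bilt[OF that] using that by (simp add: V_def)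
  have V0: "0 \<le> V N x" for N x
    using Vsq[of N x] by (cases "n0 \<le> N") (auto simp: V_def sum_nonneg)
  have cs: "(\<Sum>b<p. h b * s N b x)\<^sup>2 \<le> (\<Sum>j<N. (\<Sum>b<p. h b * z b j)\<^sup>2) * V N x" if "n0 \<le> N" for N h x
    unfolding bilt[OF that, symmetric] Vsq[OF that] by (rule Cauchy_Schwarz_ineq_sum)
  have sm: "integrable M (\<lambda>x. s N a x * s N b x)" "expectation (\<lambda>x. s N a x * s N b x) = v i * G N a b" for N a b
    using expectation_orthogonal_sums[of "W i" "v i" "z a" N "z b", OF second_moments[OF i]]
    unfolding s_def G_def by auto
  have Veq: "V N x = (\<Sum>a<p. \<Sum>b<p. K N a b * (s N b x * s N a x))" if "n0 \<le> N" for N x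
    using that by (simp add: V_def t_def sum_distrib_right mult.assoc)
  have Vint: "integrable M (V N)" if "n0 \<le> N" for N
    unfolding Veq[OF that, abs_def] using sm by auto
  \<comment> \<open>The sum is the trace of the inverse Gram matrix times the Gram matrix.\<close>
  have VE: "expectation (V N) = v i * p" if N: "n0 \<le> N" for N
  proof -
    have "expectation (V N) = (\<Sum>a<p. \<Sum>b<p. K N a b * (v i * G N b a))"
      unfolding Veq[OF N, abs_def] using sm by (simp add: Bochner_Integration.integral_sum)
    also have "\<dots> = (\<Sum>a<p. v i * (\<Sum>b<p. K N a b * G N b a))" by (simp add: sum_distrib_left mult_ac)
    also have "\<dots> = (\<Sum>a<p. v i)" using K(1)[OF N] by simp
    finally show ?thesis by simp
  qed
  have "AE x in M. (\<lambda>N. V N x / N) \<longlonglongrightarrow> 0"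
  proof (rule AE_sublinear[where start = "max 1 n0" and C = "\<bar>v i * p\<bar>" and c = "v i"])
    show "integrable M (V N)" if "max 1 n0 \<le> N" for N using that Vint by simp
    show "0 \<le> V N x" for N x by (rule V0)
    show "expectation (V N) \<le> \<bar>v i * p\<bar> * sqrt N" if "max 1 n0 \<le> N" for N
    proof -
      have "1 \<le> sqrt N" using that by simp
      then have "\<bar>v i * p\<bar> * 1 \<le> \<bar>v i * p\<bar> * sqrt N" by (intro mult_left_mono) auto
      then show ?thesis using that VE[of N] by simp
    qed
    show "AE x in M. (\<lambda>N. (\<Sum>j<N. (W i j x)\<^sup>2) / N) \<longlonglongrightarrow> v i" by (rule AE_average_squares[OF i])
    fix m n x assume mn: "max 1 n0 \<le> m" "m \<le> n"
    then have m: "n0 \<le> m" and n: "n0 \<le> n" by auto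
    let ?u = "\<lambda>N j. (\<Sum>a<p. t N a x * z a j)"
    have uW: "(\<Sum>j<N. ?u n j * W i j x) = (\<Sum>a<p. t n a x * s N a x)" for N
      unfolding s_def sum_distrib_left sum_distrib_right by (subst sum.swap) (simp add: mult_ac)
    have res: "(\<Sum>j<N. (W i j x - ?u n j)\<^sup>2) = (\<Sum>j<N. (W i j x)\<^sup>2) - 2 * (\<Sum>a<p. t n a x * s N a x) + (\<Sum>j<N. (?u n j)\<^sup>2)" for N
      unfolding uW[symmetric] by (simp add: power2_diff sum.distrib sum_subtractf sum_distrib_left mult_ac)
    have am: "2 * (\<Sum>j<m. f j * g j) \<le> (\<Sum>j<m. (f j)\<^sup>2) + (\<Sum>j<m. (g j)\<^sup>2)" for f g :: "nat \<Rightarrow> real"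
      unfolding sum_distrib_left sum.distrib[symmetric] mult.assoc[symmetric] by (intro sum_mono sum_squares_bound)
    \<comment> \<open>Minimality of the residual on the first \<open>m\<close> columns: the fit
      \<open>?u n\<close> made with \<open>n\<close> columns cannot do better there than
      \<open>?u m\<close>. On these columns the noise may be replaced by \<open>?u m\<close> in the
      product with \<open>?u n\<close>.\<close>
    have cross: "2 * (\<Sum>a<p. t n a x * s m a x) \<le> (\<Sum>j<m. (?u n j)\<^sup>2) + V m x"
      using am[of "?u n" "?u m"] by (simp only: bilt[OF m] Vsq[OF m])
    have "\<omega> - V' \<le> \<rho>" if "2 * \<xi> \<le> \<upsilon> + V'" "\<rho> = \<omega> - 2 * \<xi> + \<upsilon>" for \<rho> \<omega> \<xi> \<upsilon> V' :: real
      using that by simp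
    from this[OF cross res]
    have "(\<Sum>j<m. (W i j x)\<^sup>2) - V m x \<le> (\<Sum>j<m. (W i j x - ?u n j)\<^sup>2)" .
    also have "\<dots> \<le> (\<Sum>j<n. (W i j x - ?u n j)\<^sup>2)" using mn by (intro sum_mono2) auto
    also have "\<dots> = (\<Sum>j<n. (W i j x)\<^sup>2) - V n x"
    proof -
      have "V n x = (\<Sum>a<p. t n a x * s n a x)" using n by (simp add: V_def)
      then show ?thesis unfolding res Vsq[OF n, symmetric] by simp
    qed
    finally have "V n x \<le> V m x + ((\<Sum>j<n. (W i j x)\<^sup>2) - (\<Sum>j<m. (W i j x)\<^sup>2))" by linarith
    then show "V n x \<le> V m x + (\<Sum>j\<in>{m..<n}. (W i j x)\<^sup>2)"
      using sum_diff_nat_ivl[of 0 m n "\<lambda>j. (W i j x)\<^sup>2"] mn by (simp add: lessThan_atLeast0)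
  qed
  then show ?thesis
  proof eventually_elim
    case (elim x)
    then show ?case using V0 cs unfolding s_def by (intro exI[of _ "\<lambda>N. V N x"]) simp
  qed
qed

end

section \<open>The estimators as blocks of a corrected regression\<close>

lemma (in prob_space) indep_vars_inj_reindex:
  assumes ind: "indep_vars M' X I" and inj: "inj_on f L" and sub: "f ` L \<subseteq> I"
  shows "indep_vars (\<lambda>j. M' (f j)) (\<lambda>j. X (f j)) L"
proof -
  have "indep_vars (\<lambda>j. Pi\<^sub>M {f j} M') (\<lambda>j \<omega>. restrict (\<lambda>i. X i \<omega>) {f j}) L"
    by (rule indep_vars_restrict[OF ind]) (use inj sub in \<open>auto simp: disjoint_family_on_def inj_on_def\<close>)
  from indep_vars_compose2[OF this, of "\<lambda>j g. g (f j)" "\<lambda>j. M' (f j)"] show ?thesis by simp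
qed

section \<open>Block elimination of the corrected normal equations\<close>

lemma sum_lessThan_add_split:
  fixes g :: "nat \<Rightarrow> 'b::comm_monoid_add"
  shows "(\<Sum>a<n + q. g a) = (\<Sum>a<n. g a) + (\<Sum>a<q. g (n + a))"
  by (induction q) (simp_all add: add.assoc)

text \<open>The common shape of \<open>Qc\<close> and \<open>Lc\<close>: the coefficients of
  \<open>Z1\<close> are estimated while \<open>Z2\<close> is eliminated. The two estimators differ
  only in which of state and input plays which role.\<close>

definition schur_est :: "real \<Rightarrow> real \<Rightarrow> nat \<Rightarrow> real mat \<Rightarrow> real mat \<Rightarrow> real mat \<Rightarrow> real mat" where
  "schur_est \<sigma>1 \<sigma>2 N Z1 Z2 X = X * corr_proj \<sigma>2 N Z2 * Z1\<^sup>T * corr_gram_pinv \<sigma>1 N (Z1 * corr_proj \<sigma>2 N Z2 * Z1\<^sup>T)"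

lemma corr_gram_pinv_carrier:
  "G \<in> carrier_mat n n \<Longrightarrow> corr_gram_pinv \<sigma> N G \<in> carrier_mat n n"
  unfolding corr_gram_pinv_def by (intro pinv_carrier) auto

lemma corr_proj_carrier:
  assumes Z: "Z \<in> carrier_mat q N" shows "corr_proj \<sigma> N Z \<in> carrier_mat N N"
proof -
  have t: "Z\<^sup>T \<in> carrier_mat N q" using Z by simp
  show ?thesis unfolding corr_proj_def
    by (rule minus_carrier_mat[OF mult_carrier_mat[OF mult_carrier_mat[OF t
            corr_gram_pinv_carrier[OF mult_carrier_mat[OF Z t]]] Z]])
qed

text \<open>All matrices of size \<open>N\<close> disappear in favour of products of fixed size.
  Taking \<open>Z1\<close> for \<open>X\<close> gives the uncorrected Schur complement, taking the
  response gives the eliminated right-hand side.\<close>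

lemma mult_corr_proj:
  assumes X: "X \<in> carrier_mat r N" and Z2: "Z2 \<in> carrier_mat q N" and Z1: "Z1 \<in> carrier_mat n N"
  shows "X * corr_proj \<sigma> N Z2 * Z1\<^sup>T = X * Z1\<^sup>T - X * Z2\<^sup>T * corr_gram_pinv \<sigma> N (Z2 * Z2\<^sup>T) * (Z2 * Z1\<^sup>T)"
proof -
  let ?J = "corr_gram_pinv \<sigma> N (Z2 * Z2\<^sup>T)"
  have t1: "Z1\<^sup>T \<in> carrier_mat N n" and t2: "Z2\<^sup>T \<in> carrier_mat N q" using Z1 Z2 by auto
  have J: "?J \<in> carrier_mat q q" by (rule corr_gram_pinv_carrier[OF mult_carrier_mat[OF Z2 t2]])
  note t2J = mult_carrier_mat[OF t2 J]
  note t2JZ = mult_carrier_mat[OF t2J Z2]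
  note XJ = mult_carrier_mat[OF mult_carrier_mat[OF X t2] J]
  have "X * corr_proj \<sigma> N Z2 = X * 1\<^sub>m N - X * (Z2\<^sup>T * ?J * Z2)"
    unfolding corr_proj_def by (rule mult_minus_distrib_mat[OF X one_carrier_mat t2JZ])
  also have "X * (Z2\<^sup>T * ?J * Z2) = X * Z2\<^sup>T * ?J * Z2"
    unfolding assoc_mult_mat[OF X t2J Z2, symmetric] assoc_mult_mat[OF X t2 J, symmetric] ..
  also have "X * 1\<^sub>m N = X" using X by simp
  finally have "X * corr_proj \<sigma> N Z2 * Z1\<^sup>T = X * Z1\<^sup>T - X * Z2\<^sup>T * ?J * Z2 * Z1\<^sup>T"
    using minus_mult_distrib_mat[OF X mult_carrier_mat[OF XJ Z2] t1] by simp
  then show ?thesis unfolding assoc_mult_mat[OF XJ Z2 t1] .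
qed

lemma schur_est_carrier:
  assumes X: "X \<in> carrier_mat r N" and Z2: "Z2 \<in> carrier_mat q N" and Z1: "Z1 \<in> carrier_mat n N"
  shows "schur_est \<sigma>1 \<sigma>2 N Z1 Z2 X \<in> carrier_mat r n"
proof -
  note P = corr_proj_carrier[OF Z2, of \<sigma>2]
  have t1: "Z1\<^sup>T \<in> carrier_mat N n" using Z1 by simp
  show ?thesis unfolding schur_est_def
    by (rule mult_carrier_mat[OF mult_carrier_mat[OF mult_carrier_mat[OF X P] t1]
          corr_gram_pinv_carrier[OF mult_carrier_mat[OF mult_carrier_mat[OF Z1 P] t1]]])
qed

lemma Qc_eq_schur_est: "Qc \<sigma>U \<sigma>X0 N U X0 X = schur_est \<sigma>X0 \<sigma>U N X0 U X"
  by (simp add: Qc_def schur_est_def)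

lemma Lc_eq_schur_est: "Lc \<sigma>U \<sigma>X0 N U X0 X = schur_est \<sigma>U \<sigma>X0 N U X0 X"
  by (simp add: Lc_def schur_est_def)

lemma mult_mat_vec_uminus:
  fixes E :: "real mat"
  assumes "E \<in> carrier_mat k q" "x \<in> carrier_vec q"
  shows "E *\<^sub>v (- x) = - (E *\<^sub>v x)"
  using assms by (intro eq_vecI) (auto simp: scalar_prod_def sum_negf)

text \<open>Solving the second equation for \<open>H2\<close> and inserting it into the first leaves
  \<open>H1\<close> times the Schur complement. Injectivity of the block matrix makes that
  complement invertible, so both pseudoinverses are inverses.\<close>

lemma schur_solution:
  fixes S11 S12 S21 S22 :: "real mat"
  assumes c: "S11 \<in> carrier_mat n n" "S12 \<in> carrier_mat n q" "S21 \<in> carrier_mat q n" "S22 \<in> carrier_mat q q"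
    and H: "H1 \<in> carrier_mat r n" "H2 \<in> carrier_mat r q"
    and eq: "H1 * S11 + H2 * S21 = Y1" "H1 * S12 + H2 * S22 = Y2"
    and inj: "\<And>u w. u \<in> carrier_vec n \<Longrightarrow> w \<in> carrier_vec q \<Longrightarrow>
      S11 *\<^sub>v u + S12 *\<^sub>v w = 0\<^sub>v n \<Longrightarrow> S21 *\<^sub>v u + S22 *\<^sub>v w = 0\<^sub>v q \<Longrightarrow> u = 0\<^sub>v n"
    and inj22: "\<And>w. w \<in> carrier_vec q \<Longrightarrow> S22 *\<^sub>v w = 0\<^sub>v q \<Longrightarrow> w = 0\<^sub>v q"
  shows "(Y1 - Y2 * pinv S22 * S21) * pinv (S11 - S12 * pinv S22 * S21) = H1"
proof -
  let ?J = "pinv S22" and ?Sc = "S11 - S12 * pinv S22 * S21"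
  have d22: "det S22 \<noteq> 0" using inj22 det_0_iff_vec_prod_zero_field[OF c(4)] by blast
  note J22 = pinv_nonsingular[OF c(4) d22]
  have J: "?J \<in> carrier_mat q q" using c(4) by simp
  note S12J = mult_carrier_mat[OF c(2) J]
  note S12JS = mult_carrier_mat[OF S12J c(3)]
  have Sc: "?Sc \<in> carrier_mat n n" using minus_carrier_mat[OF S12JS] by simp
  have JS: "?J * S21 \<in> carrier_mat q n" by (rule mult_carrier_mat[OF J c(3)])
  have "det ?Sc \<noteq> 0"
  proof
    assume "det ?Sc = 0"
    then obtain u where u: "u \<in> carrier_vec n" "u \<noteq> 0\<^sub>v n" "?Sc *\<^sub>v u = 0\<^sub>v n"
      using det_0_iff_vec_prod_zero_field[OF Sc] by blast
    \<comment> \<open>Completes \<open>u\<close> to a kernel vector of the block matrix: the second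
      block row vanishes by the choice of \<open>w\<close>, the first is the Schur complement
      applied to \<open>u\<close>.\<close>
    define w where "w = - ((?J * S21) *\<^sub>v u)"
    note JSu = mult_mat_vec_carrier[OF JS u(1)]
    have w: "w \<in> carrier_vec q" using JSu by (simp add: w_def)
    have neg: "E *\<^sub>v w = - ((E * (?J * S21)) *\<^sub>v u)" if E: "E \<in> carrier_mat k q" for E k
    proof -
      have "E *\<^sub>v w = - (E *\<^sub>v ((?J * S21) *\<^sub>v u))"
        unfolding w_def by (rule mult_mat_vec_uminus[OF E JSu])
      then show ?thesis using assoc_mult_mat_vec[OF E JS u(1)] by simp
    qed
    have "S12 * (?J * S21) = S12 * ?J * S21" by (rule assoc_mult_mat[OF c(2) J c(3), symmetric])
    then have "S11 *\<^sub>v u + S12 *\<^sub>v w = S11 *\<^sub>v u - (S12 * ?J * S21) *\<^sub>v u"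
      using neg[OF c(2)] mult_mat_vec_carrier[OF c(1) u(1)] mult_mat_vec_carrier[OF S12JS u(1)]
      by (simp add: minus_add_uminus_vec)
    also have "\<dots> = 0\<^sub>v n" using minus_mult_distrib_mat_vec[OF c(1) S12JS u(1)] u(3) by simp
    finally have 1: "S11 *\<^sub>v u + S12 *\<^sub>v w = 0\<^sub>v n" .
    have "S22 * (?J * S21) = S21"
      using assoc_mult_mat[OF c(4) J c(3)] J22(1) c(3) by simp
    then have 2: "S21 *\<^sub>v u + S22 *\<^sub>v w = 0\<^sub>v q"
      using neg[OF c(4)] mult_mat_vec_carrier[OF c(3) u(1)] by simp
    from inj[OF u(1) w 1 2] u(2) show False by simp
  qed
  note JSc = pinv_nonsingular[OF Sc this]
  note a = mult_carrier_mat[OF H(1) c(1)] and b = mult_carrier_mat[OF H(2) c(3)]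
    and c' = mult_carrier_mat[OF H(1) c(2)] and d = mult_carrier_mat[OF H(2) c(4)]
  have "Y2 * ?J = H1 * S12 * ?J + H2 * S22 * ?J"
    unfolding eq(2)[symmetric] by (rule add_mult_distrib_mat[OF c' d J])
  also have "H2 * S22 * ?J = H2" unfolding assoc_mult_mat[OF H(2) c(4) J] J22(1) using H by simp
  finally have "Y2 * ?J * S21 = H1 * S12 * ?J * S21 + H2 * S21"
    using add_mult_distrib_mat[OF mult_carrier_mat[OF c' J] H(2) c(3)] by simp
  also have "H1 * S12 * ?J * S21 = H1 * (S12 * ?J * S21)"
    unfolding assoc_mult_mat[OF H(1) c(2) J] assoc_mult_mat[OF H(1) S12J c(3)] ..
  finally have "Y1 - Y2 * ?J * S21 = (H1 * S11 + H2 * S21) - (H1 * (S12 * ?J * S21) + H2 * S21)"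
    by (simp only: eq(1))
  also have "\<dots> = H1 * S11 - H1 * (S12 * ?J * S21)"
  proof -
    have "E + F - (G + F) = E - G" if "E \<in> carrier_mat r n" "F \<in> carrier_mat r n" "G \<in> carrier_mat r n"
      for E F G :: "real mat"
      using that by (intro eq_matI) auto
    from this[OF a b mult_carrier_mat[OF H(1) S12JS]] show ?thesis .
  qed
  also have "\<dots> = H1 * ?Sc" by (rule mult_minus_distrib_mat[OF H(1) c(1) S12JS, symmetric])
  finally have "(Y1 - Y2 * ?J * S21) * pinv ?Sc = H1 * (?Sc * pinv ?Sc)"
    using assoc_mult_mat[OF H(1) Sc pinv_carrier[OF Sc]] by simp
  then show ?thesis unfolding JSc(1) using H(1) by simp
qed

text \<open>The variance of the eliminated block is subtracted inside \<open>corr_proj\<close>, that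
  of the other block in the outer pseudoinverse. Both land on diagonal blocks; the off-diagonal
  blocks stay as they are, in keeping with uncorrelated noise.\<close>

lemma schur_est_eq:
  fixes Z1 Z2 X :: "real mat"
  assumes Z: "Z1 \<in> carrier_mat n N" "Z2 \<in> carrier_mat q N" "X \<in> carrier_mat r N"
    and S: "S11 = Z1 * Z1\<^sup>T - (N * \<sigma>1\<^sup>2) \<cdot>\<^sub>m 1\<^sub>m n" "S22 = Z2 * Z2\<^sup>T - (N * \<sigma>2\<^sup>2) \<cdot>\<^sub>m 1\<^sub>m q"
    and H: "H1 \<in> carrier_mat r n" "H2 \<in> carrier_mat r q"
    and eq: "H1 * S11 + H2 * (Z2 * Z1\<^sup>T) = X * Z1\<^sup>T" "H1 * (Z1 * Z2\<^sup>T) + H2 * S22 = X * Z2\<^sup>T"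
    and inj: "\<And>u w. u \<in> carrier_vec n \<Longrightarrow> w \<in> carrier_vec q \<Longrightarrow>
      S11 *\<^sub>v u + (Z1 * Z2\<^sup>T) *\<^sub>v w = 0\<^sub>v n \<Longrightarrow> (Z2 * Z1\<^sup>T) *\<^sub>v u + S22 *\<^sub>v w = 0\<^sub>v q \<Longrightarrow> u = 0\<^sub>v n"
    and inj22: "\<And>w. w \<in> carrier_vec q \<Longrightarrow> S22 *\<^sub>v w = 0\<^sub>v q \<Longrightarrow> w = 0\<^sub>v q"
  shows "schur_est \<sigma>1 \<sigma>2 N Z1 Z2 X = H1"
proof -
  have t1: "Z1\<^sup>T \<in> carrier_mat N n" and t2: "Z2\<^sup>T \<in> carrier_mat N q" using Z by auto
  note z11 = mult_carrier_mat[OF Z(1) t1] and z12 = mult_carrier_mat[OF Z(1) t2]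
    and z21 = mult_carrier_mat[OF Z(2) t1] and z22 = mult_carrier_mat[OF Z(2) t2]
  have c: "S11 \<in> carrier_mat n n" "S22 \<in> carrier_mat q q" unfolding S by auto
  have J2: "corr_gram_pinv \<sigma>2 N (Z2 * Z2\<^sup>T) = pinv S22"
    unfolding corr_gram_pinv_def S using carrier_matD[OF z22] by simp
  have J: "pinv S22 \<in> carrier_mat q q" using c(2) by simp
  define E where "E = Z1 * Z2\<^sup>T * pinv S22 * (Z2 * Z1\<^sup>T)"
  have E: "E \<in> carrier_mat n n" unfolding E_def by (rule mult_carrier_mat[OF mult_carrier_mat[OF z12 J] z21])
  have G: "Z1 * corr_proj \<sigma>2 N Z2 * Z1\<^sup>T = Z1 * Z1\<^sup>T - E"
    unfolding mult_corr_proj[OF Z(1) Z(2) Z(1)] J2 E_def ..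
  have "Z1 * Z1\<^sup>T - E - (N * \<sigma>1\<^sup>2) \<cdot>\<^sub>m 1\<^sub>m n = S11 - E"
    unfolding S using z11 E by (intro eq_matI) auto
  moreover have "dim_row (Z1 * Z1\<^sup>T - E) = n" using E by simp
  ultimately have g: "corr_gram_pinv \<sigma>1 N (Z1 * corr_proj \<sigma>2 N Z2 * Z1\<^sup>T) = pinv (S11 - E)"
    unfolding corr_gram_pinv_def G by simp
  show ?thesis
    unfolding schur_est_def g unfolding mult_corr_proj[OF Z(3) Z(2) Z(1)] J2 E_def
    by (rule schur_solution[OF c(1) z12 z21 c(2) H eq inj inj22])
qed


section \<open>Both estimators from one solution of the normal equations\<close>

context noisy_regression
begin

lemma corrected_gram_injective:
  assumes N: "n0 \<le> N" and coercive: "\<And>h. q N h / 2 \<le> (\<Sum>a<p. \<Sum>b<p. h a * S N a b * h b)"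
    and ker: "\<And>a. a < p \<Longrightarrow> (\<Sum>b<p. S N a b * h b) = 0" and a: "a < p"
  shows "h a = 0"
proof -
  have "(\<Sum>a<p. \<Sum>b<p. h a * S N a b * h b) = (\<Sum>a<p. h a * (\<Sum>b<p. S N a b * h b))"
    by (simp add: sum_distrib_left mult.assoc)
  also have "\<dots> = 0" using ker by simp
  finally have "q N h = 0" using coercive[of h] q_nonneg[of N h] by simp
  then show "h a = 0" using coordinate_bound[OF N a, of h] by simp
qed

lemma normal_equation_solution:
  fixes r :: nat
  assumes N: "n0 \<le> N" and coercive: "\<And>h. q N h / 2 \<le> (\<Sum>a<p. \<Sum>b<p. h a * S N a b * h b)"
  shows "\<exists>H. \<forall>b<r. \<forall>d<p. (\<Sum>a<p. H b a * S N a d) = Y b d"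
proof -
  define Sm where "Sm = mat p p (\<lambda>(a, b). S N a b)"
  define Ym where "Ym = mat r p (\<lambda>(b, d). Y b d)"
  have Sm: "Sm \<in> carrier_mat p p" and Ym: "Ym \<in> carrier_mat r p" by (simp_all add: Sm_def Ym_def)
  have "det Sm \<noteq> 0"
  proof
    assume "det Sm = 0"
    then obtain v where v: "v \<in> carrier_vec p" "v \<noteq> 0\<^sub>v p" "Sm *\<^sub>v v = 0\<^sub>v p"
      using det_0_iff_vec_prod_zero_field[OF Sm] by blast
    have "(\<Sum>b<p. S N a b * v $ b) = 0" if "a < p" for a
    proof -
      have "(Sm *\<^sub>v v) $ a = (\<Sum>b<p. S N a b * v $ b)"
        using that v(1) by (simp add: Sm_def scalar_prod_def lessThan_atLeast0)
      then show ?thesis using v(3) that by simp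
    qed
    from corrected_gram_injective[OF N coercive this] have "v $ a = 0" if "a < p" for a using that by blast
    then have "v = 0\<^sub>v p" using v(1) by (intro eq_vecI) auto
    with v(2) show False by simp
  qed
  note inv = pinv_nonsingular(2)[OF Sm this]
  have P: "pinv Sm \<in> carrier_mat p p" using Sm by simp
  define Hm where "Hm = Ym * pinv Sm"
  have Hm: "Hm \<in> carrier_mat r p" unfolding Hm_def by (rule mult_carrier_mat[OF Ym P])
  have HS: "Hm * Sm = Ym"
    using assoc_mult_mat[OF Ym P Sm] Ym unfolding Hm_def inv by simp
  have "(\<Sum>a<p. Hm $$ (b, a) * S N a d) = Y b d" if "b < r" "d < p" for b d
  proof -
    have "(Hm * Sm) $$ (b, d) = (\<Sum>a<p. Hm $$ (b, a) * S N a d)"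
      using that carrier_matD[OF Hm] by (simp add: Sm_def scalar_prod_def lessThan_atLeast0)
    then show ?thesis unfolding HS using that by (simp add: Ym_def)
  qed
  then show ?thesis by (intro exI[of _ "\<lambda>b a. Hm $$ (b, a)"]) simp
qed

lemma schur_est_normal_equation:
  fixes Y :: "nat \<Rightarrow> nat \<Rightarrow> real"
  assumes p: "p = n + k" and s: "\<And>a. a < n \<Longrightarrow> s a = \<sigma>1\<^sup>2" "\<And>a. a < k \<Longrightarrow> s (n + a) = \<sigma>2\<^sup>2"
    and N: "n0 \<le> N" and coercive: "\<And>h. q N h / 2 \<le> (\<Sum>a<p. \<Sum>b<p. h a * S N a b * h b)"
    and H: "\<And>b d. b < r \<Longrightarrow> d < p \<Longrightarrow> (\<Sum>a<p. H b a * S N a d) = (\<Sum>j<N. y b j * z d j)"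
    and Z1: "Z1 = mat n N (\<lambda>(a, j). z a j)" and Z2: "Z2 = mat k N (\<lambda>(a, j). z (n + a) j)"
    and R: "R = mat r N (\<lambda>(b, j). y b j)"
  shows "schur_est \<sigma>1 \<sigma>2 N Z1 Z2 R = mat r n (\<lambda>(b, a). H b a)" (is ?first)
    and "schur_est \<sigma>2 \<sigma>1 N Z2 Z1 R = mat r k (\<lambda>(b, a). H b (n + a))" (is ?second)
proof -
  define S11 where "S11 = Z1 * Z1\<^sup>T - (N * \<sigma>1\<^sup>2) \<cdot>\<^sub>m 1\<^sub>m n"
  define S22 where "S22 = Z2 * Z2\<^sup>T - (N * \<sigma>2\<^sup>2) \<cdot>\<^sub>m 1\<^sub>m k"
  define H1 where "H1 = mat r n (\<lambda>(b, a). H b a)"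
  define H2 where "H2 = mat r k (\<lambda>(b, a). H b (n + a))"
  have c: "Z1 \<in> carrier_mat n N" "Z2 \<in> carrier_mat k N" "R \<in> carrier_mat r N"
    "H1 \<in> carrier_mat r n" "H2 \<in> carrier_mat r k"
    by (simp_all add: Z1 Z2 R H1_def H2_def)
  have s11: "S11 = mat n n (\<lambda>(a, b). S N a b)"
    by (intro eq_matI) (auto simp: S11_def Z1 S_def scalar_prod_def lessThan_atLeast0 s)
  have s22: "S22 = mat k k (\<lambda>(a, b). S N (n + a) (n + b))"
    by (intro eq_matI) (auto simp: S22_def Z2 S_def scalar_prod_def lessThan_atLeast0 s)
  have s12: "Z1 * Z2\<^sup>T = mat n k (\<lambda>(a, b). S N a (n + b))"
    by (intro eq_matI) (auto simp: Z1 Z2 S_def scalar_prod_def lessThan_atLeast0)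
  have s21: "Z2 * Z1\<^sup>T = mat k n (\<lambda>(a, b). S N (n + a) b)"
    by (intro eq_matI) (auto simp: Z1 Z2 S_def scalar_prod_def lessThan_atLeast0)
  have e1: "H1 * S11 + H2 * (Z2 * Z1\<^sup>T) = R * Z1\<^sup>T"
  proof (rule eq_matI)
    fix b d assume "b < dim_row (R * Z1\<^sup>T)" "d < dim_col (R * Z1\<^sup>T)"
    then have bd: "b < r" "d < n" by (simp_all add: R Z1)
    then have "(H1 * S11 + H2 * (Z2 * Z1\<^sup>T)) $$ (b, d) = (\<Sum>a<p. H b a * S N a d)"
      unfolding s11 s21 p sum_lessThan_add_split
      by (simp add: H1_def H2_def scalar_prod_def lessThan_atLeast0)
    also have "\<dots> = (R * Z1\<^sup>T) $$ (b, d)"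
      using bd H[of b d] by (simp add: p R Z1 scalar_prod_def lessThan_atLeast0)
    finally show "(H1 * S11 + H2 * (Z2 * Z1\<^sup>T)) $$ (b, d) = (R * Z1\<^sup>T) $$ (b, d)" .
  qed (simp_all add: s11 s21, simp_all add: H2_def R Z1)
  have e2: "H1 * (Z1 * Z2\<^sup>T) + H2 * S22 = R * Z2\<^sup>T"
  proof (rule eq_matI)
    fix b d assume "b < dim_row (R * Z2\<^sup>T)" "d < dim_col (R * Z2\<^sup>T)"
    then have bd: "b < r" "d < k" by (simp_all add: R Z2)
    then have "(H1 * (Z1 * Z2\<^sup>T) + H2 * S22) $$ (b, d) = (\<Sum>a<p. H b a * S N a (n + d))"
      unfolding s12 s22 p sum_lessThan_add_split
      by (simp add: H1_def H2_def scalar_prod_def lessThan_atLeast0)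
    also have "\<dots> = (R * Z2\<^sup>T) $$ (b, d)"
      using bd H[of b "n + d"] by (simp add: p R Z2 scalar_prod_def lessThan_atLeast0)
    finally show "(H1 * (Z1 * Z2\<^sup>T) + H2 * S22) $$ (b, d) = (R * Z2\<^sup>T) $$ (b, d)" .
  qed (simp_all add: s12 s22, simp_all add: H2_def R Z2)
  have inj: "u = 0\<^sub>v n \<and> v = 0\<^sub>v k" if u: "u \<in> carrier_vec n" and v: "v \<in> carrier_vec k"
    and 1: "S11 *\<^sub>v u + (Z1 * Z2\<^sup>T) *\<^sub>v v = 0\<^sub>v n" and 2: "(Z2 * Z1\<^sup>T) *\<^sub>v u + S22 *\<^sub>v v = 0\<^sub>v k" for u v
  proof -
    define h where "h a = (if a < n then u $ a else v $ (a - n))" for a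
    have "(\<Sum>b<p. S N a b * h b) = 0" if a: "a < p" for a
    proof (cases "a < n")
      case True
      then have "(\<Sum>b<p. S N a b * h b) = (S11 *\<^sub>v u + (Z1 * Z2\<^sup>T) *\<^sub>v v) $ a"
        unfolding p sum_lessThan_add_split s11 s12
        using u v by (simp add: h_def scalar_prod_def lessThan_atLeast0)
      then show ?thesis unfolding 1 using True by simp
    next
      case False
      then obtain a' where a': "a = n + a'" "a' < k" using a p by (metis add_less_cancel_left le_Suc_ex linorder_not_less)
      then have "(\<Sum>b<p. S N a b * h b) = ((Z2 * Z1\<^sup>T) *\<^sub>v u + S22 *\<^sub>v v) $ a'"
        unfolding p sum_lessThan_add_split s22 s21
        using u v by (simp add: h_def scalar_prod_def lessThan_atLeast0)
      then show ?thesis unfolding 2 using a' by simp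
    qed
    from corrected_gram_injective[OF N coercive this] have h: "h a = 0" if "a < p" for a using that by blast
    have "u $ a = 0" if "a < n" for a using h[of a] that p by (simp add: h_def)
    moreover have "v $ a = 0" if "a < k" for a using h[of "n + a"] that p by (simp add: h_def)
    ultimately show ?thesis using u v by auto
  qed
  have c22: "S11 \<in> carrier_mat n n" "S22 \<in> carrier_mat k k" by (simp_all add: s11 s22)
  note z12 = mult_carrier_mat[OF c(1) transpose_carrier_mat[THEN iffD2, OF c(2)]]
    and z21 = mult_carrier_mat[OF c(2) transpose_carrier_mat[THEN iffD2, OF c(1)]]
  \<comment> \<open>A diagonal block of an injective matrix may be singular; coercivity, however,
    passes to the block by extending \<open>v\<close> with zeros.\<close>
  have qf22: "v = 0\<^sub>v k" if v: "v \<in> carrier_vec k" and e: "S22 *\<^sub>v v = 0\<^sub>v k" for v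
  proof -
    define h where "h a = (if a < n then 0 else v $ (a - n))" for a
    have "(\<Sum>b<k. S N (n + a) (n + b) * v $ b) = 0" if "a < k" for a
    proof -
      have "(S22 *\<^sub>v v) $ a = (\<Sum>b<k. S N (n + a) (n + b) * v $ b)"
        unfolding s22 using that v by (simp add: scalar_prod_def lessThan_atLeast0)
      then show ?thesis unfolding e using that by simp
    qed
    then have "(\<Sum>a<p. \<Sum>b<p. h a * S N a b * h b) = 0"
      unfolding p sum_lessThan_add_split by (simp add: h_def mult.assoc sum_distrib_left[symmetric])
    then have "q N h = 0" using coercive[of h] q_nonneg[of N h] by simp
    then have "h a = 0" if "a < p" for a using coordinate_bound[OF N that, of h] by simp
    from this[of "n + _"] show ?thesis using v p by (intro eq_vecI) (auto simp: h_def)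
  qed
  have qf11: "v = 0\<^sub>v n" if v: "v \<in> carrier_vec n" and e: "S11 *\<^sub>v v = 0\<^sub>v n" for v
  proof -
    define h where "h a = (if a < n then v $ a else 0)" for a
    have "(\<Sum>b<n. S N a b * v $ b) = 0" if "a < n" for a
    proof -
      have "(S11 *\<^sub>v v) $ a = (\<Sum>b<n. S N a b * v $ b)"
        unfolding s11 using that v by (simp add: scalar_prod_def lessThan_atLeast0)
      then show ?thesis unfolding e using that by simp
    qed
    then have "(\<Sum>a<p. \<Sum>b<p. h a * S N a b * h b) = 0"
      unfolding p sum_lessThan_add_split by (simp add: h_def mult.assoc sum_distrib_left[symmetric])
    then have "q N h = 0" using coercive[of h] q_nonneg[of N h] by simp
    then have h0: "h a = 0" if "a < p" for a using coordinate_bound[OF N that, of h] by simp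
    have "v $ a = 0" if "a < n" for a using h0[of a] that p by (simp add: h_def)
    then show ?thesis using v by (intro eq_vecI) auto
  qed
  show ?first unfolding H1_def[symmetric]
    by (rule schur_est_eq[OF c(1-3) S11_def S22_def c(4,5) e1 e2 _ qf22]) (use inj in blast)
  show ?second unfolding H2_def[symmetric]
  proof (rule schur_est_eq[OF c(2,1,3) S22_def S11_def c(5,4) _ _ _ qf11])
    note m = mult_carrier_mat[OF c(4) c22(1)] mult_carrier_mat[OF c(5) z21]
      mult_carrier_mat[OF c(4) z12] mult_carrier_mat[OF c(5) c22(2)]
    show "H2 * S22 + H1 * (Z1 * Z2\<^sup>T) = R * Z2\<^sup>T" using e2 comm_add_mat[OF m(3,4)] by simp
    show "H2 * (Z2 * Z1\<^sup>T) + H1 * S11 = R * Z1\<^sup>T" using e1 comm_add_mat[OF m(1,2)] by simp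
    fix u v :: "real vec" assume uv: "u \<in> carrier_vec k" "v \<in> carrier_vec n"
      and "S22 *\<^sub>v u + (Z2 * Z1\<^sup>T) *\<^sub>v v = 0\<^sub>v k" "(Z1 * Z2\<^sup>T) *\<^sub>v u + S11 *\<^sub>v v = 0\<^sub>v n"
    then have "S11 *\<^sub>v v + (Z1 * Z2\<^sup>T) *\<^sub>v u = 0\<^sub>v n" "(Z2 * Z1\<^sup>T) *\<^sub>v v + S22 *\<^sub>v u = 0\<^sub>v k"
      using comm_add_vec[OF mult_mat_vec_carrier[OF c22(1) uv(2)] mult_mat_vec_carrier[OF z12 uv(1)]]
        comm_add_vec[OF mult_mat_vec_carrier[OF z21 uv(2)] mult_mat_vec_carrier[OF c22(2) uv(1)]] by simp_all
    from inj[OF uv(2,1) this] show "u = 0\<^sub>v k" by simp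
  qed
qed

end


text \<open>The rows of the response share the regressors and hence \<open>q\<close>,
  \<open>S\<close> and \<open>z\<close>, so one interpretation, for row 0, provides these for all
  rows. Solutions \<open>H N\<close> are chosen only where \<open>S\<close> is coercive, that is,
  eventually.\<close>

lemma schur_est_consistent:
  fixes f :: "nat \<Rightarrow> nat \<Rightarrow> real"
  assumes reg: "\<And>b. b < r \<Longrightarrow> noisy_regression p n0 c zb w (e b) s V (Ve b)" and r: "0 < r"
    and p: "p = n + k" and s: "\<And>a. a < n \<Longrightarrow> s a = \<sigma>1\<^sup>2" "\<And>a. a < k \<Longrightarrow> s (n + a) = \<sigma>2\<^sup>2"
    and Z1: "\<And>N. Z1 N = mat n N (\<lambda>(a, j). zb a j + w a j)"
    and Z2: "\<And>N. Z2 N = mat k N (\<lambda>(a, j). zb (n + a) j + w (n + a) j)"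
    and X: "\<And>N. X N = mat r N (\<lambda>(b, j). (\<Sum>a<p. f b a * zb a j) + e b j)"
  shows "mat_tendsto (\<lambda>N. schur_est \<sigma>1 \<sigma>2 N (Z1 N) (Z2 N) (X N)) (mat r n (\<lambda>(b, a). f b a))" (is ?first)
    and "mat_tendsto (\<lambda>N. schur_est \<sigma>2 \<sigma>1 N (Z2 N) (Z1 N) (X N)) (mat r k (\<lambda>(b, a). f b (n + a)))" (is ?second)
proof -
  interpret R: noisy_regression p n0 c zb w "e 0" "f 0" s V "Ve 0" by (rule reg[OF r])
  define ok where "ok N \<longleftrightarrow> n0 \<le> N \<and> (\<forall>h. R.q N h / 2 \<le> (\<Sum>a<p. \<Sum>b<p. h a * R.S N a b * h b))" for N
  have ev: "\<forall>\<^sub>F N in sequentially. ok N"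
    unfolding ok_def using R.corrected_gram_coercive eventually_ge_at_top[of n0] by eventually_elim simp
  define y where "y b j = (\<Sum>a<p. f b a * zb a j) + e b j" for b j
  have "\<forall>N. \<exists>H. ok N \<longrightarrow> (\<forall>b<r. \<forall>d<p. (\<Sum>a<p. H b a * R.S N a d) = (\<Sum>j<N. y b j * R.z d j))"
  proof
    fix N
    show "\<exists>H. ok N \<longrightarrow> (\<forall>b<r. \<forall>d<p. (\<Sum>a<p. H b a * R.S N a d) = (\<Sum>j<N. y b j * R.z d j))"
    proof (cases "ok N")
      case True
      then have "n0 \<le> N" "\<And>h. R.q N h / 2 \<le> (\<Sum>a<p. \<Sum>b<p. h a * R.S N a b * h b)"
        by (auto simp: ok_def)
      from R.normal_equation_solution[OF this, of r "\<lambda>b d. \<Sum>j<N. y b j * R.z d j"] show ?thesis by simp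
    qed simp
  qed
  from choice[OF this] obtain H where H: "\<forall>N. ok N \<longrightarrow>
      (\<forall>b<r. \<forall>d<p. (\<Sum>a<p. H N b a * R.S N a d) = (\<Sum>j<N. y b j * R.z d j))" ..
  have lim: "(\<lambda>N. H N b i) \<longlonglongrightarrow> f b i" if "b < r" "i < p" for b i
  proof (rule noisy_regression.estimator_consistent[OF reg[OF that(1)] _ that(2)])
    show "\<forall>\<^sub>F N in sequentially. \<forall>d<p. (\<Sum>a<p. H N b a * R.S N a d)
        = (\<Sum>j<N. ((\<Sum>a<p. f b a * zb a j) + e b j) * R.z d j)"
      using ev by eventually_elim (use H that(1) in \<open>simp add: y_def\<close>)
  qed
  have Z1': "Z1 N = mat n N (\<lambda>(a, j). R.z a j)" and Z2': "Z2 N = mat k N (\<lambda>(a, j). R.z (n + a) j)"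
    and X': "X N = mat r N (\<lambda>(b, j). y b j)" for N
    by (simp_all add: Z1 Z2 X R.z_def y_def)
  have car: "Z1 N \<in> carrier_mat n N" "Z2 N \<in> carrier_mat k N" "X N \<in> carrier_mat r N" for N
    by (simp_all add: Z1 Z2 X)
  have eq: "schur_est \<sigma>1 \<sigma>2 N (Z1 N) (Z2 N) (X N) = mat r n (\<lambda>(b, a). H N b a)"
    "schur_est \<sigma>2 \<sigma>1 N (Z2 N) (Z1 N) (X N) = mat r k (\<lambda>(b, a). H N b (n + a))" if N: "ok N" for N
  proof -
    have a: "n0 \<le> N" "\<And>h. R.q N h / 2 \<le> (\<Sum>a<p. \<Sum>b<p. h a * R.S N a b * h b)"
      "\<And>b d. b < r \<Longrightarrow> d < p \<Longrightarrow> (\<Sum>a<p. H N b a * R.S N a d) = (\<Sum>j<N. y b j * R.z d j)"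
      using N H unfolding ok_def by blast+
    show "schur_est \<sigma>1 \<sigma>2 N (Z1 N) (Z2 N) (X N) = mat r n (\<lambda>(b, a). H N b a)"
      by (rule R.schur_est_normal_equation(1)[OF p s a Z1' Z2' X'])
    show "schur_est \<sigma>2 \<sigma>1 N (Z2 N) (Z1 N) (X N) = mat r k (\<lambda>(b, a). H N b (n + a))"
      by (rule R.schur_est_normal_equation(2)[OF p s a Z1' Z2' X'])
  qed
  show ?first
  proof (rule mat_tendsto_eventually_eq)
    show "mat_tendsto (\<lambda>N. mat r n (\<lambda>(b, a). H N b a)) (mat r n (\<lambda>(b, a). f b a))"
      by (rule mat_tendstoI[of _ r n]) (use lim p in auto)
    show "schur_est \<sigma>1 \<sigma>2 N (Z1 N) (Z2 N) (X N)
        \<in> carrier_mat (dim_row (mat r n (\<lambda>(b, a). f b a))) (dim_col (mat r n (\<lambda>(b, a). f b a)))" for N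
      using schur_est_carrier[OF car(3,2,1)] by simp
    show "\<forall>\<^sub>F N in sequentially. mat r n (\<lambda>(b, a). H N b a) = schur_est \<sigma>1 \<sigma>2 N (Z1 N) (Z2 N) (X N)"
      using ev by eventually_elim (simp add: eq)
  qed
  show ?second
  proof (rule mat_tendsto_eventually_eq)
    show "mat_tendsto (\<lambda>N. mat r k (\<lambda>(b, a). H N b (n + a))) (mat r k (\<lambda>(b, a). f b (n + a)))"
      by (rule mat_tendstoI[of _ r k]) (use lim p in auto)
    show "schur_est \<sigma>2 \<sigma>1 N (Z2 N) (Z1 N) (X N)
        \<in> carrier_mat (dim_row (mat r k (\<lambda>(b, a). f b (n + a)))) (dim_col (mat r k (\<lambda>(b, a). f b (n + a))))" for N
      using schur_est_carrier[OF car(3,1,2)] by simp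
    show "\<forall>\<^sub>F N in sequentially. mat r k (\<lambda>(b, a). H N b (n + a)) = schur_est \<sigma>2 \<sigma>1 N (Z2 N) (Z1 N) (X N)"
      using ev by eventually_elim (simp add: eq)
  qed
qed

section \<open>From the experiments to the regression\<close>

lemma (in prob_space) noise_family_of_experiment:
  assumes ind: "mutually_indep_entries M q n WU WX0 WX"
    and U: "centred_iid_entries M q \<sigma>U WU" and X0: "centred_iid_entries M n \<sigma>X0 WX0"
    and X: "centred_iid_entries M n \<sigma>X WX"
  shows "noise_family M
     (\<lambda>i. if i < n then WX0 i else if i < n + q then WU (i - n) else WX (i - (n + q))) {..<n + q + n}
     (\<lambda>i. if i < n then \<sigma>X0\<^sup>2 else if i < n + q then \<sigma>U\<^sup>2 else \<sigma>X\<^sup>2)"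
    (is "noise_family M ?W ?I ?v")
proof -
  \<comment> \<open>The rows are numbered in the order initial state, input, final state: the first
    \<open>n + q\<close> are the errors in the stacked regressors, the last \<open>n\<close> the
    errors in the response.\<close>
  define g where "g = (\<lambda>(i, j :: nat). if i < n then (Initial, i, j)
     else if i < n + q then (Input, i - n, j) else (Final, i - (n + q), j))"
  let ?X = "\<lambda>(b, r, j). case b of Input \<Rightarrow> WU r j | Initial \<Rightarrow> WX0 r j | Final \<Rightarrow> WX r j"
  have "indep_vars (\<lambda>_. borel) (\<lambda>ij. ?X (g ij)) (?I \<times> UNIV)"
  proof (rule indep_vars_inj_reindex)
    show "indep_vars (\<lambda>_. borel) ?X {(b, r, j). r < (case b of Input \<Rightarrow> q | Initial \<Rightarrow> n | Final \<Rightarrow> n)}"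
      using ind by (simp add: mutually_indep_entries_def)
    show "inj_on g (?I \<times> UNIV)"
      by (auto simp: inj_on_def g_def split: if_splits)
    show "g ` (?I \<times> UNIV) \<subseteq> {(b, r, j). r < (case b of Input \<Rightarrow> q | Initial \<Rightarrow> n | Final \<Rightarrow> n)}"
      by (auto simp: g_def split: if_splits)
  qed
  moreover have "(\<lambda>ij. ?X (g ij)) = (\<lambda>(i, j). ?W i j)"
    by (auto simp: g_def fun_eq_iff)
  ultimately have indep: "indep_vars (\<lambda>_. borel) (\<lambda>(i, j). ?W i j) (?I \<times> UNIV)" by simp
  have row: "integrable M (W r j) \<and> expectation (W r j) = 0 \<and> integrable M (\<lambda>x. (W r j x)\<^sup>2)
      \<and> expectation (\<lambda>x. (W r j x)\<^sup>2) = \<sigma>\<^sup>2 \<and> distr M borel (W r j) = distr M borel (W r 0)"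
    if "centred_iid_entries M d \<sigma> W" "r < d" for W d \<sigma> r j
    using that unfolding centred_iid_entries_def by blast
  have all: "integrable M (?W i j) \<and> expectation (?W i j) = 0 \<and> integrable M (\<lambda>x. (?W i j x)\<^sup>2)
      \<and> expectation (\<lambda>x. (?W i j x)\<^sup>2) = ?v i \<and> distr M borel (?W i j) = distr M borel (?W i 0)"
    if "i \<in> ?I" for i j
  proof -
    consider "i < n" | "\<not> i < n" "i < n + q" | "\<not> i < n" "\<not> i < n + q" by blast
    then show ?thesis
    proof cases
      case 1
      then show ?thesis using row[OF X0, of i j] by simp
    next
      case 2
      then show ?thesis using row[OF U, of "i - n" j] by simp
    next
      case 3
      then have "i - (n + q) < n" using that by auto
      with 3 show ?thesis using row[OF X, of "i - (n + q)" j] by simp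
    qed
  qed
  show ?thesis
    by unfold_locales (use indep all in blast)+
qed

text \<open>The quotient is cleared of \<open>N\<close>, which is why the threshold is at least
  1.\<close>

lemma persistent_excitation:
  assumes pe: "persistent_full_row_rank (\<lambda>N. data_mat n x0b N @\<^sub>r data_mat q ub N) (n + q)"
  obtains c n0 where "0 < c" "0 < n0"
    "\<And>N h. n0 \<le> N \<Longrightarrow> c * N * (\<Sum>a<n + q. (h a)\<^sup>2)
      \<le> (\<Sum>j<N. (\<Sum>a<n + q. h a * (if a < n then x0b j $ a else ub j $ (a - n)))\<^sup>2)"
proof -
  let ?Z = "\<lambda>N. data_mat n x0b N @\<^sub>r data_mat q ub N"
  obtain c n1 where c: "0 < c" and n1: "\<And>N v. n1 \<le> N \<Longrightarrow> v \<in> carrier_vec (n + q) \<Longrightarrow>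
      c * (v \<bullet> v) \<le> (((?Z N)\<^sup>T *\<^sub>v v) \<bullet> ((?Z N)\<^sup>T *\<^sub>v v)) / real N"
    using pe unfolding persistent_full_row_rank_def eventually_sequentially by blast
  have "c * N * (\<Sum>a<n + q. (h a)\<^sup>2)
      \<le> (\<Sum>j<N. (\<Sum>a<n + q. h a * (if a < n then x0b j $ a else ub j $ (a - n)))\<^sup>2)"
    if N: "max 1 n1 \<le> N" for N h
  proof -
    define v where "v = vec (n + q) h"
    have v: "v \<in> carrier_vec (n + q)" by (simp add: v_def)
    have Z: "?Z N = mat (n + q) N (\<lambda>(a, j). if a < n then x0b j $ a else ub j $ (a - n))"
      by (intro eq_matI) (auto simp: append_rows_def data_mat_def)
    have e: "((?Z N)\<^sup>T *\<^sub>v v) $ j = (\<Sum>a<n + q. h a * (if a < n then x0b j $ a else ub j $ (a - n)))"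
      if "j < N" for j
      unfolding Z using that by (simp add: v_def scalar_prod_def lessThan_atLeast0 mult.commute)
    have d: "dim_vec ((?Z N)\<^sup>T *\<^sub>v v) = N" unfolding Z by simp
    have "((?Z N)\<^sup>T *\<^sub>v v) \<bullet> ((?Z N)\<^sup>T *\<^sub>v v)
        = (\<Sum>j<N. (\<Sum>a<n + q. h a * (if a < n then x0b j $ a else ub j $ (a - n)))\<^sup>2)"
      unfolding scalar_prod_def d lessThan_atLeast0[symmetric] power2_eq_square using e by (intro sum.cong) auto
    moreover have "v \<bullet> v = (\<Sum>a<n + q. (h a)\<^sup>2)"
      by (simp add: v_def scalar_prod_def lessThan_atLeast0 power2_eq_square)
    ultimately show ?thesis using n1[OF _ v, of N] N by (simp add: le_divide_eq mult_ac)
  qed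
  with that[of c "max 1 n1"] c show thesis by simp
qed

text \<open>Row \<open>b\<close> of the final states is a regression whose coefficients are row
  \<open>b\<close> of \<open>A ^\<^sub>m h\<close> followed by row \<open>b\<close> of
  \<open>ctrb A B h\<close>. Only finitely many noise rows occur, so their exceptional null sets can
  be collected.\<close>

lemma experiment_AE_consistent:
  fixes A B :: "real mat" and P :: "'w measure"
  assumes prob: "prob_space P" and n: "0 < n" and A: "A \<in> carrier_mat n n" and B: "B \<in> carrier_mat n m"
    and ub: "\<And>j. ub j \<in> carrier_vec (m * h)" and x0b: "\<And>j. x0b j \<in> carrier_vec n"
    and xb: "\<And>j. xb j = final_state A B h (x0b j) (ub j)"
    and ind: "mutually_indep_entries P (m * h) n WU WX0 WX"
    and U: "centred_iid_entries P (m * h) \<sigma>U WU" and X0: "centred_iid_entries P n \<sigma>X0 WX0"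
    and X: "centred_iid_entries P n \<sigma>X WX"
    and pe: "persistent_full_row_rank (\<lambda>N. data_mat n x0b N @\<^sub>r data_mat (m * h) ub N) (n + m * h)"
  shows "AE \<omega> in P.
    mat_tendsto (\<lambda>N. Qc \<sigma>U \<sigma>X0 N (data_mat (m * h) ub N + noise_mat (m * h) WU N \<omega>)
      (data_mat n x0b N + noise_mat n WX0 N \<omega>) (data_mat n xb N + noise_mat n WX N \<omega>)) (A ^\<^sub>m h) \<and>
    mat_tendsto (\<lambda>N. Lc \<sigma>U \<sigma>X0 N (data_mat (m * h) ub N + noise_mat (m * h) WU N \<omega>)
      (data_mat n x0b N + noise_mat n WX0 N \<omega>) (data_mat n xb N + noise_mat n WX N \<omega>)) (ctrb A B h)"
proof -
  interpret prob_space P by (rule prob)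
  define q where "q = m * h"
  define p where "p = n + q"
  define W where "W i = (if i < n then WX0 i else if i < n + q then WU (i - n) else WX (i - (n + q)))" for i
  define s where "s i = (if i < n then \<sigma>X0\<^sup>2 else if i < n + q then \<sigma>U\<^sup>2 else \<sigma>X\<^sup>2)" for i
  define zb where "zb a j = (if a < n then x0b j $ a else ub j $ (a - n))" for a j
  define f where "f b a = (if a < n then (A ^\<^sub>m h) $$ (b, a) else ctrb A B h $$ (b, a - n))" for b a
  interpret noise_family P W "{..<n + q + n}" s
    unfolding W_def[abs_def] s_def[abs_def] q_def by (rule noise_family_of_experiment[OF ind U X0 X])
  obtain c n0 where c: "0 < c" and n0: "0 < n0"
    and exc: "\<And>N h. n0 \<le> N \<Longrightarrow> c * N * (\<Sum>a<p. (h a)\<^sup>2) \<le> (\<Sum>j<N. (\<Sum>a<p. h a * zb a j)\<^sup>2)"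
    using persistent_excitation[OF pe] unfolding p_def q_def zb_def by blast
  have pd: "\<forall>a<p. g a = 0" if N: "n0 \<le> N" and z: "(\<Sum>j<N. (\<Sum>a<p. g a * zb a j)\<^sup>2) = 0" for N g
  proof -
    have "c * N * (\<Sum>a<p. (g a)\<^sup>2) \<le> c * N * 0" using exc[OF N, of g] z by simp
    moreover have "0 < c * N" using c n0 N by simp
    ultimately have "(\<Sum>a<p. (g a)\<^sup>2) \<le> 0" by (simp only: mult_le_cancel_left_pos)
    then have "(\<Sum>a<p. (g a)\<^sup>2) = 0" by (intro antisym sum_nonneg) auto
    then show ?thesis by (simp add: sum_nonneg_eq_0_iff)
  qed
  have AE1: "AE \<omega> in P. \<forall>i\<in>{..<n + q + n}. \<forall>i'\<in>{..<n + q + n}.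
      (\<lambda>N. (\<Sum>j<N. W i j \<omega> * W i' j \<omega>) / N) \<longlonglongrightarrow> (if i = i' then s i else 0)"
    using AE_average_squares AE_average_products
    by (auto simp: AE_finite_all power2_eq_square)
  have AE2: "AE \<omega> in P. \<forall>i\<in>{..<n + q + n}. \<exists>V. (\<forall>N. 0 \<le> V N) \<and> (\<lambda>N. V N / N) \<longlonglongrightarrow> 0 \<and>
    (\<forall>N g. n0 \<le> N \<longrightarrow>
      (\<Sum>b<p. g b * (\<Sum>j<N. zb b j * W i j \<omega>))\<^sup>2 \<le> (\<Sum>j<N. (\<Sum>b<p. g b * zb b j)\<^sup>2) * V N)"
    using AE_projection_sublinear[where z = zb and p = p, OF _ pd] by (simp add: AE_finite_all)
  from AE1 AE2 show ?thesis
  proof eventually_elim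
    case (elim \<omega>)
    from bchoice[OF elim(2)] obtain VV where VV: "\<forall>i\<in>{..<n + q + n}. (\<forall>N. 0 \<le> VV i N) \<and>
      (\<lambda>N. VV i N / N) \<longlonglongrightarrow> 0 \<and> (\<forall>N g. n0 \<le> N \<longrightarrow>
      (\<Sum>b<p. g b * (\<Sum>j<N. zb b j * W i j \<omega>))\<^sup>2 \<le> (\<Sum>j<N. (\<Sum>b<p. g b * zb b j)\<^sup>2) * VV i N)" ..
    \<comment> \<open>The regression model asks for nonnegative \<open>V\<close> at every index, but
      the witnesses are controlled only for the rows of the family; elsewhere 0 is used.\<close>
    have reg: "noisy_regression p n0 c zb (\<lambda>a j. W a j \<omega>) (\<lambda>j. W (p + b) j \<omega>) s
        (\<lambda>a. if a < p then VV a else (\<lambda>_. 0)) (VV (p + b))" if "b < n" for b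
    proof
      show "0 < c" "0 < n0" by (rule c, rule n0)
      show "c * N * (\<Sum>a<p. (h a)\<^sup>2) \<le> (\<Sum>j<N. (\<Sum>a<p. h a * zb a j)\<^sup>2)" if "n0 \<le> N" for N h
        by (rule exc[OF that])
      show "(\<lambda>N. (\<Sum>j<N. W (p + b) j \<omega> * W b' j \<omega>) / N) \<longlonglongrightarrow> 0" if "b' < p" for b'
        using elim(1)[rule_format, of "p + b" b'] that \<open>b < n\<close> by (simp add: p_def)
    qed (use VV elim(1) that in \<open>auto simp: p_def\<close>)
    let ?U = "\<lambda>N. data_mat (m * h) ub N + noise_mat (m * h) WU N \<omega>"
    let ?Xini = "\<lambda>N. data_mat n x0b N + noise_mat n WX0 N \<omega>"
    let ?X = "\<lambda>N. data_mat n xb N + noise_mat n WX N \<omega>"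
    have s1: "s a = \<sigma>X0\<^sup>2" if "a < n" for a using that by (simp add: s_def)
    have s2: "s (n + a) = \<sigma>U\<^sup>2" if "a < q" for a using that by (simp add: s_def)
    have X0': "?Xini N = mat n N (\<lambda>(a, j). zb a j + W a j \<omega>)" for N
      by (intro eq_matI) (auto simp: data_mat_def noise_mat_def zb_def W_def)
    have U': "?U N = mat q N (\<lambda>(a, j). zb (n + a) j + W (n + a) j \<omega>)" for N
      by (intro eq_matI) (auto simp: data_mat_def noise_mat_def zb_def W_def q_def)
    have xb': "xb j $ b = (\<Sum>a<p. f b a * zb a j)" if b: "b < n" for b j
    proof -
      have "xb j = A ^\<^sub>m h *\<^sub>v x0b j + ctrb A B h *\<^sub>v ub j"
        unfolding xb by (rule final_state_eq[OF A B x0b ub])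
      then show ?thesis
        unfolding p_def sum_lessThan_add_split
        using b carrier_matD[OF pow_carrier_mat[OF A, of h]] carrier_matD[OF ctrb_carrier[OF A B, of h]]
          carrier_vecD[OF x0b[of j]] carrier_vecD[OF ub[of j]] A
        by (simp add: f_def zb_def q_def scalar_prod_def lessThan_atLeast0)
    qed
    have X': "?X N = mat n N (\<lambda>(b, j). (\<Sum>a<p. f b a * zb a j) + W (p + b) j \<omega>)" for N
      by (intro eq_matI) (auto simp: data_mat_def noise_mat_def xb' W_def p_def)
    have t1: "mat n n (\<lambda>(b, a). f b a) = A ^\<^sub>m h"
      using carrier_matD[OF pow_carrier_mat[OF A, of h]] by (intro eq_matI) (auto simp: f_def)
    have t2: "mat n q (\<lambda>(b, a). f b (n + a)) = ctrb A B h"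
      using carrier_matD[OF ctrb_carrier[OF A B, of h]] by (intro eq_matI) (auto simp: f_def q_def)
    show ?case
      using schur_est_consistent[OF reg n p_def s1 s2 X0' U' X'] unfolding t1 t2
      by (simp add: Qc_eq_schur_est Lc_eq_schur_est)
  qed
qed

theorem theorem5p1:
  fixes A B :: "real mat" and n m T M l :: nat
    and Th k :: "nat \<Rightarrow> nat"
    and x0 xf :: "real vec"
    and ubar x0bar xbar :: "nat \<Rightarrow> nat \<Rightarrow> real vec"
    and Ubar X0bar Xbar :: "nat \<Rightarrow> nat \<Rightarrow> real mat"
    and P :: "'w measure"
    and WU WX0 WX :: "nat \<Rightarrow> nat \<Rightarrow> nat \<Rightarrow> 'w \<Rightarrow> real"
    and \<sigma>U \<sigma>X0 \<sigma>X :: real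
    and U X0 X :: "nat \<Rightarrow> nat \<Rightarrow> 'w \<Rightarrow> real mat"
    and Q L :: "nat \<Rightarrow> 'w \<Rightarrow> nat \<Rightarrow> real mat"
  assumes dims: "0 < n" "0 < m" "A \<in> carrier_mat n n" "B \<in> carrier_mat n m"
    and horizons: "inj_on Th {1..M}" "\<And>i. i \<in> {1..M} \<Longrightarrow> 1 \<le> Th i"
    and T: "1 \<le> T" "\<And>i. i \<in> {1..l} \<Longrightarrow> k i \<in> {1..M}" "(\<Sum>i = 1..l. Th (k i)) = T"
    and endpoints: "x0 \<in> carrier_vec n" "xf \<in> carrier_vec n" "reachable A B T x0 xf"
    and true_experiments:
      "\<And>i j. i \<in> {1..M} \<Longrightarrow> ubar i j \<in> carrier_vec (m * Th i)"
      "\<And>i j. i \<in> {1..M} \<Longrightarrow> x0bar i j \<in> carrier_vec n"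
      "\<And>i j. i \<in> {1..M} \<Longrightarrow> xbar i j = final_state A B (Th i) (x0bar i j) (ubar i j)"
    and true_data:
      "\<And>i N. Ubar i N = data_mat (m * Th i) (ubar i) N"
      "\<And>i N. X0bar i N = data_mat n (x0bar i) N"
      "\<And>i N. Xbar i N = data_mat n (xbar i) N"
    and prob: "prob_space P"
    and noise:
      "\<And>i. i \<in> {1..M} \<Longrightarrow> mutually_indep_entries P (m * Th i) n (WU i) (WX0 i) (WX i)"
      "\<And>i. i \<in> {1..M} \<Longrightarrow> centred_iid_entries P (m * Th i) \<sigma>U (WU i)"
      "\<And>i. i \<in> {1..M} \<Longrightarrow> centred_iid_entries P n \<sigma>X0 (WX0 i)"
      "\<And>i. i \<in> {1..M} \<Longrightarrow> centred_iid_entries P n \<sigma>X (WX i)"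
    and noisy_data:
      "\<And>i N \<omega>. U i N \<omega> = Ubar i N + noise_mat (m * Th i) (WU i) N \<omega>"
      "\<And>i N \<omega>. X0 i N \<omega> = X0bar i N + noise_mat n (WX0 i) N \<omega>"
      "\<And>i N \<omega>. X i N \<omega> = Xbar i N + noise_mat n (WX i) N \<omega>"
    and full_row_rank:
      "\<And>i. i \<in> {1..l} \<Longrightarrow>
        \<forall>\<^sub>F N in sequentially. full_row_rank (X0bar (k i) N @\<^sub>r Ubar (k i) N)"
      \<comment> \<open>the rank condition persists in the normalised limit\<close>
      "\<And>i. i \<in> {1..l} \<Longrightarrow>
        persistent_full_row_rank (\<lambda>N. X0bar (k i) N @\<^sub>r Ubar (k i) N) (n + m * Th (k i))"
    \<comment> \<open>\<open>pinv\<close> is discontinuous at matrices that are not of full rank\<close>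
    and ctrb_full_rank: "vec_space.rank n (ctrb A B T) = min n (m * T)"
    and estimators:
      "\<And>N \<omega> i. Q N \<omega> i = Qc \<sigma>U \<sigma>X0 N (U (k i) N \<omega>) (X0 (k i) N \<omega>) (X (k i) N \<omega>)"
      "\<And>N \<omega> i. L N \<omega> i = Lc \<sigma>U \<sigma>X0 N (U (k i) N \<omega>) (X0 (k i) N \<omega>) (X (k i) N \<omega>)"
  shows "\<exists>u_star. is_min_energy_control A B T x0 xf u_star
           \<and> (AE \<omega> in P. vec_tendsto (\<lambda>N. control_est n (Q N \<omega>) (L N \<omega>) l x0 xf) u_star)"
proof (intro exI conjI)
  note A = dims(3) and B = dims(4)
  let ?C = "ctrb A B T" and ?t = "\<lambda>i. Th (k i)"
  show "is_min_energy_control A B T x0 xf (pinv ?C *\<^sub>v (xf - A ^\<^sub>m T *\<^sub>v x0))"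
    by (rule pinv_min_energy[OF A B endpoints])
  have "AE \<omega> in P. \<forall>i\<in>{1..l}. mat_tendsto (\<lambda>N. Q N \<omega> i) (A ^\<^sub>m ?t i) \<and> mat_tendsto (\<lambda>N. L N \<omega> i) (ctrb A B (?t i))"
  proof (subst AE_finite_all, simp, rule ballI)
    fix i assume i: "i \<in> {1..l}"
    note ki = T(2)[OF i]
    show "AE \<omega> in P. mat_tendsto (\<lambda>N. Q N \<omega> i) (A ^\<^sub>m ?t i) \<and> mat_tendsto (\<lambda>N. L N \<omega> i) (ctrb A B (?t i))"
      unfolding estimators noisy_data true_data
      by (rule experiment_AE_consistent[OF prob dims(1) A B true_experiments(1)[OF ki] true_experiments(2)[OF ki]
            true_experiments(3)[OF ki] noise(1)[OF ki] noise(2)[OF ki] noise(3)[OF ki] noise(4)[OF ki]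
            full_row_rank(2)[OF i, unfolded true_data]])
  qed
  then show "AE \<omega> in P. vec_tendsto (\<lambda>N. control_est n (Q N \<omega>) (L N \<omega>) l x0 xf)
      (pinv ?C *\<^sub>v (xf - A ^\<^sub>m T *\<^sub>v x0))"
  proof eventually_elim
    case (elim \<omega>)
    define Q0 where "Q0 i = A ^\<^sub>m ?t i" for i
    define L0 where "L0 i = ctrb A B (?t i)" for i
    have Q: "mat_tendsto (\<lambda>N. Q N \<omega> i) (Q0 i)" "Q0 i \<in> carrier_mat n n"
      and L: "mat_tendsto (\<lambda>N. L N \<omega> i) (L0 i)" "L0 i \<in> carrier_mat n (m * ?t i)" if "i \<in> {1..l}" for i
      using elim that pow_carrier_mat[OF A] ctrb_carrier[OF A B] by (simp_all add: Q0_def L0_def)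
    have D: "mat_tendsto (\<lambda>N. desc_prod n (Q N \<omega>) i l) (desc_prod n Q0 i l)
        \<and> desc_prod n Q0 i l \<in> carrier_mat n n" if "1 \<le> i" for i
      unfolding desc_prod_def by (rule mat_tendsto_prod_mats) (use Q that in auto)
    have E: "mat_tendsto (\<lambda>N. ctrb_est n (Q N \<omega>) (L N \<omega>) l) (ctrb_est n Q0 L0 l)"
      unfolding ctrb_est_def
    proof (rule mat_tendsto_block_row[THEN conjunct1])
      fix i assume "i \<in> set (rev [1..<Suc l])"
      then have i: "i \<in> {1..l}" by auto
      note Di = D[of "Suc i"]
      show "mat_tendsto (\<lambda>N. desc_prod n (Q N \<omega>) (Suc i) l * L N \<omega> i) (desc_prod n Q0 (Suc i) l * L0 i)"
        using mat_tendsto_mult[OF Di[THEN conjunct1] L(1)[OF i] Di[THEN conjunct2] L(2)[OF i]] by simp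
      show "desc_prod n Q0 (Suc i) l * L0 i \<in> carrier_mat n (m * ?t i)"
        using mult_carrier_mat[OF Di[THEN conjunct2] L(2)[OF i]] by simp
    qed
    have E0: "ctrb_est n Q0 L0 l = ?C"
      using ctrb_est_exact[OF A B, of l Q0 ?t L0] T(3) by (simp add: Q0_def L0_def)
    have D0: "desc_prod n Q0 1 l = A ^\<^sub>m T"
      using desc_prod_pow[OF A B, of l Q0 ?t] T(3) by (simp add: Q0_def)
    have C: "?C \<in> carrier_mat n (m * T)" by (rule ctrb_carrier[OF A B])
    \<comment> \<open>The passage to the limit in the pseudoinverse rests on the full rank of the
      limit \<open>?C\<close>; everything else in the formula is built from products and block
      rows.\<close>
    have pinv: "mat_tendsto (\<lambda>N. pinv (ctrb_est n (Q N \<omega>) (L N \<omega>) l)) (pinv ?C)"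
      by (rule mat_tendsto_pinv[OF E[unfolded E0] C ctrb_full_rank])
    note AT = pow_carrier_mat[OF A, of T]
    have AT': "- (A ^\<^sub>m T) \<in> carrier_mat n n" using AT by simp
    have "mat_tendsto (\<lambda>N. - desc_prod n (Q N \<omega>) 1 l) (- (A ^\<^sub>m T))"
      using mat_tendsto_uminus[OF D[of 1, THEN conjunct1]] D0 by simp
    from mat_tendsto_append_cols[OF this mat_tendsto_const AT' one_carrier_mat[of n]]
    have R: "mat_tendsto (\<lambda>N. (- desc_prod n (Q N \<omega>) 1 l) @\<^sub>c 1\<^sub>m n) ((- (A ^\<^sub>m T)) @\<^sub>c 1\<^sub>m n)" .
    note Rc = append_cols_carrier[OF AT' one_carrier_mat[of n]]
    have xx: "x0 @\<^sub>v xf \<in> carrier_vec (n + n)" using endpoints by simp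
    have Rx: "((- (A ^\<^sub>m T)) @\<^sub>c 1\<^sub>m n) *\<^sub>v (x0 @\<^sub>v xf) = xf - A ^\<^sub>m T *\<^sub>v x0"
    proof -
      have "((- (A ^\<^sub>m T)) @\<^sub>c 1\<^sub>m n) *\<^sub>v (x0 @\<^sub>v xf) = - (A ^\<^sub>m T) *\<^sub>v x0 + 1\<^sub>m n *\<^sub>v xf"
        by (rule append_cols_mult_vec[OF AT' one_carrier_mat endpoints(1,2)])
      also have "\<dots> = xf - A ^\<^sub>m T *\<^sub>v x0"
        using carrier_matD[OF AT] carrier_vecD[OF endpoints(1)] carrier_vecD[OF endpoints(2)] endpoints(2)
        by (intro eq_vecI) (auto simp: scalar_prod_def sum_negf)
      finally show ?thesis .
    qed
    have b: "vec_tendsto (\<lambda>N. ((- desc_prod n (Q N \<omega>) 1 l) @\<^sub>c 1\<^sub>m n) *\<^sub>v (x0 @\<^sub>v xf)) (xf - A ^\<^sub>m T *\<^sub>v x0)"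
      using vec_tendsto_mult_mat_vec[OF R Rc vec_tendsto_const xx] unfolding Rx .
    have d: "xf - A ^\<^sub>m T *\<^sub>v x0 \<in> carrier_vec n"
      using mult_mat_vec_carrier[OF AT endpoints(1)] endpoints(2) by simp
    show ?case unfolding control_est_def
      by (rule vec_tendsto_mult_mat_vec[OF pinv pinv_carrier[OF C] b d])
  qed
qed

end
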